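(* Let $T>0$ and $X_T=(0,1)\times(0,T)$. Let $b\in\mathcal{G}_{H^\infty(X_T)}$ and $c\in\mathcal{G}_{H^\infty((0,1))}$ be of slow scale in all derivatives. Assume further that $c$ possesses a representative $(c_\varepsilon)_\varepsilon$ for which there are real constants $c_1>c_0>0$ with $0<c_0\le c_\varepsilon(x)\le c_1$ for all $x\in(0,1)$, $\varepsilon\in(0,1]$, and that $b$ is of slow scale $L^\infty$-log-type, i.e. for some (hence any) representative $(b_\varepsilon)_\varepsilon$ of $b$ there exist a slow scale net $(r_\varepsilon)_\varepsilon$ with $r_\varepsilon\ge1$ and $\varepsilon_0\in(0,1]$ such that $$\|b_\varepsilon\|_{L^\infty(X_T)}\le\log(r_\varepsilon)\qquad(0<\varepsilon\le\varepsilon_0).$$ If $f_1\in\mathcal{G}^\infty_{H^\infty((0,1))}$ satisfies $f_1(0)=f_1(1)=0$ (as generalized numbers), $f_2\in\mathcal{G}^\infty_{H^\infty((0,1))}$, and $g\in\mathcal{G}^\infty_{H^\infty(X_T)}$, then the unique Colombeau solution $u\in\mathcal{G}_{H^\infty(X_T)}$ to the initial-boundary value problem $$\partial_t^2u+\partial_x^2\big(c\,\partial_x^2u\big)+b\,\partial_x^2u=g,\qquad u|_{t=0}=f_1,\quad\partial_tu|_{t=0}=f_2,$$ $$u|_{x=0}=u|_{x=1}=0,\qquad\partial_xu|_{x=0}=\partial_xu|_{x=1}=0$$ belongs to $\mathcal{G}^\infty_{H^\infty(X_T)}$.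
   Context: For $\Omega=X_T$ or $\Omega=(0,1)$, $H^\infty(\Omega)$ denotes the space of smooth functions on $\Omega$ all of whose derivatives belong to $L^2(\Omega)$ (such functions are smooth up to the boundary). All nets are indexed by $\varepsilon\in(0,1]$. Moderate families: $\mathcal{E}_{M,H^\infty(\Omega)}$ is the set of families $(u_\varepsilon)_\varepsilon$ in $H^\infty(\Omega)$ such that for every multi-index $\alpha$ there is $p\ge0$ with $\|\partial^\alpha u_\varepsilon\|_{L^2(\Omega)}=O(\varepsilon^{-p})$ as $\varepsilon\to0$. Null families: $\mathcal{N}_{H^\infty(\Omega)}$ is the set of moderate families with $\|u_\varepsilon\|_{L^2(\Omega)}=O(\varepsilon^q)$ for every $q\ge0$ (equivalently, the same holds for all derivatives). The Colombeau algebra is $\mathcal{G}_{H^\infty(\Omega)}=\mathcal{E}_{M,H^\infty(\Omega)}/\mathcal{N}_{H^\infty(\Omega)}$; $[(u_\varepsilon)_\varepsilon]$ denotes the class of $(u_\varepsilon)_\varepsilon$. Products and derivatives are defined $\varepsilon$-wise on representatives; elements of $\mathcal{G}_{H^\infty((0,1))}$ are regarded as elements of $\mathcal{G}_{H^\infty(X_T)}$ (independent of $t$). Regular elements: $u=[(u_\varepsilon)_\varepsilon]\in\mathcal{G}_{H^\infty(\Omega)}$ belongs to $\mathcal{G}^\infty_{H^\infty(\Omega)}$ if and only if there exists $p\ge0$ such that for all multi-indices $\alpha$, $\|\partial^\alpha u_\varepsilon\|_{L^2(\Omega)}=O(\varepsilon^{-p})$ as $\varepsilon\to0$ ($p$ uniform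 in $\alpha$). Slow scale: a net $(r_\varepsilon)_{\varepsilon\in(0,1]}$ of complex numbers is of slow scale if for all $p\in\mathbb{N}$, $|r_\varepsilon|^p=O(\varepsilon^{-1})$ as $\varepsilon\to0$. $v=[(v_\varepsilon)_\varepsilon]\in\mathcal{G}_{H^\infty(\Omega)}$ is of slow scale in all derivatives if the net $(\|\partial^\alpha v_\varepsilon\|_{L^2(\Omega)})_\varepsilon$ is of slow scale for all multi-indices $\alpha$. Restrictions: for $u=[(u_\varepsilon)_\varepsilon]\in\mathcal{G}_{H^\infty(X_T)}$, $u|_{t=0}\in\mathcal{G}_{H^\infty((0,1))}$ is the class of $(u_\varepsilon(\cdot,0))_\varepsilon$; restrictions to $x=0$ and $x=1$ are likewise defined by restricting representatives. For $v=[(v_\varepsilon)_\varepsilon]\in\mathcal{G}_{H^\infty((0,1))}$, "$v(0)=0$ as generalized numbers" means $|v_\varepsilon(0)|=O(\varepsilon^q)$ as $\varepsilon\to0$ for all $q\ge0$; similarly for $v(1)$. Existence and uniqueness of the solution $u\in\mathcal{G}_{H^\infty(X_T)}$ is asserted by the paper whenever $c$ possesses a representative $(c_\varepsilon)_\varepsilon$ for which there are real constants $c_1>c_0>0$ with $0<c_0\le c_\varepsilon(x)\le c_1$ for all $x\in(0,1)$, $\varepsilon\in(0,1]$, $f_1(0)=f_1(1)=0$, and $b$ is of $L^\infty$-log-type, i.e. $\|b_\varepsilon\|_{L^\infty(X_T)}\le N\log(1/\varepsilon)$ for some $N\in\mathbb{N}$ and all small $\varepsilon$ (which is implied by slow scale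 $L^\infty$-log-type). *)

theory Defs
  imports "HOL-Analysis.Analysis" "HOL-Library.Landau_Symbols" "HOL-Probability.Essential_Supremum"
begin

section \<open>Smooth functions with square integrable derivatives\<close>

text \<open>
  A function on an open set \<open>\<Omega>\<close> is a total function of which only the values on \<open>\<Omega>\<close> matter; all
  functions are complex valued.  A multi-index is a list of basis vectors, the directions of
  successive differentiation.  For smooth functions the order of the list is irrelevant, so that
  these are exactly the derivatives \<open>\<partial>\<^sup>\<alpha>\<close> with \<open>\<alpha>\<close> counting the occurrences of each basis vector.
\<close>

definition pd :: "'a::euclidean_space \<Rightarrow> ('a \<Rightarrow> complex) \<Rightarrow> 'a \<Rightarrow> complex" where
  "pd i f x = frechet_derivative f (at x) i"

definition multi_pd :: "'a::euclidean_space list \<Rightarrow> ('a \<Rightarrow> complex) \<Rightarrow> 'a \<Rightarrow> complex" where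
  "multi_pd \<alpha> f = foldr pd \<alpha> f"

definition smooth_fun_on :: "'a::euclidean_space set \<Rightarrow> ('a \<Rightarrow> complex) \<Rightarrow> bool" where
  "smooth_fun_on \<Omega> f \<longleftrightarrow> (\<forall>\<alpha>\<in>lists Basis. multi_pd \<alpha> f differentiable_on \<Omega>)"

definition L2norm :: "'a::euclidean_space set \<Rightarrow> ('a \<Rightarrow> complex) \<Rightarrow> real" where
  "L2norm \<Omega> f = sqrt (LINT x:\<Omega>|lborel. (norm (f x))\<^sup>2)"

definition Linf_norm :: "'a::euclidean_space set \<Rightarrow> ('a \<Rightarrow> complex) \<Rightarrow> ereal" where
  "Linf_norm \<Omega> f = esssup (restrict_space lborel \<Omega>) (\<lambda>x. ereal (norm (f x)))"

definition H_infty :: "'a::euclidean_space set \<Rightarrow> ('a \<Rightarrow> complex) set" where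
  "H_infty \<Omega> = {f. smooth_fun_on \<Omega> f \<and>
     (\<forall>\<alpha>\<in>lists Basis. set_integrable lborel \<Omega> (\<lambda>x. (norm (multi_pd \<alpha> f x))\<^sup>2))}"

text \<open>
  The value at a boundary point of a function given on \<open>\<Omega>\<close> and smooth up to the boundary.
\<close>

definition bval :: "'a::euclidean_space set \<Rightarrow> ('a \<Rightarrow> complex) \<Rightarrow> 'a \<Rightarrow> complex" where
  "bval \<Omega> f y = Lim (at y within \<Omega>) f"


section \<open>Colombeau algebras\<close>

text \<open>
  Families are indexed by \<open>\<epsilon> \<in> {0<..1}\<close>; their values at other \<open>\<epsilon>\<close> play no role.
\<close>

type_synonym 'a family = "real \<Rightarrow> 'a \<Rightarrow> complex"

type_synonym 'a gfun = "'a family set"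

definition moderate :: "'a::euclidean_space set \<Rightarrow> 'a family set" where
  "moderate \<Omega> = {u. (\<forall>\<epsilon>\<in>{0<..1}. u \<epsilon> \<in> H_infty \<Omega>) \<and>
     (\<forall>\<alpha>\<in>lists Basis. \<exists>p\<ge>0. (\<lambda>\<epsilon>. L2norm \<Omega> (multi_pd \<alpha> (u \<epsilon>))) \<in> O[at_right 0](\<lambda>\<epsilon>. \<epsilon> powr (- p)))}"

definition null_fam :: "'a::euclidean_space set \<Rightarrow> 'a family set" where
  "null_fam \<Omega> = {u \<in> moderate \<Omega>.
     \<forall>q\<ge>0. (\<lambda>\<epsilon>. L2norm \<Omega> (u \<epsilon>)) \<in> O[at_right 0](\<lambda>\<epsilon>. \<epsilon> powr q)}"

definition null_rel :: "'a::euclidean_space set \<Rightarrow> ('a family \<times> 'a family) set" where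
  "null_rel \<Omega> = {(u, v). u \<in> moderate \<Omega> \<and> v \<in> moderate \<Omega> \<and> (\<lambda>\<epsilon> x. u \<epsilon> x - v \<epsilon> x) \<in> null_fam \<Omega>}"

definition colombeau :: "'a::euclidean_space set \<Rightarrow> 'a gfun set" where
  "colombeau \<Omega> = moderate \<Omega> // null_rel \<Omega>"

definition gclass :: "'a::euclidean_space set \<Rightarrow> 'a family \<Rightarrow> 'a gfun" where
  "gclass \<Omega> u = null_rel \<Omega> `` {u}"

text \<open>
  Operations on classes are the \<open>\<epsilon>\<close>-wise operations on representatives, the results being
  classes over \<open>\<Omega>'\<close>.
\<close>

definition glift :: "'b::euclidean_space set \<Rightarrow> (('a \<Rightarrow> complex) \<Rightarrow> 'b \<Rightarrow> complex) \<Rightarrow> 'a gfun \<Rightarrow> 'b gfun" where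
  "glift \<Omega>' F U = (\<Union>u\<in>U. gclass \<Omega>' (\<lambda>\<epsilon>. F (u \<epsilon>)))"

definition glift2 :: "'a::euclidean_space set \<Rightarrow> (complex \<Rightarrow> complex \<Rightarrow> complex) \<Rightarrow> 'a gfun \<Rightarrow> 'a gfun \<Rightarrow> 'a gfun" where
  "glift2 \<Omega> op U V = (\<Union>u\<in>U. \<Union>v\<in>V. gclass \<Omega> (\<lambda>\<epsilon> x. op (u \<epsilon> x) (v \<epsilon> x)))"

definition gzero :: "'a::euclidean_space set \<Rightarrow> 'a gfun" where
  "gzero \<Omega> = gclass \<Omega> (\<lambda>\<epsilon> x. 0)"

definition gadd :: "'a::euclidean_space set \<Rightarrow> 'a gfun \<Rightarrow> 'a gfun \<Rightarrow> 'a gfun" where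
  "gadd \<Omega> = glift2 \<Omega> (+)"

definition gmult :: "'a::euclidean_space set \<Rightarrow> 'a gfun \<Rightarrow> 'a gfun \<Rightarrow> 'a gfun" where
  "gmult \<Omega> = glift2 \<Omega> (*)"

definition gpd :: "'a::euclidean_space set \<Rightarrow> 'a \<Rightarrow> 'a gfun \<Rightarrow> 'a gfun" where
  "gpd \<Omega> i = glift \<Omega> (pd i)"

definition regular :: "'a::euclidean_space set \<Rightarrow> 'a gfun set" where
  "regular \<Omega> = {U \<in> colombeau \<Omega>. \<exists>u\<in>U. \<exists>p\<ge>0. \<forall>\<alpha>\<in>lists Basis.
     (\<lambda>\<epsilon>. L2norm \<Omega> (multi_pd \<alpha> (u \<epsilon>))) \<in> O[at_right 0](\<lambda>\<epsilon>. \<epsilon> powr (- p))}"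

definition slow_scale :: "(real \<Rightarrow> 'b::real_normed_vector) \<Rightarrow> bool" where
  "slow_scale r \<longleftrightarrow> (\<forall>p::nat. (\<lambda>\<epsilon>. norm (r \<epsilon>) ^ p) \<in> O[at_right 0](\<lambda>\<epsilon>. 1 / \<epsilon>))"

definition slow_scale_derivs :: "'a::euclidean_space set \<Rightarrow> 'a gfun \<Rightarrow> bool" where
  "slow_scale_derivs \<Omega> V \<longleftrightarrow>
     (\<exists>v\<in>V. \<forall>\<alpha>\<in>lists Basis. slow_scale (\<lambda>\<epsilon>. L2norm \<Omega> (multi_pd \<alpha> (v \<epsilon>))))"

definition slow_scale_log_type :: "'a::euclidean_space set \<Rightarrow> 'a gfun \<Rightarrow> bool" where
  "slow_scale_log_type \<Omega> B \<longleftrightarrow>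
     (\<exists>b\<in>B. \<exists>r :: real \<Rightarrow> real. slow_scale r \<and> (\<forall>\<epsilon>\<in>{0<..1}. r \<epsilon> \<ge> 1) \<and>
        (\<exists>\<epsilon>0\<in>{0<..1}. \<forall>\<epsilon>\<in>{0<..\<epsilon>0}. Linf_norm \<Omega> (b \<epsilon>) \<le> ereal (ln (r \<epsilon>))))"

definition bounded_positive :: "'a::euclidean_space set \<Rightarrow> 'a gfun \<Rightarrow> bool" where
  "bounded_positive \<Omega> C \<longleftrightarrow>
     (\<exists>c\<in>C. \<exists>c0 c1 :: real. 0 < c0 \<and> c0 < c1 \<and>
        (\<forall>\<epsilon>\<in>{0<..1}. \<forall>x\<in>\<Omega>. c \<epsilon> x \<in> \<real> \<and> c0 \<le> Re (c \<epsilon> x) \<and> Re (c \<epsilon> x) \<le> c1))"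

text \<open>
  The boundary value of \<open>V\<close> at the point \<open>y\<close> vanishes as a generalized number.
\<close>

definition gvanishes_at :: "'a::euclidean_space set \<Rightarrow> 'a gfun \<Rightarrow> 'a \<Rightarrow> bool" where
  "gvanishes_at \<Omega> V y \<longleftrightarrow>
     (\<exists>v\<in>V. \<forall>q\<ge>0. (\<lambda>\<epsilon>. norm (bval \<Omega> (v \<epsilon>) y)) \<in> O[at_right 0](\<lambda>\<epsilon>. \<epsilon> powr q))"


section \<open>The initial-boundary value problem\<close>

text \<open>
  Points of the space-time domain are pairs \<open>(x, t)\<close>.
\<close>

abbreviation I01 :: "real set" where
  "I01 \<equiv> {0<..<1}"

definition X_dom :: "real \<Rightarrow> (real \<times> real) set" where
  "X_dom T = I01 \<times> {0<..<T}"

abbreviation gdx :: "real \<Rightarrow> (real \<times> real) gfun \<Rightarrow> (real \<times> real) gfun" where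
  "gdx T \<equiv> gpd (X_dom T) (1, 0)"

abbreviation gdt :: "real \<Rightarrow> (real \<times> real) gfun \<Rightarrow> (real \<times> real) gfun" where
  "gdt T \<equiv> gpd (X_dom T) (0, 1)"

definition restrict_t0 :: "real \<Rightarrow> (real \<times> real) gfun \<Rightarrow> real gfun" where
  "restrict_t0 T = glift I01 (\<lambda>f x. bval (X_dom T) f (x, 0))"

text \<open>
  Restriction to \<open>x = a\<close>, for \<open>a = 0\<close> and \<open>a = 1\<close>.
\<close>

definition restrict_x :: "real \<Rightarrow> real \<Rightarrow> (real \<times> real) gfun \<Rightarrow> real gfun" where
  "restrict_x T a = glift {0<..<T} (\<lambda>f t. bval (X_dom T) f (a, t))"

definition embed_x :: "real \<Rightarrow> real gfun \<Rightarrow> (real \<times> real) gfun" where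
  "embed_x T = glift (X_dom T) (\<lambda>f (x, t). f x)"

definition colombeau_solution ::
  "real \<Rightarrow> (real \<times> real) gfun \<Rightarrow> real gfun \<Rightarrow> (real \<times> real) gfun \<Rightarrow> real gfun \<Rightarrow> real gfun
     \<Rightarrow> (real \<times> real) gfun \<Rightarrow> bool" where
  "colombeau_solution T b c g f1 f2 u \<longleftrightarrow>
     u \<in> colombeau (X_dom T) \<and>
     gadd (X_dom T)
       (gadd (X_dom T)
         (gdt T (gdt T u))
         (gdx T (gdx T (gmult (X_dom T) (embed_x T c) (gdx T (gdx T u))))))
       (gmult (X_dom T) b (gdx T (gdx T u))) = g \<and>
     restrict_t0 T u = f1 \<and>
     restrict_t0 T (gdt T u) = f2 \<and>
     restrict_x T 0 u = gzero {0<..<T} \<and>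
     restrict_x T 1 u = gzero {0<..<T} \<and>
     restrict_x T 0 (gdx T u) = gzero {0<..<T} \<and>
     restrict_x T 1 (gdx T u) = gzero {0<..<T}"

end

theory Submission
  imports Defs
begin

text \<open>
  Why the solution is regular. Since the data \<open>f1\<close>, \<open>f2\<close> and \<open>g\<close> are regular, one number \<open>P\<close> bounds
  the orders of growth of all their derivatives. The point is that every estimate for the solution
  multiplies the data only by slow scale nets. With the notion of order used here (\<open>net_order\<close>),
  which allows a loss of an arbitrarily small power of \<open>1 / \<epsilon>\<close>, such a multiplication does not
  change the order at all. Any number of estimates may therefore be chained, one for each
  derivative, and the order stays \<open>P\<close>.

  The \<open>k\<close>-th time derivative \<open>v\<close> of \<open>u\<close> solves the equation of \<open>u\<close> with another right-hand side: the
  derivative of \<open>g\<close> and products of derivatives of \<open>b\<close> with second space derivatives of time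
  derivatives of lower order (\<open>slice_growth_Ht\<close>). The energy, the integral over the space variable
  of \<open>(norm (dt v))\<^sup>2 + c * (norm (dx (dx v)))\<^sup>2 + (norm v)\<^sup>2\<close>, satisfies Gronwall's inequality
  (\<open>energy_inequality\<close>), and the exponential factor is a power of \<open>r \<epsilon>\<close> because \<open>norm b \<le> ln (r \<epsilon>)\<close>.
  This is where the slow scale logarithmic type of \<open>b\<close> matters: it makes the factor a slow scale
  net. The initial values of the derivatives have order \<open>P\<close>, since the equation reduces time
  derivatives at the initial time to derivatives of \<open>f1\<close>, \<open>f2\<close>, \<open>g\<close> and the coefficients
  (\<open>growth_initial\<close>). The boundary terms of the integration by parts contain boundary values of time
  derivatives of \<open>u\<close> and \<open>dx u\<close>, which are negligible, multiplied by moderate factors. Induction on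
  \<open>k\<close> bounds all time derivatives (\<open>energy_estimate\<close>).

  For the space derivatives let \<open>W = c * dx (dx u)\<close>. The equation expresses \<open>dx (dx W)\<close> by \<open>g\<close>, by
  time derivatives of \<open>u\<close> and by \<open>b * dx (dx u)\<close>; an interpolation inequality (\<open>interpolation\<close>)
  gives \<open>dx W\<close> and suprema in place of mean squares. Division by \<open>c\<close>, which is bounded below, leads
  back from \<open>W\<close> to \<open>u\<close> and gains two space derivatives, and the equation returns from \<open>u\<close> to \<open>W\<close>; an
  induction on the number of space derivatives alternates between these two steps
  (\<open>growth_u_of_growth_W\<close>, \<open>growth_W_of_growth_u\<close>).

  Two preparations make this rigorous for classes of families. First, Sobolev's inequality on boxes
  allows suprema in place of \<open>L\<^sup>2\<close> norms, and all derivatives of a null family are negligible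
  (\<open>growth_multi_pd_null\<close>); so every estimate of derivatives carries over from one representative to
  another, and the problem for classes gives a problem for one family. Secondly, the functions are
  smooth only in the open domain, while data and boundary conditions are limits at its boundary. The
  energy estimates therefore take place at a positive but negligible distance \<open>h \<epsilon>\<close> from the lateral
  sides and from the initial side: since Lipschitz constants are moderate, the values there differ
  negligibly from the boundary values (\<open>growth_near_side\<close>).
\<close>

section \<open>Calculus of iterated partial derivatives\<close>

lemma multi_pd_Nil [simp]: "multi_pd [] f = f"
  by (simp add: multi_pd_def)

lemma multi_pd_Cons [simp]: "multi_pd (i # \<alpha>) f = pd i (multi_pd \<alpha> f)"
  by (simp add: multi_pd_def)

lemma multi_pd_append: "multi_pd (\<alpha> @ \<beta>) f = multi_pd \<alpha> (multi_pd \<beta> f)"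
  by (simp add: multi_pd_def)

text \<open>Functions are total, but only their values on an open set matter for derivatives there; identities
  between functions below are therefore pointwise identities on the domain.\<close>

lemma pd_cong:
  assumes "open S" "x \<in> S" "\<And>y. y \<in> S \<Longrightarrow> f y = g y"
  shows "pd i f x = pd i g x"
proof -
  have "(f has_derivative D) (at x) \<longleftrightarrow> (g has_derivative D) (at x)" for D
    using has_derivative_transform_within_open[of f D x UNIV S g]
      has_derivative_transform_within_open[of g D x UNIV S f] assms by auto
  then show ?thesis
    by (simp add: pd_def frechet_derivative_def)
qed

lemma multi_pd_cong:
  assumes "open S" "\<And>y. y \<in> S \<Longrightarrow> f y = g y" "x \<in> S"
  shows "multi_pd \<alpha> f x = multi_pd \<alpha> g x"
  using assms(3)
proof (induction \<alpha> arbitrary: x)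
  case Nil
  then show ?case using assms by simp
next
  case (Cons i \<alpha>)
  show ?case
    using pd_cong[OF assms(1) Cons.prems, of "multi_pd \<alpha> f" "multi_pd \<alpha> g"] Cons.IH by simp
qed

lemma pd_eqI: "(f has_derivative D) (at x) \<Longrightarrow> pd i f x = D i"
  by (metis frechet_derivative_at pd_def)

lemma differentiable_cong_open:
  assumes "open S" "x \<in> S" "\<And>y. y \<in> S \<Longrightarrow> f y = g y" "f differentiable at x"
  shows "g differentiable at x"
  using assms has_derivative_transform_within_open[of f _ x UNIV S g]
  unfolding differentiable_def by blast

lemma pd_add:
  assumes "f differentiable at x" "g differentiable at x"
  shows "pd i (\<lambda>x. f x + g x) x = pd i f x + pd i g x"
  using pd_eqI[OF has_derivative_add] assms
  unfolding frechet_derivative_works pd_def by blast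

lemma pd_diff:
  assumes "f differentiable at x" "g differentiable at x"
  shows "pd i (\<lambda>x. f x - g x) x = pd i f x - pd i g x"
  using pd_eqI[OF has_derivative_diff] assms
  unfolding frechet_derivative_works pd_def by blast

lemma pd_mult:
  assumes "f differentiable at x" "g differentiable at x"
  shows "pd i (\<lambda>x. f x * g x) x = pd i f x * g x + f x * pd i g x"
  using pd_eqI[OF has_derivative_mult, of f _ x g _ i] assms
  unfolding frechet_derivative_works pd_def by fastforce

lemma pd_const [simp]: "pd i (\<lambda>x. k) = (\<lambda>x. 0)"
  using pd_eqI[OF has_derivative_const] by blast

lemma has_derivative_pd: "f differentiable at x \<Longrightarrow> (f has_derivative (\<lambda>v. pd v f x)) (at x)"
  unfolding pd_def frechet_derivative_works .

lemma pd_line: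
  assumes "f differentiable at (p + s *\<^sub>R e)"
  shows "((\<lambda>s. f (p + s *\<^sub>R e)) has_vector_derivative pd e f (p + s *\<^sub>R e)) (at s)"
proof -
  have D: "(f has_derivative (\<lambda>v. pd v f (p + s *\<^sub>R e))) (at (p + s *\<^sub>R e))"
    by (rule has_derivative_pd[OF assms])
  have "((\<lambda>s. f (p + s *\<^sub>R e)) has_derivative (\<lambda>h. pd (h *\<^sub>R e) f (p + s *\<^sub>R e))) (at s)"
    by (rule has_derivative_compose[of "\<lambda>s. p + s *\<^sub>R e" "\<lambda>h. h *\<^sub>R e" s UNIV f, OF _ D])
      (auto intro!: derivative_eq_intros)
  moreover have "pd (h *\<^sub>R e) f (p + s *\<^sub>R e) = h *\<^sub>R pd e f (p + s *\<^sub>R e)" for h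
    using has_derivative_linear[OF D] by (rule linear_scale)
  ultimately show ?thesis by (simp add: has_vector_derivative_def)
qed

lemma norm_diff_le_of_vector_derivative:
  fixes \<phi> :: "real \<Rightarrow> 'b::real_normed_vector"
  assumes "0 \<le> h" "\<And>s. 0 \<le> s \<Longrightarrow> s \<le> h \<Longrightarrow> (\<phi> has_vector_derivative \<phi>' s) (at s)"
    and "\<And>s. 0 \<le> s \<Longrightarrow> s \<le> h \<Longrightarrow> norm (\<phi>' s) \<le> B"
  shows "norm (\<phi> h - \<phi> 0) \<le> B * h"
proof -
  have "norm (\<phi> h - \<phi> 0) \<le> B * norm (h - 0)"
  proof (rule differentiable_bound[where S="{0..h}"])
    fix s assume s: "s \<in> {0..h}"
    show "(\<phi> has_derivative (\<lambda>t. t *\<^sub>R \<phi>' s)) (at s within {0..h})"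
      using assms(2)[of s] s unfolding has_vector_derivative_def
      by (auto intro: has_derivative_at_withinI)
    show "onorm (\<lambda>t. t *\<^sub>R \<phi>' s) \<le> B"
      using assms(3)[of s] s by (intro onorm_le) (simp add: mult.commute[of B] mult_left_mono)
  qed (use assms(1) in auto)
  then show ?thesis using assms(1) by simp
qed

text \<open>Continuity of both mixed derivatives at the point suffices: a double difference of \<open>f\<close> over a
  small square is, up to an error of smaller order than the area, the area times either of them.\<close>

lemma double_difference:
  fixes f :: "'a::euclidean_space \<Rightarrow> complex"
  assumes S: "open S" "x \<in> S"
    and d1: "\<And>y. y \<in> S \<Longrightarrow> f differentiable at y"
    and d2: "\<And>y. y \<in> S \<Longrightarrow> pd i f differentiable at y"
    and cont: "isCont (pd j (pd i f)) x" and \<eta>: "0 < \<eta>"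
  shows "\<exists>d>0. \<forall>h. 0 < h \<and> h < d \<longrightarrow>
    norm (f (x + h *\<^sub>R i + h *\<^sub>R j) - f (x + h *\<^sub>R i) - f (x + h *\<^sub>R j) + f x
          - (h * h) *\<^sub>R pd j (pd i f) x) \<le> \<eta> * (h * h)"
proof -
  let ?A = "pd j (pd i f) x"
  obtain r0 where r0: "r0 > 0" "ball x r0 \<subseteq> S" using S openE by blast
  obtain r1 where r1: "r1 > 0" "\<And>y. dist y x < r1 \<Longrightarrow> dist (pd j (pd i f) y) ?A < \<eta>"
    using cont \<eta> unfolding continuous_at_eps_delta by meson
  define r where "r = min r0 r1"
  define d where "d = r / (norm i + norm j + 1)"
  have dpos: "d > 0" using r0 r1 by (simp add: d_def r_def add_nonneg_pos)
  have near: "dist (x + s *\<^sub>R i + t *\<^sub>R j) x < r" if "0 \<le> s" "s < d" "0 \<le> t" "t < d" for s t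
  proof -
    have "dist (x + s *\<^sub>R i + t *\<^sub>R j) x = norm (s *\<^sub>R i + t *\<^sub>R j)"
      by (simp add: dist_norm add.assoc)
    also have "\<dots> \<le> s * norm i + t * norm j"
      using norm_triangle_ineq[of "s *\<^sub>R i" "t *\<^sub>R j"] that by simp
    also have "\<dots> \<le> d * norm i + d * norm j"
      using that by (intro add_mono mult_right_mono) auto
    also have "\<dots> < d * (norm i + norm j + 1)" using dpos by (simp add: algebra_simps)
    also have "\<dots> = r"
    proof -
      have "norm i + norm j + 1 \<noteq> 0" using norm_ge_zero[of i] norm_ge_zero[of j] by linarith
      then show ?thesis by (simp add: d_def)
    qed
    finally show ?thesis .
  qed
  have inS: "x + s *\<^sub>R i + t *\<^sub>R j \<in> S" if "0 \<le> s" "s < d" "0 \<le> t" "t < d" for s t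
    using near[OF that] r0(2) by (auto simp: r_def dist_commute subset_iff)
  have close: "norm (pd j (pd i f) (x + s *\<^sub>R i + t *\<^sub>R j) - ?A) \<le> \<eta>"
    if "0 \<le> s" "s < d" "0 \<le> t" "t < d" for s t
    using r1(2)[of "x + s *\<^sub>R i + t *\<^sub>R j"] near[OF that] by (simp add: r_def dist_norm)
  have main: "norm (f (x + h *\<^sub>R i + h *\<^sub>R j) - f (x + h *\<^sub>R i) - f (x + h *\<^sub>R j) + f x
          - (h * h) *\<^sub>R ?A) \<le> \<eta> * (h * h)" if h: "0 < h" "h < d" for h
  proof -
    define \<phi> where "\<phi> s = f (x + s *\<^sub>R i + h *\<^sub>R j) - f (x + s *\<^sub>R i) - s *\<^sub>R (h *\<^sub>R ?A)" for s
    define \<phi>' where "\<phi>' s = pd i f (x + s *\<^sub>R i + h *\<^sub>R j) - pd i f (x + s *\<^sub>R i) - h *\<^sub>R ?A" for s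
    have der: "(\<phi> has_vector_derivative \<phi>' s) (at s)" if "0 \<le> s" "s \<le> h" for s
    proof -
      have "((\<lambda>s. f ((x + h *\<^sub>R j) + s *\<^sub>R i)) has_vector_derivative pd i f ((x + h *\<^sub>R j) + s *\<^sub>R i)) (at s)"
        using inS[of s h] that h by (intro pd_line d1) (auto simp: algebra_simps)
      moreover have "((\<lambda>s. f (x + s *\<^sub>R i)) has_vector_derivative pd i f (x + s *\<^sub>R i)) (at s)"
        using inS[of s 0] that h by (intro pd_line d1) auto
      ultimately show ?thesis unfolding \<phi>_def \<phi>'_def
        by (auto intro!: derivative_eq_intros simp: algebra_simps)
    qed
    have bd: "norm (\<phi>' s) \<le> \<eta> * h" if s: "0 \<le> s" "s \<le> h" for s
    proof -
      define \<psi> where "\<psi> t = pd i f (x + s *\<^sub>R i + t *\<^sub>R j) - t *\<^sub>R ?A" for t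
      have "norm (\<psi> h - \<psi> 0) \<le> \<eta> * h"
      proof (rule norm_diff_le_of_vector_derivative)
        fix t assume t: "0 \<le> t" "t \<le> h"
        have "((\<lambda>t. pd i f ((x + s *\<^sub>R i) + t *\<^sub>R j)) has_vector_derivative
            pd j (pd i f) ((x + s *\<^sub>R i) + t *\<^sub>R j)) (at t)"
          using inS[of s t] t s h by (intro pd_line d2) auto
        then show "(\<psi> has_vector_derivative (pd j (pd i f) (x + s *\<^sub>R i + t *\<^sub>R j) - ?A)) (at t)"
          unfolding \<psi>_def by (auto intro!: derivative_eq_intros)
        show "norm (pd j (pd i f) (x + s *\<^sub>R i + t *\<^sub>R j) - ?A) \<le> \<eta>"
          using close[of s t] s t h by auto
      qed (use h in auto)
      then show ?thesis by (simp add: \<psi>_def \<phi>'_def algebra_simps)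
    qed
    have "norm (\<phi> h - \<phi> 0) \<le> (\<eta> * h) * h"
      by (rule norm_diff_le_of_vector_derivative[where \<phi>'=\<phi>', OF _ der bd]) (use h in auto)
    then show ?thesis by (simp add: \<phi>_def algebra_simps)
  qed
  show ?thesis using dpos main by blast
qed

text \<open>Schwarz's theorem: the double difference is symmetric in the two directions.\<close>

lemma pd_commute:
  fixes f :: "'a::euclidean_space \<Rightarrow> complex"
  assumes S: "open S" "x \<in> S"
    and "\<And>y. y \<in> S \<Longrightarrow> f differentiable at y"
    and "\<And>y. y \<in> S \<Longrightarrow> pd i f differentiable at y"
    and "\<And>y. y \<in> S \<Longrightarrow> pd j f differentiable at y"
    and "isCont (pd j (pd i f)) x" "isCont (pd i (pd j f)) x"
  shows "pd j (pd i f) x = pd i (pd j f) x"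
proof (rule ccontr)
  let ?A = "pd j (pd i f) x" and ?B = "pd i (pd j f) x"
  assume "?A \<noteq> ?B"
  define \<eta> where "\<eta> = norm (?A - ?B) / 3"
  have \<eta>: "\<eta> > 0" using \<open>?A \<noteq> ?B\<close> by (simp add: \<eta>_def)
  define \<Delta> where "\<Delta> h = f (x + h *\<^sub>R i + h *\<^sub>R j) - f (x + h *\<^sub>R i) - f (x + h *\<^sub>R j) + f x" for h
  obtain d1 where d1: "d1 > 0" "\<And>h. 0 < h \<Longrightarrow> h < d1 \<Longrightarrow> norm (\<Delta> h - (h * h) *\<^sub>R ?A) \<le> \<eta> * (h * h)"
    using double_difference[OF S assms(3,4,6) \<eta>] unfolding \<Delta>_def by blast
  obtain d2 where d2: "d2 > 0" "\<And>h. 0 < h \<Longrightarrow> h < d2 \<Longrightarrow>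
      norm (f (x + h *\<^sub>R j + h *\<^sub>R i) - f (x + h *\<^sub>R j) - f (x + h *\<^sub>R i) + f x - (h * h) *\<^sub>R ?B) \<le> \<eta> * (h * h)"
    using double_difference[OF S assms(3,5,7) \<eta>] by blast
  define h where "h = min d1 d2 / 2"
  have h: "0 < h" "h < d1" "h < d2" using d1(1) d2(1) by (auto simp: h_def)
  have sw: "f (x + h *\<^sub>R j + h *\<^sub>R i) - f (x + h *\<^sub>R j) - f (x + h *\<^sub>R i) + f x = \<Delta> h"
    by (simp add: \<Delta>_def algebra_simps)
  have "(h * h) *\<^sub>R (?A - ?B) = (\<Delta> h - (h * h) *\<^sub>R ?B) - (\<Delta> h - (h * h) *\<^sub>R ?A)"
    by (simp add: algebra_simps)
  then have "(h * h) * norm (?A - ?B) \<le> norm (\<Delta> h - (h * h) *\<^sub>R ?B) + norm (\<Delta> h - (h * h) *\<^sub>R ?A)"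
    by (metis norm_triangle_ineq4 abs_mult_self_eq norm_scaleR abs_mult)
  also have "\<dots> \<le> \<eta> * (h * h) + \<eta> * (h * h)"
    using d1(2)[OF h(1,2)] d2(2)[OF h(1,3)] unfolding sw by (intro add_mono)
  finally have "norm (?A - ?B) \<le> 2 * \<eta>" using h by (simp add: algebra_simps)
  then show False using \<eta> by (simp add: \<eta>_def)
qed

section \<open>Smooth functions on open sets\<close>

lemma smooth_differentiable:
  "open \<Omega> \<Longrightarrow> smooth_fun_on \<Omega> f \<Longrightarrow> \<alpha> \<in> lists Basis \<Longrightarrow> x \<in> \<Omega> \<Longrightarrow> multi_pd \<alpha> f differentiable at x"
  by (metis differentiable_on_def smooth_fun_on_def at_within_open)

lemma smooth_differentiable0:
  "open \<Omega> \<Longrightarrow> smooth_fun_on \<Omega> f \<Longrightarrow> x \<in> \<Omega> \<Longrightarrow> f differentiable at x"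
  using smooth_differentiable[of \<Omega> f "[]"] by simp

lemma smoothI:
  "(\<And>\<alpha> x. \<alpha> \<in> lists Basis \<Longrightarrow> x \<in> \<Omega> \<Longrightarrow> multi_pd \<alpha> f differentiable at x) \<Longrightarrow> smooth_fun_on \<Omega> f"
  unfolding smooth_fun_on_def by (meson differentiable_at_imp_differentiable_on)

lemma smooth_multi_pd:
  "smooth_fun_on \<Omega> f \<Longrightarrow> \<beta> \<in> lists Basis \<Longrightarrow> smooth_fun_on \<Omega> (multi_pd \<beta> f)"
  unfolding smooth_fun_on_def by (metis append_in_lists_conv multi_pd_append)

lemma smooth_pd: "smooth_fun_on \<Omega> f \<Longrightarrow> i \<in> Basis \<Longrightarrow> smooth_fun_on \<Omega> (pd i f)"
  using smooth_multi_pd[of \<Omega> f "[i]"] by simp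

lemma smooth_continuous_on:
  assumes "open \<Omega>" "smooth_fun_on \<Omega> f" "\<alpha> \<in> lists Basis"
  shows "continuous_on \<Omega> (multi_pd \<alpha> f)"
  using assms unfolding smooth_fun_on_def by (auto intro: differentiable_imp_continuous_on)

lemma multi_pd_const: "multi_pd \<alpha> (\<lambda>x. k) = (\<lambda>x. if \<alpha> = [] then k else 0)"
  by (induction \<alpha>) (auto split: if_splits)

lemma smooth_const: "smooth_fun_on \<Omega> (\<lambda>x. k)"
  by (auto simp: smooth_fun_on_def multi_pd_const)

lemma multi_pd_diff:
  assumes \<Omega>: "open \<Omega>" and "smooth_fun_on \<Omega> f" "smooth_fun_on \<Omega> g" "\<alpha> \<in> lists Basis" "x \<in> \<Omega>"
  shows "multi_pd \<alpha> (\<lambda>x. f x - g x) x = multi_pd \<alpha> f x - multi_pd \<alpha> g x"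
  using assms(4,5)
proof (induction \<alpha> arbitrary: x)
  case (Cons i \<alpha>)
  have "pd i (multi_pd \<alpha> (\<lambda>x. f x - g x)) x = pd i (\<lambda>x. multi_pd \<alpha> f x - multi_pd \<alpha> g x) x"
    using Cons by (intro pd_cong[OF \<Omega>]) auto
  also have "\<dots> = pd i (multi_pd \<alpha> f) x - pd i (multi_pd \<alpha> g) x"
    using Cons smooth_differentiable[OF \<Omega>] assms(2,3) by (intro pd_diff) auto
  finally show ?case by simp
qed simp

lemma smooth_diff:
  assumes \<Omega>: "open \<Omega>" and "smooth_fun_on \<Omega> f" "smooth_fun_on \<Omega> g"
  shows "smooth_fun_on \<Omega> (\<lambda>x. f x - g x)"
proof (rule smoothI)
  fix \<alpha> x assume "\<alpha> \<in> lists (Basis::'a set)" "x \<in> \<Omega>"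
  then show "multi_pd \<alpha> (\<lambda>x. f x - g x) differentiable at x"
    by (intro differentiable_cong_open[OF \<Omega> _ multi_pd_diff[OF assms, symmetric]]
        differentiable_diff smooth_differentiable[OF \<Omega>] assms(2,3))
qed

lemma smooth_uminus:
  "open \<Omega> \<Longrightarrow> smooth_fun_on \<Omega> f \<Longrightarrow> smooth_fun_on \<Omega> (\<lambda>x. - f x)"
  using smooth_diff[OF _ smooth_const[of \<Omega> 0], of f] by simp

lemma smooth_add:
  assumes \<Omega>: "open \<Omega>" and "smooth_fun_on \<Omega> f" "smooth_fun_on \<Omega> g"
  shows "smooth_fun_on \<Omega> (\<lambda>x. f x + g x)"
  using smooth_diff[OF \<Omega> assms(2) smooth_uminus[OF \<Omega> assms(3)]] by simp

lemma multi_pd_uminus: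
  "open \<Omega> \<Longrightarrow> smooth_fun_on \<Omega> f \<Longrightarrow> \<alpha> \<in> lists Basis \<Longrightarrow> x \<in> \<Omega> \<Longrightarrow>
    multi_pd \<alpha> (\<lambda>x. - f x) x = - multi_pd \<alpha> f x"
  using multi_pd_diff[of \<Omega> "\<lambda>x. 0" f \<alpha> x] by (simp add: smooth_const multi_pd_const)

lemma multi_pd_add:
  assumes \<Omega>: "open \<Omega>" and "smooth_fun_on \<Omega> f" "smooth_fun_on \<Omega> g" "\<alpha> \<in> lists Basis" "x \<in> \<Omega>"
  shows "multi_pd \<alpha> (\<lambda>x. f x + g x) x = multi_pd \<alpha> f x + multi_pd \<alpha> g x"
  using multi_pd_diff[OF \<Omega> assms(2) smooth_uminus[OF \<Omega> assms(3)] assms(4,5)]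
    multi_pd_uminus[OF \<Omega> assms(3,4,5)] by simp

text \<open>A pair occurs once for every choice of the differentiations that go to the first factor, so that the
  Leibniz rule is a plain sum without binomial coefficients.\<close>

primrec splits :: "'a list \<Rightarrow> ('a list \<times> 'a list) list" where
  "splits [] = [([], [])]"
| "splits (i # \<alpha>) = map (\<lambda>(\<beta>, \<gamma>). (i # \<beta>, \<gamma>)) (splits \<alpha>) @ map (\<lambda>(\<beta>, \<gamma>). (\<beta>, i # \<gamma>)) (splits \<alpha>)"

lemma splits_mset: "(\<beta>, \<gamma>) \<in> set (splits \<alpha>) \<Longrightarrow> mset \<beta> + mset \<gamma> = mset \<alpha>"
  by (induction \<alpha> arbitrary: \<beta> \<gamma>) auto

lemma splits_lists:
  assumes "(\<beta>, \<gamma>) \<in> set (splits \<alpha>)" "\<alpha> \<in> lists A"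
  shows "\<beta> \<in> lists A" "\<gamma> \<in> lists A"
  using splits_mset[OF assms(1)] assms(2)
  by (metis in_lists_conv_set set_mset_mset union_iff)+

lemma pd_sum_list_mult:
  assumes "\<And>\<beta> \<gamma>. (\<beta>, \<gamma>) \<in> set L \<Longrightarrow> F \<beta> differentiable at x \<and> G \<gamma> differentiable at x"
  shows "(\<lambda>x. \<Sum>(\<beta>, \<gamma>)\<leftarrow>L. F \<beta> x * G \<gamma> x) differentiable at x \<and>
    pd i (\<lambda>x. \<Sum>(\<beta>, \<gamma>)\<leftarrow>L. F \<beta> x * G \<gamma> x) x =
      (\<Sum>(\<beta>, \<gamma>)\<leftarrow>L. pd i (F \<beta>) x * G \<gamma> x) + (\<Sum>(\<beta>, \<gamma>)\<leftarrow>L. F \<beta> x * pd i (G \<gamma>) x)"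
  using assms
proof (induction L)
  case (Cons p L)
  obtain \<beta> \<gamma> where p: "p = (\<beta>, \<gamma>)" by (cases p)
  have d: "F \<beta> differentiable at x" "G \<gamma> differentiable at x" using Cons.prems p by auto
  have IH: "(\<lambda>x. \<Sum>(\<beta>, \<gamma>)\<leftarrow>L. F \<beta> x * G \<gamma> x) differentiable at x \<and>
    pd i (\<lambda>x. \<Sum>(\<beta>, \<gamma>)\<leftarrow>L. F \<beta> x * G \<gamma> x) x =
      (\<Sum>(\<beta>, \<gamma>)\<leftarrow>L. pd i (F \<beta>) x * G \<gamma> x) + (\<Sum>(\<beta>, \<gamma>)\<leftarrow>L. F \<beta> x * pd i (G \<gamma>) x)"
    using Cons by auto
  have dm: "(\<lambda>x. F \<beta> x * G \<gamma> x) differentiable at x" using d by (intro differentiable_mult)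
  show ?case
    using differentiable_add[OF dm conjunct1[OF IH]] pd_add[OF dm conjunct1[OF IH], of i]
      pd_mult[OF d, of i] conjunct2[OF IH]
    by (simp add: p)
qed simp

lemma multi_pd_mult:
  assumes \<Omega>: "open \<Omega>" and "smooth_fun_on \<Omega> f" "smooth_fun_on \<Omega> g" "\<alpha> \<in> lists Basis" "x \<in> \<Omega>"
  shows "multi_pd \<alpha> (\<lambda>x. f x * g x) x = (\<Sum>(\<beta>, \<gamma>)\<leftarrow>splits \<alpha>. multi_pd \<beta> f x * multi_pd \<gamma> g x)"
  using assms(4,5)
proof (induction \<alpha> arbitrary: x)
  case (Cons i \<alpha>)
  have d: "multi_pd \<beta> f differentiable at x \<and> multi_pd \<gamma> g differentiable at x"
    if "(\<beta>, \<gamma>) \<in> set (splits \<alpha>)" for \<beta> \<gamma>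
  proof -
    have \<alpha>: "\<alpha> \<in> lists Basis" and x: "x \<in> \<Omega>" using Cons by simp_all
    show ?thesis
      using smooth_differentiable[OF \<Omega> assms(2) splits_lists(1)[OF that \<alpha>] x]
        smooth_differentiable[OF \<Omega> assms(3) splits_lists(2)[OF that \<alpha>] x] by simp
  qed
  have "pd i (multi_pd \<alpha> (\<lambda>x. f x * g x)) x =
      pd i (\<lambda>x. \<Sum>(\<beta>, \<gamma>)\<leftarrow>splits \<alpha>. multi_pd \<beta> f x * multi_pd \<gamma> g x) x"
    using Cons by (intro pd_cong[OF \<Omega>]) auto
  also have "\<dots> = (\<Sum>(\<beta>, \<gamma>)\<leftarrow>splits \<alpha>. pd i (multi_pd \<beta> f) x * multi_pd \<gamma> g x)
      + (\<Sum>(\<beta>, \<gamma>)\<leftarrow>splits \<alpha>. multi_pd \<beta> f x * pd i (multi_pd \<gamma> g) x)"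
    using pd_sum_list_mult[of "splits \<alpha>" "\<lambda>\<beta>. multi_pd \<beta> f" x "\<lambda>\<gamma>. multi_pd \<gamma> g" i] d by blast
  finally show ?case by (simp add: comp_def case_prod_beta')
qed simp

lemma smooth_mult:
  assumes \<Omega>: "open \<Omega>" and "smooth_fun_on \<Omega> f" "smooth_fun_on \<Omega> g"
  shows "smooth_fun_on \<Omega> (\<lambda>x. f x * g x)"
proof (rule smoothI)
  fix \<alpha> x assume \<alpha>: "\<alpha> \<in> lists (Basis::'a set)" "x \<in> \<Omega>"
  have d: "multi_pd \<beta> f differentiable at x \<and> multi_pd \<gamma> g differentiable at x"
    if "(\<beta>, \<gamma>) \<in> set (splits \<alpha>)" for \<beta> \<gamma>
    using smooth_differentiable[OF \<Omega> assms(2) splits_lists(1)[OF that \<alpha>(1)] \<alpha>(2)]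
      smooth_differentiable[OF \<Omega> assms(3) splits_lists(2)[OF that \<alpha>(1)] \<alpha>(2)] by blast
  show "multi_pd \<alpha> (\<lambda>x. f x * g x) differentiable at x"
    by (rule differentiable_cong_open[OF \<Omega> \<alpha>(2) multi_pd_mult[OF assms \<alpha>(1), symmetric]
          conjunct1[OF pd_sum_list_mult[OF d]]])
qed

lemma smooth_pd_commute:
  assumes \<Omega>: "open \<Omega>" and f: "smooth_fun_on \<Omega> f" and ij: "i \<in> Basis" "j \<in> Basis" and x: "x \<in> \<Omega>"
  shows "pd i (pd j f) x = pd j (pd i f) x"
proof -
  have d: "multi_pd \<alpha> f differentiable at y" if "set \<alpha> \<subseteq> Basis" "y \<in> \<Omega>" for \<alpha> y
    using smooth_differentiable[OF \<Omega> f _ that(2)] that(1) by (simp add: in_lists_conv_set subset_iff)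
  show ?thesis
    using d[of "[]"] d[of "[i]"] d[of "[j]"] ij
      differentiable_imp_continuous_within[OF d[of "[i,j]" x]]
      differentiable_imp_continuous_within[OF d[of "[j,i]" x]] x
    by (intro pd_commute[OF \<Omega> x]) simp_all
qed

lemma multi_pd_pd:
  assumes \<Omega>: "open \<Omega>" and f: "smooth_fun_on \<Omega> f" and "i \<in> Basis" "\<alpha> \<in> lists Basis" "x \<in> \<Omega>"
  shows "multi_pd \<alpha> (pd i f) x = pd i (multi_pd \<alpha> f) x"
  using assms(4,5)
proof (induction \<alpha> arbitrary: x)
  case (Cons j \<alpha>)
  have "pd j (multi_pd \<alpha> (pd i f)) x = pd j (pd i (multi_pd \<alpha> f)) x"
    using Cons by (intro pd_cong[OF \<Omega>]) auto
  also have "\<dots> = pd i (pd j (multi_pd \<alpha> f)) x"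
    using Cons smooth_multi_pd[OF f] assms(3) by (intro smooth_pd_commute[OF \<Omega>]) auto
  finally show ?case by simp
qed simp

text \<open>Repeated use of Schwarz's theorem moves the direction that comes first in \<open>\<alpha>\<close> to the front of \<open>\<beta>\<close>.\<close>

lemma multi_pd_perm:
  assumes \<Omega>: "open \<Omega>" and f: "smooth_fun_on \<Omega> f"
    and "mset \<alpha> = mset \<beta>" "\<alpha> \<in> lists Basis" "x \<in> \<Omega>"
  shows "multi_pd \<alpha> f x = multi_pd \<beta> f x"
  using assms(3-5)
proof (induction \<alpha> arbitrary: \<beta> x)
  case (Cons i \<alpha>)
  have "i \<in> set \<beta>" using Cons.prems(1) by (metis list.set_intros(1) set_mset_mset)
  then obtain \<beta>1 \<beta>2 where \<beta>: "\<beta> = \<beta>1 @ i # \<beta>2" by (meson split_list)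
  have m: "mset \<alpha> = mset (\<beta>1 @ \<beta>2)" using Cons.prems(1) by (simp add: \<beta>)
  have L: "\<beta>1 \<in> lists Basis" "\<beta>2 \<in> lists Basis" "i \<in> Basis"
    using mset_eq_setD[OF Cons.prems(1)] Cons.prems(2) by (auto simp: in_lists_conv_set \<beta>)
  have "multi_pd (i # \<alpha>) f x = pd i (multi_pd \<beta>1 (multi_pd \<beta>2 f)) x"
    using Cons.IH[OF m] Cons.prems unfolding multi_pd_Cons
    by (intro pd_cong[OF \<Omega>]) (auto simp: multi_pd_append)
  also have "\<dots> = multi_pd \<beta>1 (pd i (multi_pd \<beta>2 f)) x"
    using L Cons.prems smooth_multi_pd[OF f] by (intro multi_pd_pd[OF \<Omega>, symmetric]) auto
  finally show ?case by (simp add: \<beta> multi_pd_append)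
qed simp

section \<open>Orders of growth\<close>

text \<open>The losses \<open>\<delta>\<close> make slow scale nets the nets of order \<open>0\<close>, so that a product with a slow scale
  net keeps the order.  Negligible nets are the nets of every (negative) order.\<close>

definition net_order :: "real \<Rightarrow> (real \<Rightarrow> real) \<Rightarrow> bool" where
  "net_order P m \<longleftrightarrow> (\<forall>\<delta>>0. \<forall>\<^sub>F \<epsilon> in at_right 0. \<bar>m \<epsilon>\<bar> \<le> \<epsilon> powr (- (P + \<delta>)))"

lemma eventually_unit: "\<forall>\<^sub>F \<epsilon> in at_right (0::real). 0 < \<epsilon> \<and> \<epsilon> \<le> 1"
  using eventually_at_right_real[of 0 "1::real"] by (auto elim: eventually_mono)

lemma net_orderD: "net_order P m \<Longrightarrow> \<delta> > 0 \<Longrightarrow> \<forall>\<^sub>F \<epsilon> in at_right 0. \<bar>m \<epsilon>\<bar> \<le> \<epsilon> powr (- (P + \<delta>))"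
  by (simp add: net_order_def)

lemma net_order_le:
  assumes "net_order P m" "P \<le> Q" "\<forall>\<^sub>F \<epsilon> in at_right 0. \<bar>m' \<epsilon>\<bar> \<le> \<bar>m \<epsilon>\<bar>"
  shows "net_order Q m'"
  unfolding net_order_def
proof (intro allI impI)
  fix \<delta> :: real assume \<delta>: "\<delta> > 0"
  show "\<forall>\<^sub>F \<epsilon> in at_right 0. \<bar>m' \<epsilon>\<bar> \<le> \<epsilon> powr (- (Q + \<delta>))"
    using net_orderD[OF assms(1) \<delta>] assms(3) eventually_unit
  proof eventually_elim
    case (elim \<epsilon>)
    have "\<epsilon> powr (- (P + \<delta>)) \<le> \<epsilon> powr (- (Q + \<delta>))"
      using elim assms(2) by (intro powr_mono') auto
    then show ?case using elim by linarith
  qed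
qed

lemma net_order_mono: "net_order P m \<Longrightarrow> P \<le> Q \<Longrightarrow> net_order Q m"
  by (rule net_order_le) auto

lemma net_order_abs: "net_order P (\<lambda>\<epsilon>. \<bar>m \<epsilon>\<bar>) \<longleftrightarrow> net_order P m"
  by (simp add: net_order_def)

lemma net_order_powr: "net_order (- q) (\<lambda>\<epsilon>. \<epsilon> powr q)"
  unfolding net_order_def
proof (intro allI impI)
  fix \<delta> :: real assume \<delta>: "\<delta> > 0"
  show "\<forall>\<^sub>F \<epsilon> in at_right 0. \<bar>\<epsilon> powr q\<bar> \<le> \<epsilon> powr (- (- q + \<delta>))"
    using eventually_unit by eventually_elim (use \<delta> in \<open>auto intro!: powr_mono'\<close>)
qed

text \<open>A constant factor is absorbed by the losses.\<close>

lemma eventually_const_le_powr: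
  assumes "\<delta> > 0"
  shows "\<forall>\<^sub>F \<epsilon> in at_right (0::real). K \<le> \<epsilon> powr (- \<delta>)"
proof -
  define M where "M = max K 1"
  define c where "c = M powr (- 1 / \<delta>)"
  have c: "0 < c" by (simp add: c_def M_def)
  have "c powr (- \<delta>) = M" using assms by (simp add: c_def powr_powr M_def)
  moreover have "c powr (- \<delta>) \<le> \<epsilon> powr (- \<delta>)" if "\<epsilon> \<in> {0<..<c}" for \<epsilon>
    using that assms by (intro powr_mono2') auto
  ultimately have "K \<le> \<epsilon> powr (- \<delta>)" if "\<epsilon> \<in> {0<..<c}" for \<epsilon>
    using that by (fastforce simp: M_def)
  then show ?thesis
    using eventually_at_right_real[OF c] by (rule eventually_mono[rotated])
qed

lemma net_order_const: "net_order 0 (\<lambda>\<epsilon>. K)"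
  unfolding net_order_def using eventually_const_le_powr[of _ "\<bar>K\<bar>"] by simp

lemma net_order_mult:
  assumes "net_order P m" "net_order Q n"
  shows "net_order (P + Q) (\<lambda>\<epsilon>. m \<epsilon> * n \<epsilon>)"
  unfolding net_order_def
proof (intro allI impI)
  fix \<delta> :: real assume \<delta>: "\<delta> > 0"
  then have h: "\<delta> / 2 > 0" by simp
  show "\<forall>\<^sub>F \<epsilon> in at_right 0. \<bar>m \<epsilon> * n \<epsilon>\<bar> \<le> \<epsilon> powr (- (P + Q + \<delta>))"
    using net_orderD[OF assms(1) h] net_orderD[OF assms(2) h]
  proof eventually_elim
    case (elim \<epsilon>)
    have "\<bar>m \<epsilon> * n \<epsilon>\<bar> \<le> \<epsilon> powr (- (P + \<delta> / 2)) * \<epsilon> powr (- (Q + \<delta> / 2))"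
      unfolding abs_mult using elim by (intro mult_mono) auto
    also have "\<dots> = \<epsilon> powr (- (P + Q + \<delta>))"
      unfolding powr_add[symmetric] by (simp add: algebra_simps)
    finally show ?case .
  qed
qed

lemma net_order_cmult: "net_order P m \<Longrightarrow> net_order P (\<lambda>\<epsilon>. K * m \<epsilon>)"
  using net_order_mult[OF net_order_const] by fastforce

lemma net_order_add:
  assumes "net_order P m" "net_order P n"
  shows "net_order P (\<lambda>\<epsilon>. m \<epsilon> + n \<epsilon>)"
  unfolding net_order_def
proof (intro allI impI)
  fix \<delta> :: real assume \<delta>: "\<delta> > 0"
  then have h: "\<delta> / 2 > 0" by simp
  show "\<forall>\<^sub>F \<epsilon> in at_right 0. \<bar>m \<epsilon> + n \<epsilon>\<bar> \<le> \<epsilon> powr (- (P + \<delta>))"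
    using net_orderD[OF assms(1) h] net_orderD[OF assms(2) h] eventually_const_le_powr[OF h, of 2]
  proof eventually_elim
    case (elim \<epsilon>)
    have "\<bar>m \<epsilon> + n \<epsilon>\<bar> \<le> 2 * \<epsilon> powr (- (P + \<delta> / 2))" using elim by linarith
    also have "\<dots> \<le> \<epsilon> powr (- (\<delta> / 2)) * \<epsilon> powr (- (P + \<delta> / 2))"
      using elim by (intro mult_right_mono) auto
    also have "\<dots> = \<epsilon> powr (- (P + \<delta>))"
      unfolding powr_add[symmetric] by (simp add: algebra_simps)
    finally show ?case .
  qed
qed

lemma net_order_zero: "net_order P (\<lambda>\<epsilon>. 0)"
  by (simp add: net_order_def)

lemma net_order_sum:
  "(\<And>i. i \<in> A \<Longrightarrow> net_order P (m i)) \<Longrightarrow> net_order P (\<lambda>\<epsilon>. \<Sum>i\<in>A. m i \<epsilon>)"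
  by (induction A rule: infinite_finite_induct) (auto intro: net_order_add net_order_zero)

lemma net_order_power2: "net_order P m \<Longrightarrow> net_order (2 * P) (\<lambda>\<epsilon>. (m \<epsilon>)\<^sup>2)"
  using net_order_mult[of P m P m] by (simp add: power2_eq_square)

lemma net_order_sqrt:
  assumes "net_order (2 * P) m"
  shows "net_order P (\<lambda>\<epsilon>. sqrt (m \<epsilon>))"
  unfolding net_order_def
proof (intro allI impI)
  fix \<delta> :: real assume \<delta>: "\<delta> > 0"
  then have h: "2 * \<delta> > 0" by simp
  show "\<forall>\<^sub>F \<epsilon> in at_right 0. \<bar>sqrt (m \<epsilon>)\<bar> \<le> \<epsilon> powr (- (P + \<delta>))"
    using net_orderD[OF assms h]
  proof eventually_elim
    case (elim \<epsilon>)
    have "\<epsilon> powr (- (2 * P + 2 * \<delta>)) = (\<epsilon> powr (- (P + \<delta>)))\<^sup>2"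
      by (simp add: power2_eq_square flip: powr_add)
    then have "\<bar>m \<epsilon>\<bar> \<le> (\<epsilon> powr (- (P + \<delta>)))\<^sup>2" using elim by simp
    then have "sqrt \<bar>m \<epsilon>\<bar> \<le> \<epsilon> powr (- (P + \<delta>))" by (rule real_le_lsqrt[rotated]) auto
    then show ?case by (cases "m \<epsilon> \<ge> 0") (auto simp: real_sqrt_minus abs_if)
  qed
qed

lemma net_order_bigo:
  assumes "m \<in> O[at_right 0](\<lambda>\<epsilon>. \<epsilon> powr (- P))"
  shows "net_order P m"
proof -
  obtain K where "\<forall>\<^sub>F \<epsilon> in at_right 0. norm (m \<epsilon>) \<le> K * norm (\<epsilon> powr (- P))"
    using assms by (elim landau_o.bigE)
  then have "\<forall>\<^sub>F \<epsilon> in at_right 0. \<bar>m \<epsilon>\<bar> \<le> \<bar>K * \<epsilon> powr (- P)\<bar>"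
    by eventually_elim (smt (verit) abs_mult abs_ge_self mult_right_mono powr_ge_zero real_norm_def abs_of_nonneg)
  then show ?thesis
    using net_order_le[OF net_order_cmult[OF net_order_powr[of "- P"], of K]] by simp
qed

lemma net_order_imp_bigo:
  assumes "net_order P m"
  shows "m \<in> O[at_right 0](\<lambda>\<epsilon>. \<epsilon> powr (- (P + 1)))"
  by (rule landau_o.bigI[of 1]) (use net_orderD[OF assms, of 1] in simp_all)

text \<open>By taking roots: a net all of whose powers are below \<open>\<epsilon> powr (- 2)\<close> is below every power of
  \<open>1 / \<epsilon>\<close> with positive exponent.\<close>

lemma net_order_slow_scale:
  assumes "slow_scale r"
  shows "net_order 0 (\<lambda>\<epsilon>. norm (r \<epsilon>))"
  unfolding net_order_def
proof (intro allI impI)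
  fix \<delta> :: real assume \<delta>: "\<delta> > 0"
  \<comment> \<open>A \<open>p\<close>-th root turns the exponent \<open>- 2\<close> into \<open>- 2 / p\<close>.\<close>
  obtain p :: nat where p: "2 / \<delta> < real p" using reals_Archimedean2 by blast
  have p0: "0 < real p" using p \<delta> by (meson divide_pos_pos less_trans zero_less_numeral)
  have b: "net_order 1 (\<lambda>\<epsilon>. norm (r \<epsilon>) ^ p)"
  proof (rule net_order_bigo)
    have "(\<lambda>\<epsilon>. norm (r \<epsilon>) ^ p) \<in> O[at_right 0](\<lambda>\<epsilon>. 1 / \<epsilon>)"
      using assms by (simp add: slow_scale_def)
    moreover have "\<forall>\<^sub>F \<epsilon> in at_right 0. 1 / \<epsilon> = \<epsilon> powr (- (1::real))"
      using eventually_unit by eventually_elim (simp add: powr_minus_divide)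
    ultimately show "(\<lambda>\<epsilon>. norm (r \<epsilon>) ^ p) \<in> O[at_right 0](\<lambda>\<epsilon>. \<epsilon> powr (- 1))"
      by (simp add: landau_o.big.cong)
  qed
  show "\<forall>\<^sub>F \<epsilon> in at_right 0. \<bar>norm (r \<epsilon>)\<bar> \<le> \<epsilon> powr (- (0 + \<delta>))"
    using net_orderD[OF b zero_less_one] eventually_unit
  proof eventually_elim
    case (elim \<epsilon>)
    have "norm (r \<epsilon>) ^ p \<le> \<epsilon> powr (- 2)" using elim by simp
    also have "\<dots> \<le> \<epsilon> powr (- (\<delta> * real p))"
      using elim p \<delta> by (intro powr_mono') (auto simp: field_simps)
    also have "\<dots> = (\<epsilon> powr (- \<delta>)) ^ p"
      using elim by (simp add: powr_powr flip: powr_realpow)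
    finally have "norm (r \<epsilon>) \<le> \<epsilon> powr (- \<delta>)"
      using p0 by (subst (asm) power_mono_iff) auto
    then show ?case by simp
  qed
qed

text \<open>Gronwall's lemma for a coefficient \<open>\<kappa> * ln (r \<epsilon>)\<close> produces such a factor.\<close>

lemma net_order_slow_powr:
  assumes "net_order 0 r" "\<kappa> > 0"
  shows "net_order 0 (\<lambda>\<epsilon>. \<bar>r \<epsilon>\<bar> powr \<kappa>)"
  unfolding net_order_def
proof (intro allI impI)
  fix \<delta> :: real assume \<delta>: "\<delta> > 0"
  have h: "\<delta> / \<kappa> > 0" using \<delta> assms by simp
  show "\<forall>\<^sub>F \<epsilon> in at_right 0. \<bar>\<bar>r \<epsilon>\<bar> powr \<kappa>\<bar> \<le> \<epsilon> powr (- (0 + \<delta>))"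
    using net_orderD[OF assms(1) h]
  proof eventually_elim
    case (elim \<epsilon>)
    have "\<bar>r \<epsilon>\<bar> powr \<kappa> \<le> (\<epsilon> powr (- (\<delta> / \<kappa>))) powr \<kappa>"
      using elim assms(2) by (intro powr_mono2) auto
    then show ?case using assms(2) by (simp add: powr_powr)
  qed
qed

text \<open>The exponent \<open>1 / \<epsilon>\<close> eventually exceeds every fixed one.\<close>

lemma net_order_negligible: "net_order P (\<lambda>\<epsilon>. K * \<epsilon> powr (1 / \<epsilon>))"
proof (rule net_order_cmult, rule net_order_le[OF net_order_powr[of "- P"]])
  have "filterlim (\<lambda>\<epsilon>::real. inverse \<epsilon>) at_top (at_right 0)"
    by (rule filterlim_inverse_at_top_right)
  then have "\<forall>\<^sub>F \<epsilon> in at_right (0::real). - P \<le> inverse \<epsilon>"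
    by (simp add: filterlim_at_top)
  then show "\<forall>\<^sub>F \<epsilon> in at_right 0. \<bar>\<epsilon> powr (1 / \<epsilon>)\<bar> \<le> \<bar>\<epsilon> powr (- P)\<bar>"
    using eventually_unit
    by eventually_elim (auto intro!: powr_mono' simp: inverse_eq_divide)
qed simp

text \<open>The sets on which a family of functions is estimated may depend on \<open>\<epsilon>\<close>.\<close>

definition growth :: "(real \<Rightarrow> 'p set) \<Rightarrow> real \<Rightarrow> (real \<Rightarrow> 'p \<Rightarrow> 'b::real_normed_vector) \<Rightarrow> bool" where
  "growth S P w \<longleftrightarrow> (\<exists>m. net_order P m \<and> (\<forall>\<^sub>F \<epsilon> in at_right 0. \<forall>p\<in>S \<epsilon>. norm (w \<epsilon> p) \<le> m \<epsilon>))"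

lemma growthI:
  "net_order P m \<Longrightarrow> \<forall>\<^sub>F \<epsilon> in at_right 0. \<forall>p\<in>S \<epsilon>. norm (w \<epsilon> p) \<le> m \<epsilon> \<Longrightarrow> growth S P w"
  unfolding growth_def by blast

lemma growthE:
  assumes "growth S P w"
  obtains m where "net_order P m" "\<forall>\<epsilon>. 0 \<le> m \<epsilon>" "\<forall>\<^sub>F \<epsilon> in at_right 0. \<forall>p\<in>S \<epsilon>. norm (w \<epsilon> p) \<le> m \<epsilon>"
proof -
  obtain m where m: "net_order P m" "\<forall>\<^sub>F \<epsilon> in at_right 0. \<forall>p\<in>S \<epsilon>. norm (w \<epsilon> p) \<le> m \<epsilon>"
    using assms unfolding growth_def by blast
  show thesis
  proof (rule that[of "\<lambda>\<epsilon>. \<bar>m \<epsilon>\<bar>"])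
    show "\<forall>\<^sub>F \<epsilon> in at_right 0. \<forall>p\<in>S \<epsilon>. norm (w \<epsilon> p) \<le> \<bar>m \<epsilon>\<bar>"
      using m(2) by (rule eventually_mono) force
  qed (use m(1) in \<open>auto simp: net_order_abs\<close>)
qed

lemma growth_mono: "growth S P w \<Longrightarrow> P \<le> Q \<Longrightarrow> growth S Q w"
  unfolding growth_def using net_order_mono by blast

lemma growth_le:
  assumes "growth S P w" "\<forall>\<^sub>F \<epsilon> in at_right 0. \<forall>p\<in>S' \<epsilon>. p \<in> S \<epsilon> \<and> norm (v \<epsilon> p) \<le> norm (w \<epsilon> p)"
  shows "growth S' P v"
proof -
  obtain m where m: "net_order P m" "\<forall>\<^sub>F \<epsilon> in at_right 0. \<forall>p\<in>S \<epsilon>. norm (w \<epsilon> p) \<le> m \<epsilon>"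
    using assms(1) unfolding growth_def by blast
  have "\<forall>\<^sub>F \<epsilon> in at_right 0. \<forall>p\<in>S' \<epsilon>. norm (v \<epsilon> p) \<le> m \<epsilon>"
    using m(2) assms(2) by eventually_elim force
  then show ?thesis using m(1) unfolding growth_def by blast
qed

lemma growth_cong:
  assumes "growth S P w" "\<And>\<epsilon> p. 0 < \<epsilon> \<Longrightarrow> \<epsilon> \<le> 1 \<Longrightarrow> p \<in> S \<epsilon> \<Longrightarrow> v \<epsilon> p = w \<epsilon> p"
  shows "growth S P v"
  by (rule growth_le[OF assms(1)]) (use eventually_unit in \<open>eventually_elim, auto simp: assms(2)\<close>)

lemma growth_subset:
  assumes "growth S P w" "\<And>\<epsilon>. 0 < \<epsilon> \<Longrightarrow> \<epsilon> \<le> 1 \<Longrightarrow> S' \<epsilon> \<subseteq> S \<epsilon>"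
  shows "growth S' P w"
  by (rule growth_le[OF assms(1)]) (use eventually_unit in \<open>eventually_elim, use assms(2) in auto\<close>)

lemma growth_zero: "growth S P (\<lambda>\<epsilon> p. 0)"
  by (rule growthI[OF net_order_zero]) auto

lemma growth_add:
  assumes "growth S P v" "growth S P w"
  shows "growth S P (\<lambda>\<epsilon> p. v \<epsilon> p + w \<epsilon> p)"
proof -
  obtain m where m: "net_order P m" "\<forall>\<^sub>F \<epsilon> in at_right 0. \<forall>p\<in>S \<epsilon>. norm (v \<epsilon> p) \<le> m \<epsilon>"
    using assms(1) unfolding growth_def by blast
  obtain n where n: "net_order P n" "\<forall>\<^sub>F \<epsilon> in at_right 0. \<forall>p\<in>S \<epsilon>. norm (w \<epsilon> p) \<le> n \<epsilon>"
    using assms(2) unfolding growth_def by blast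
  show ?thesis
  proof (rule growthI[OF net_order_add[OF m(1) n(1)]])
    show "\<forall>\<^sub>F \<epsilon> in at_right 0. \<forall>p\<in>S \<epsilon>. norm (v \<epsilon> p + w \<epsilon> p) \<le> m \<epsilon> + n \<epsilon>"
      using m(2) n(2) by eventually_elim (auto intro: norm_triangle_mono)
  qed
qed

lemma growth_uminus: "growth S P w \<Longrightarrow> growth S P (\<lambda>\<epsilon> p. - w \<epsilon> p)"
  unfolding growth_def by simp

lemma growth_diff: "growth S P v \<Longrightarrow> growth S P w \<Longrightarrow> growth S P (\<lambda>\<epsilon> p. v \<epsilon> p - w \<epsilon> p)"
  using growth_add[OF _ growth_uminus] by fastforce

lemma growth_sum_list:
  "(\<And>x. x \<in> set L \<Longrightarrow> growth S P (w x)) \<Longrightarrow> growth S P (\<lambda>\<epsilon> p. \<Sum>x\<leftarrow>L. w x \<epsilon> p)"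
  by (induction L) (auto intro: growth_add growth_zero)

lemma growth_mult:
  fixes v w :: "real \<Rightarrow> 'p \<Rightarrow> 'b::real_normed_algebra"
  assumes "growth S P v" "growth S Q w"
  shows "growth S (P + Q) (\<lambda>\<epsilon> p. v \<epsilon> p * w \<epsilon> p)"
proof -
  obtain m where m: "net_order P m" "\<forall>\<epsilon>. 0 \<le> m \<epsilon>" "\<forall>\<^sub>F \<epsilon> in at_right 0. \<forall>p\<in>S \<epsilon>. norm (v \<epsilon> p) \<le> m \<epsilon>"
    using assms(1) by (rule growthE)
  obtain n where n: "net_order Q n" "\<forall>\<^sub>F \<epsilon> in at_right 0. \<forall>p\<in>S \<epsilon>. norm (w \<epsilon> p) \<le> n \<epsilon>"
    using assms(2) unfolding growth_def by blast
  show ?thesis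
  proof (rule growthI[OF net_order_mult[OF m(1) n(1)]])
    show "\<forall>\<^sub>F \<epsilon> in at_right 0. \<forall>p\<in>S \<epsilon>. norm (v \<epsilon> p * w \<epsilon> p) \<le> m \<epsilon> * n \<epsilon>"
      using m(3) n(2)
      by eventually_elim (auto intro!: order_trans[OF norm_mult_ineq] mult_mono simp: m(2)[rule_format])
  qed
qed

section \<open>Sobolev estimates on boxes\<close>

lemma abs_2_inner_le:
  fixes u v :: "'a::real_inner"
  shows "\<bar>2 * (u \<bullet> v)\<bar> \<le> (norm u)\<^sup>2 + (norm v)\<^sup>2"
proof -
  have "0 \<le> (norm (u + v))\<^sup>2" "0 \<le> (norm (u - v))\<^sup>2" by auto
  then show ?thesis
    by (simp add: power2_norm_eq_inner inner_simps inner_commute abs_le_iff)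
qed

lemma has_real_derivative_norm_square:
  fixes \<phi> :: "real \<Rightarrow> 'a::real_inner"
  assumes "(\<phi> has_vector_derivative v) (at s within S)"
  shows "((\<lambda>s. (norm (\<phi> s))\<^sup>2) has_real_derivative 2 * (\<phi> s \<bullet> v)) (at s within S)"
proof -
  have "((\<lambda>s. \<phi> s \<bullet> \<phi> s) has_derivative (\<lambda>h. \<phi> s \<bullet> (h *\<^sub>R v) + (h *\<^sub>R v) \<bullet> \<phi> s)) (at s within S)"
    using assms unfolding has_vector_derivative_def by (intro has_derivative_inner)
  moreover have "(\<lambda>h. \<phi> s \<bullet> (h *\<^sub>R v) + (h *\<^sub>R v) \<bullet> \<phi> s) = (*) (2 * (\<phi> s \<bullet> v))"
    by (auto simp: inner_commute)
  ultimately show ?thesis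
    by (simp add: has_field_derivative_def power2_norm_eq_inner)
qed

lemma norm_square_diff_le_integral:
  fixes \<phi> \<phi>' :: "real \<Rightarrow> complex"
  assumes "l \<le> r" and d: "\<And>y. y \<in> {l..r} \<Longrightarrow> (\<phi> has_vector_derivative \<phi>' y) (at y)"
    and c: "continuous_on {l..r} \<phi>'"
  shows "\<bar>(norm (\<phi> r))\<^sup>2 - (norm (\<phi> l))\<^sup>2\<bar> \<le> integral {l..r} (\<lambda>y. (norm (\<phi> y))\<^sup>2 + (norm (\<phi>' y))\<^sup>2)"
proof -
  have c0: "continuous_on {l..r} \<phi>"
    using d by (meson continuous_at_imp_continuous_on has_vector_derivative_continuous)
  have "((\<lambda>y. 2 * (\<phi> y \<bullet> \<phi>' y)) has_integral ((norm (\<phi> r))\<^sup>2 - (norm (\<phi> l))\<^sup>2)) {l..r}"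
  proof (rule fundamental_theorem_of_calculus[OF assms(1)])
    fix y assume "y \<in> {l..r}"
    then show "((\<lambda>s. (norm (\<phi> s))\<^sup>2) has_vector_derivative 2 * (\<phi> y \<bullet> \<phi>' y)) (at y within {l..r})"
      using has_real_derivative_norm_square[OF has_vector_derivative_at_within[OF d]]
      by (simp add: has_real_derivative_iff_has_vector_derivative)
  qed
  then have "(norm (\<phi> r))\<^sup>2 - (norm (\<phi> l))\<^sup>2 = integral {l..r} (\<lambda>y. 2 * (\<phi> y \<bullet> \<phi>' y))"
    by (rule integral_unique[symmetric])
  also have "\<bar>\<dots>\<bar> \<le> integral {l..r} (\<lambda>y. (norm (\<phi> y))\<^sup>2 + (norm (\<phi>' y))\<^sup>2)"
    unfolding real_norm_def[symmetric] using c c0 abs_2_inner_le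
    by (intro integral_norm_bound_integral integrable_continuous_real continuous_intros) auto
  finally show ?thesis .
qed

text \<open>Stated with the Lebesgue integral of a nonnegative function, which may be infinite, the estimate
  can be iterated over the coordinates without any integrability considerations.\<close>

lemma sobolev_interval_nn:
  fixes \<phi> \<phi>' :: "real \<Rightarrow> complex"
  assumes pq: "p < q" and d: "\<And>y. y \<in> {p<..<q} \<Longrightarrow> (\<phi> has_vector_derivative \<phi>' y) (at y)"
    and c: "continuous_on {p<..<q} \<phi>'" and x: "x \<in> {p<..<q}"
  shows "ennreal ((norm (\<phi> x))\<^sup>2) \<le> ennreal (1 + 1 / (q - p)) *
    (\<integral>\<^sup>+y. ennreal ((norm (\<phi> y))\<^sup>2 + (norm (\<phi>' y))\<^sup>2) * indicator {p<..<q} y \<partial>lborel)"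
proof -
  define k where "k y = (norm (\<phi> y))\<^sup>2 + (norm (\<phi>' y))\<^sup>2" for y
  define I where "I = (\<integral>\<^sup>+y. ennreal (k y) * indicator {p<..<q} y \<partial>lborel)"
  have c0: "continuous_on {p<..<q} \<phi>"
    using d by (meson continuous_at_imp_continuous_on has_vector_derivative_continuous)
  have I_ge: "ennreal (integral {l..r} k) \<le> I" if lr: "l \<le> r" "{l..r} \<subseteq> {p<..<q}" for l r
  proof -
    have "(k has_integral integral {l..r} k) {l..r}"
      unfolding k_def using lr c c0
      by (intro integrable_integral integrable_continuous_real continuous_intros)
        (auto intro: continuous_on_subset)
    then have "ennreal (integral {l..r} k) = (\<integral>\<^sup>+y. ennreal (indicator {l..r} y * k y) \<partial>lborel)"
      using nn_integral_has_integral_lebesgue[of "{l..r}" k] by (simp add: k_def)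
    also have "\<dots> \<le> I"
      unfolding I_def using lr(2) by (intro nn_integral_mono) (auto simp: indicator_def)
    finally show ?thesis .
  qed
  have *: "ennreal ((norm (\<phi> x))\<^sup>2) \<le> ennreal (k y) + I" if y: "y \<in> {p<..<q}" for y
  proof -
    have s: "{min x y..max x y} \<subseteq> {p<..<q}" using x y by auto
    have "\<bar>(norm (\<phi> (max x y)))\<^sup>2 - (norm (\<phi> (min x y)))\<^sup>2\<bar> \<le> integral {min x y..max x y} k"
      unfolding k_def using s d c
      by (intro norm_square_diff_le_integral) (auto intro: continuous_on_subset)
    then have "(norm (\<phi> x))\<^sup>2 \<le> (norm (\<phi> y))\<^sup>2 + integral {min x y..max x y} k"
      by (cases "x \<le> y") (auto simp: max_def min_def)
    also have "\<dots> \<le> k y + integral {min x y..max x y} k" by (simp add: k_def)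
    finally have "ennreal ((norm (\<phi> x))\<^sup>2) \<le> ennreal (k y + integral {min x y..max x y} k)"
      by (rule ennreal_leI)
    also have "\<dots> = ennreal (k y) + ennreal (integral {min x y..max x y} k)"
      by (intro ennreal_plus Henstock_Kurzweil_Integration.integral_nonneg integrable_continuous_real)
        (auto simp: k_def intro!: continuous_intros continuous_on_subset[OF c s] continuous_on_subset[OF c0 s])
    also have "\<dots> \<le> ennreal (k y) + I" using s by (intro add_left_mono I_ge) auto
    finally show ?thesis .
  qed
  have m[measurable]: "(\<lambda>y. ennreal (k y) * indicator {p<..<q} y) \<in> borel_measurable borel"
  proof -
    have "continuous_on {p<..<q} k" unfolding k_def using c c0 by (intro continuous_intros)
    then have "(\<lambda>y. indicator {p<..<q} y *\<^sub>R k y) \<in> borel_measurable borel"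
      by (intro borel_measurable_continuous_on_indicator) auto
    then have "(\<lambda>y. ennreal (indicator {p<..<q} y *\<^sub>R k y)) \<in> borel_measurable borel" by measurable
    moreover have "(\<lambda>y. ennreal (indicator {p<..<q} y *\<^sub>R k y)) = (\<lambda>y. ennreal (k y) * indicator {p<..<q} y)"
      by (auto simp: indicator_def)
    ultimately show ?thesis by simp
  qed
  have "ennreal (q - p) * ennreal ((norm (\<phi> x))\<^sup>2) = (\<integral>\<^sup>+y. ennreal ((norm (\<phi> x))\<^sup>2) * indicator {p<..<q} y \<partial>lborel)"
    using pq by (subst nn_integral_cmult_indicator) (auto simp: mult.commute)
  also have "\<dots> \<le> (\<integral>\<^sup>+y. ennreal (k y) * indicator {p<..<q} y + I * indicator {p<..<q} y \<partial>lborel)"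
    using * by (intro nn_integral_mono) (auto simp: indicator_def)
  also have "\<dots> = I + I * ennreal (q - p)"
    using pq by (subst nn_integral_add) (auto simp: nn_integral_cmult_indicator I_def)
  also have "\<dots> = ennreal (1 + (q - p)) * I"
    using pq by (simp add: mult.commute[of _ I] distrib_left ennreal_plus)
  finally have "ennreal (1 / (q - p)) * (ennreal (q - p) * ennreal ((norm (\<phi> x))\<^sup>2)) \<le>
      ennreal (1 / (q - p)) * (ennreal (1 + (q - p)) * I)"
    by (rule mult_left_mono) auto
  moreover have "ennreal (1 / (q - p)) * ennreal (1 + (q - p)) = ennreal (1 + 1 / (q - p))"
    using pq by (subst ennreal_mult[symmetric]) (auto simp: field_simps)
  moreover have "ennreal (1 / (q - p)) * ennreal (q - p) = 1"
    using pq by (subst ennreal_mult[symmetric]) auto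
  ultimately have "ennreal ((norm (\<phi> x))\<^sup>2) \<le> ennreal (1 + 1 / (q - p)) * I"
    by (simp only: mult.assoc[symmetric] mult_1_left)
  then show ?thesis by (simp add: I_def k_def)
qed

lemma L2norm_square:
  assumes "open \<Omega>" "continuous_on \<Omega> f" "set_integrable lborel \<Omega> (\<lambda>x. (norm (f x))\<^sup>2)"
  shows "(\<integral>\<^sup>+x. ennreal ((norm (f x))\<^sup>2) * indicator \<Omega> x \<partial>lborel) = ennreal ((L2norm \<Omega> f)\<^sup>2)"
proof -
  have "(\<integral>\<^sup>+x. ennreal ((norm (f x))\<^sup>2) * indicator \<Omega> x \<partial>lborel)
      = (\<integral>\<^sup>+x. ennreal (indicator \<Omega> x *\<^sub>R (norm (f x))\<^sup>2) \<partial>lborel)"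
    by (intro nn_integral_cong) (auto simp: indicator_def)
  also have "\<dots> = ennreal (LINT x:\<Omega>|lborel. (norm (f x))\<^sup>2)"
    using assms(3) unfolding set_integrable_def set_lebesgue_integral_def
    by (intro nn_integral_eq_integral) auto
  also have "(LINT x:\<Omega>|lborel. (norm (f x))\<^sup>2) = (L2norm \<Omega> f)\<^sup>2"
    unfolding L2norm_def set_lebesgue_integral_def
    by (subst real_sqrt_pow2) (auto intro!: Bochner_Integration.integral_nonneg)
  finally show ?thesis .
qed

lemma L2norm_nonneg: "0 \<le> L2norm \<Omega> f"
  unfolding L2norm_def set_lebesgue_integral_def by (auto intro!: Bochner_Integration.integral_nonneg)

text \<open>A box on which finitely many \<open>L\<^sup>2\<close> norms of derivatives control the values; \<open>F\<close> and \<open>K\<close> depend only on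
  the box, so that the estimate holds uniformly in families.\<close>

definition sobolev_box :: "'a::euclidean_space set \<Rightarrow> bool" where
  "sobolev_box \<Omega> \<longleftrightarrow> (\<exists>l u. \<Omega> = box l u) \<and> \<Omega> \<noteq> {} \<and>
     (\<exists>F K. finite F \<and> F \<subseteq> lists Basis \<and>
       (\<forall>f\<in>H_infty \<Omega>. \<forall>x\<in>\<Omega>. norm (f x) \<le> K * (\<Sum>\<alpha>\<in>F. L2norm \<Omega> (multi_pd \<alpha> f))))"

lemma sum_squares_le_square_sum:
  assumes "\<And>i. 0 \<le> N i"
  shows "(\<Sum>i\<in>F. (N i)\<^sup>2) \<le> (\<Sum>i\<in>F. N i :: real)\<^sup>2"
proof (induction F rule: infinite_finite_induct)
  case (insert i F)
  have "0 \<le> N i * sum N F" using assms by (intro mult_nonneg_nonneg sum_nonneg)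
  then show ?case using insert by (simp add: power2_sum)
qed auto

lemma norm_le_sum_L2normI:
  assumes "finite F" "0 \<le> K"
    and "ennreal ((norm (z::complex))\<^sup>2) \<le> ennreal K * ennreal (\<Sum>\<alpha>\<in>F. (N \<alpha>)\<^sup>2)"
    and "\<And>\<alpha>. 0 \<le> N \<alpha>"
  shows "norm z \<le> sqrt K * (\<Sum>\<alpha>\<in>F. N \<alpha>)"
proof -
  have "ennreal ((norm z)\<^sup>2) \<le> ennreal (K * (\<Sum>\<alpha>\<in>F. (N \<alpha>)\<^sup>2))"
    using assms(2,3) by (simp add: ennreal_mult sum_nonneg)
  then have "(norm z)\<^sup>2 \<le> K * (\<Sum>\<alpha>\<in>F. (N \<alpha>)\<^sup>2)"
    using assms(2) by (simp add: ennreal_le_iff sum_nonneg)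
  also have "\<dots> \<le> K * (\<Sum>\<alpha>\<in>F. N \<alpha>)\<^sup>2"
    using assms(2,4) by (intro mult_left_mono sum_squares_le_square_sum)
  also have "\<dots> = (sqrt K * (\<Sum>\<alpha>\<in>F. N \<alpha>))\<^sup>2" using assms(2) by (simp add: power_mult_distrib)
  finally show ?thesis
    by (rule power2_le_imp_le) (intro mult_nonneg_nonneg sum_nonneg assms(4) real_sqrt_ge_zero assms(2))
qed

lemma H_inftyD:
  assumes "f \<in> H_infty \<Omega>"
  shows "smooth_fun_on \<Omega> f"
    "\<alpha> \<in> lists Basis \<Longrightarrow> set_integrable lborel \<Omega> (\<lambda>x. (norm (multi_pd \<alpha> f x))\<^sup>2)"
  using assms by (auto simp: H_infty_def)

lemma smooth_line_derivative:
  assumes "open \<Omega>" "smooth_fun_on \<Omega> f" "p + s *\<^sub>R e \<in> \<Omega>"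
  shows "((\<lambda>s. f (p + s *\<^sub>R e)) has_vector_derivative pd e f (p + s *\<^sub>R e)) (at s)"
  using pd_line smooth_differentiable0 assms by blast

lemma measurable_norm_square_indicator:
  fixes g :: "'a::euclidean_space \<Rightarrow> complex"
  assumes "open \<Omega>" "continuous_on \<Omega> g"
  shows "(\<lambda>y. ennreal ((norm (g y))\<^sup>2) * indicator \<Omega> y) \<in> borel_measurable borel"
proof -
  have "(\<lambda>y. ennreal ((norm (indicator \<Omega> y *\<^sub>R g y))\<^sup>2)) \<in> borel_measurable borel"
    using borel_measurable_continuous_on_indicator[OF _ assms(2)] assms(1) by measurable
  moreover have "(\<lambda>y. ennreal ((norm (indicator \<Omega> y *\<^sub>R g y))\<^sup>2)) =
      (\<lambda>y. ennreal ((norm (g y))\<^sup>2) * indicator \<Omega> y)" by (auto simp: indicator_def)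
  ultimately show ?thesis by (simp only:)
qed

lemma sobolev_box_interval:
  assumes pq: "p < q"
  shows "sobolev_box {p<..<q :: real}"
  unfolding sobolev_box_def
proof (intro conjI exI ballI)
  show "{p<..<q} = box p q" by (simp add: box_real)
  show "{p<..<q} \<noteq> {}" using pq by simp
  show "finite {[], [1::real]}" "{[], [1::real]} \<subseteq> lists Basis" by auto
  fix f and x :: real assume f: "f \<in> H_infty {p<..<q}" and x: "x \<in> {p<..<q}"
  note sm = H_inftyD(1)[OF f]
  have c: "continuous_on {p<..<q} f" "continuous_on {p<..<q} (pd 1 f)"
    using smooth_continuous_on[OF _ sm, of "[]"] smooth_continuous_on[OF _ sm, of "[1]"] by auto
  have "ennreal ((norm (f x))\<^sup>2) \<le> ennreal (1 + 1 / (q - p)) *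
    (\<integral>\<^sup>+y. ennreal ((norm (f y))\<^sup>2 + (norm (pd 1 f y))\<^sup>2) * indicator {p<..<q} y \<partial>lborel)"
    using smooth_line_derivative[OF _ sm, of 0 _ 1] c x pq by (intro sobolev_interval_nn) auto
  also have "(\<integral>\<^sup>+y. ennreal ((norm (f y))\<^sup>2 + (norm (pd 1 f y))\<^sup>2) * indicator {p<..<q} y \<partial>lborel)
     = (\<integral>\<^sup>+y. ennreal ((norm (f y))\<^sup>2) * indicator {p<..<q} y
          + ennreal ((norm (pd 1 f y))\<^sup>2) * indicator {p<..<q} y \<partial>lborel)"
    by (intro nn_integral_cong) (auto simp: indicator_def)
  also have "\<dots> = ennreal ((L2norm {p<..<q} f)\<^sup>2) + ennreal ((L2norm {p<..<q} (pd 1 f))\<^sup>2)"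
  proof (subst nn_integral_add)
    show "(\<lambda>y. ennreal ((norm (f y))\<^sup>2) * indicator {p<..<q} y) \<in> borel_measurable lborel"
      "(\<lambda>y. ennreal ((norm (pd 1 f y))\<^sup>2) * indicator {p<..<q} y) \<in> borel_measurable lborel"
      using measurable_norm_square_indicator[OF _ c(1)] measurable_norm_square_indicator[OF _ c(2)] by auto
  qed (use L2norm_square[OF _ c(1)] L2norm_square[OF _ c(2)] H_inftyD(2)[OF f, of "[]"] H_inftyD(2)[OF f, of "[1]"] in auto)
  also have "\<dots> = ennreal (\<Sum>\<alpha>\<in>{[], [1]}. (L2norm {p<..<q} (multi_pd \<alpha> f))\<^sup>2)"
    by simp
  finally show "norm (f x) \<le> sqrt (1 + 1 / (q - p)) * (\<Sum>\<alpha>\<in>{[], [1]}. L2norm {p<..<q} (multi_pd \<alpha> f))"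
    using pq by (intro norm_le_sum_L2normI) (auto simp: L2norm_nonneg)
qed

lemma X_dom_box: "X_dom T = box (0, 0) (1, T)"
  by (auto simp: X_dom_def box_def Basis_prod_def)

lemma open_X_dom: "open (X_dom T)"
  by (simp add: X_dom_box open_box)

lemma Basis_real_prod: "(Basis :: (real \<times> real) set) = {(1, 0), (0, 1)}"
  by (auto simp: Basis_prod_def)

lemma X_dom_line_derivative:
  assumes "smooth_fun_on (X_dom T) f" "(x, t) \<in> X_dom T"
  shows "((\<lambda>x. f (x, t)) has_vector_derivative pd (1, 0) f (x, t)) (at x)"
    "((\<lambda>t. f (x, t)) has_vector_derivative pd (0, 1) f (x, t)) (at t)"
  using smooth_line_derivative[OF open_X_dom assms(1), of "(0, t)" x "(1, 0)"]
    smooth_line_derivative[OF open_X_dom assms(1), of "(x, 0)" t "(0, 1)"] assms(2)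
  by auto

text \<open>The one-dimensional estimate is applied in the space variable and then, to the function and its space
  derivative, in the time variable; this is how the mixed derivative enters.\<close>

lemma sobolev_box_X_dom:
  assumes T: "T > 0"
  shows "sobolev_box (X_dom T)"
  unfolding sobolev_box_def
proof (intro conjI exI ballI)
  let ?X = "X_dom T" and ?ex = "(1, 0) :: real \<times> real" and ?et = "(0, 1) :: real \<times> real"
  let ?F = "{[], [?ex], [?et], [?et, ?ex]}"
  show "X_dom T = box (0, 0) (1, T)" by (rule X_dom_box)
  have "(1 / 2, T / 2) \<in> X_dom T" using T by (simp add: X_dom_def)
  then show "X_dom T \<noteq> {}" by blast
  show "finite ?F" "?F \<subseteq> lists Basis" by (auto simp: Basis_real_prod)
  fix f and z assume f: "f \<in> H_infty ?X" and z: "z \<in> ?X"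
  obtain x t where xt: "z = (x, t)" by (cases z)
  have x: "x \<in> I01" and t: "t \<in> {0<..<T}" using z by (auto simp: xt X_dom_def)
  note sm = H_inftyD(1)[OF f]
  have smx: "smooth_fun_on ?X (pd ?ex f)" by (rule smooth_pd[OF sm]) (simp add: Basis_real_prod)
  have c: "continuous_on ?X (multi_pd \<alpha> f)" if "\<alpha> \<in> ?F" for \<alpha>
    using that by (intro smooth_continuous_on[OF open_X_dom sm]) (auto simp: Basis_real_prod)
  define k where "k w = (\<Sum>\<alpha>\<in>?F. (norm (multi_pd \<alpha> f w))\<^sup>2)" for w
  have row: "continuous_on {0<..<1} (\<lambda>y. g (y, s))" "continuous_on {0<..<T} (\<lambda>s. g (y, s))"
    if "continuous_on ?X g" "y \<in> I01" "s \<in> {0<..<T}" for g :: "real \<times> real \<Rightarrow> complex" and y s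
    using that by (auto intro!: continuous_on_compose2[OF that(1)] continuous_intros simp: X_dom_def)
  have col: "ennreal ((norm (f (y, t)))\<^sup>2 + (norm (pd ?ex f (y, t)))\<^sup>2) \<le> ennreal (1 + 1 / T) *
      (\<integral>\<^sup>+s. ennreal (k (y, s)) * indicator {0<..<T} s \<partial>lborel)" if y: "y \<in> I01" for y
  proof -
    have i: "ennreal ((norm (g (y, t)))\<^sup>2) \<le> ennreal (1 + 1 / T) *
      (\<integral>\<^sup>+s. ennreal ((norm (g (y, s)))\<^sup>2 + (norm (pd ?et g (y, s)))\<^sup>2) * indicator {0<..<T} s \<partial>lborel)"
      if "smooth_fun_on ?X g" for g
    proof -
      have "continuous_on ?X (pd ?et g)"
        using smooth_continuous_on[OF open_X_dom that, of "[?et]"] by (simp add: Basis_real_prod)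
      then show ?thesis
        using sobolev_interval_nn[of 0 T "\<lambda>s. g (y, s)" "\<lambda>s. pd ?et g (y, s)" t]
          X_dom_line_derivative(2)[OF that] row(2) T y t by (simp add: X_dom_def)
    qed
    have m: "(\<lambda>s. ennreal ((norm (g (y, s)))\<^sup>2 + (norm (pd ?et g (y, s)))\<^sup>2) * indicator {0<..<T} s)
        \<in> borel_measurable borel" if "smooth_fun_on ?X g" for g
    proof -
      have "continuous_on ?X g" "continuous_on ?X (pd ?et g)"
        using smooth_continuous_on[OF open_X_dom that, of "[]"]
          smooth_continuous_on[OF open_X_dom that, of "[?et]"] by (auto simp: Basis_real_prod)
      then have "(\<lambda>s. ennreal ((norm (g (y, s)))\<^sup>2) * indicator {0<..<T} s
           + ennreal ((norm (pd ?et g (y, s)))\<^sup>2) * indicator {0<..<T} s) \<in> borel_measurable borel"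
        using row(2) y t by (intro borel_measurable_add measurable_norm_square_indicator) auto
      then show ?thesis by (simp add: distrib_right)
    qed
    have "ennreal ((norm (f (y, t)))\<^sup>2 + (norm (pd ?ex f (y, t)))\<^sup>2) \<le> ennreal (1 + 1 / T) *
      ((\<integral>\<^sup>+s. ennreal ((norm (f (y, s)))\<^sup>2 + (norm (pd ?et f (y, s)))\<^sup>2) * indicator {0<..<T} s \<partial>lborel)
     + (\<integral>\<^sup>+s. ennreal ((norm (pd ?ex f (y, s)))\<^sup>2 + (norm (pd ?et (pd ?ex f) (y, s)))\<^sup>2) * indicator {0<..<T} s \<partial>lborel))"
      using add_mono[OF i[OF sm] i[OF smx]] by (simp add: distrib_left)
    also have "\<dots> = ennreal (1 + 1 / T) * (\<integral>\<^sup>+s. ennreal (k (y, s)) * indicator {0<..<T} s \<partial>lborel)"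
      using m[OF sm] m[OF smx]
      by (subst nn_integral_add[symmetric]) (auto intro!: arg_cong2[of _ _ _ _ "(*)"] nn_integral_cong
          simp: k_def indicator_def add_ac simp flip: ennreal_plus)
    finally show ?thesis .
  qed
  have ck: "continuous_on ?X k"
    unfolding k_def using c by (intro continuous_intros) auto
  have mk: "(\<lambda>w. ennreal (k w) * indicator ?X w) \<in> borel_measurable borel"
  proof -
    have "(\<lambda>w. ennreal (indicator ?X w *\<^sub>R k w)) \<in> borel_measurable borel"
      using borel_measurable_continuous_on_indicator[OF _ ck] open_X_dom by measurable
    moreover have "(\<lambda>w. ennreal (indicator ?X w *\<^sub>R k w)) = (\<lambda>w. ennreal (k w) * indicator ?X w)"
      by (auto simp: indicator_def)
    ultimately show ?thesis by simp
  qed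
  have mk2: "(\<lambda>w. ennreal (k w) * indicator ?X w) \<in> borel_measurable (lborel \<Otimes>\<^sub>M lborel)"
    using mk by (simp add: lborel_prod)
  have "ennreal ((norm (f (x, t)))\<^sup>2) \<le> ennreal (1 + 1 / (1 - 0)) *
     (\<integral>\<^sup>+y. ennreal ((norm (f (y, t)))\<^sup>2 + (norm (pd ?ex f (y, t)))\<^sup>2) * indicator I01 y \<partial>lborel)"
    using X_dom_line_derivative(1)[OF sm] row(1)[OF c[of "[?ex]"]] x t
    by (intro sobolev_interval_nn) (auto simp: X_dom_def)
  also have "\<dots> \<le> ennreal (1 + 1 / (1 - 0)) * (\<integral>\<^sup>+y. ennreal (1 + 1 / T) *
      (\<integral>\<^sup>+s. ennreal (k (y, s)) * indicator ?X (y, s) \<partial>lborel) \<partial>lborel)"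
  proof (intro mult_left_mono nn_integral_mono)
    fix y :: real
    show "ennreal ((norm (f (y, t)))\<^sup>2 + (norm (pd ?ex f (y, t)))\<^sup>2) * indicator I01 y \<le> ennreal (1 + 1 / T) *
      (\<integral>\<^sup>+s. ennreal (k (y, s)) * indicator ?X (y, s) \<partial>lborel)"
    proof (cases "y \<in> I01")
      case True
      then have "(indicator ?X (y, s) :: ennreal) = indicator {0<..<T} s" for s
        by (auto simp: indicator_def X_dom_def)
      then show ?thesis using col[OF True] True by simp
    qed simp
  qed simp
  also have "\<dots> = ennreal (2 * (1 + 1 / T)) * (\<integral>\<^sup>+w. ennreal (k w) * indicator ?X w \<partial>lborel)"
  proof -
    have "(\<integral>\<^sup>+y. ennreal (1 + 1 / T) * (\<integral>\<^sup>+s. ennreal (k (y, s)) * indicator ?X (y, s) \<partial>lborel) \<partial>lborel)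
        = ennreal (1 + 1 / T) * (\<integral>\<^sup>+y. (\<integral>\<^sup>+s. ennreal (k (y, s)) * indicator ?X (y, s) \<partial>lborel) \<partial>lborel)"
      using lborel.borel_measurable_nn_integral_fst[OF mk2] by (intro nn_integral_cmult) simp
    also have "(\<integral>\<^sup>+y. (\<integral>\<^sup>+s. ennreal (k (y, s)) * indicator ?X (y, s) \<partial>lborel) \<partial>lborel)
        = (\<integral>\<^sup>+w. ennreal (k w) * indicator ?X w \<partial>lborel)"
      using lborel.nn_integral_fst[OF mk2] by (simp add: lborel_prod)
    finally have "(\<integral>\<^sup>+y. ennreal (1 + 1 / T) * (\<integral>\<^sup>+s. ennreal (k (y, s)) * indicator ?X (y, s) \<partial>lborel) \<partial>lborel)
        = ennreal (1 + 1 / T) * (\<integral>\<^sup>+w. ennreal (k w) * indicator ?X w \<partial>lborel)" .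
    moreover have "ennreal (2 * (1 + 1 / T)) = ennreal (1 + 1 / (1 - 0)) * ennreal (1 + 1 / T)"
      using T by (subst ennreal_mult[symmetric]) auto
    ultimately show ?thesis by (simp only: mult.assoc)
  qed
  also have "(\<integral>\<^sup>+w. ennreal (k w) * indicator ?X w \<partial>lborel) = ennreal (\<Sum>\<alpha>\<in>?F. (L2norm ?X (multi_pd \<alpha> f))\<^sup>2)"
  proof -
    have "(\<integral>\<^sup>+w. ennreal (k w) * indicator ?X w \<partial>lborel) =
        (\<integral>\<^sup>+w. (\<Sum>\<alpha>\<in>?F. ennreal ((norm (multi_pd \<alpha> f w))\<^sup>2) * indicator ?X w) \<partial>lborel)"
      unfolding k_def by (simp only: sum_distrib_right[symmetric] sum_ennreal[symmetric] zero_le_power2)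
    also have "\<dots> = (\<Sum>\<alpha>\<in>?F. \<integral>\<^sup>+w. ennreal ((norm (multi_pd \<alpha> f w))\<^sup>2) * indicator ?X w \<partial>lborel)"
      using measurable_norm_square_indicator[OF open_X_dom c] by (intro nn_integral_sum) auto
    also have "\<dots> = (\<Sum>\<alpha>\<in>?F. ennreal ((L2norm ?X (multi_pd \<alpha> f))\<^sup>2))"
    proof (rule sum.cong[OF refl])
      fix \<alpha> assume "\<alpha> \<in> ?F"
      moreover have "\<alpha> \<in> lists Basis" using \<open>\<alpha> \<in> ?F\<close> by (auto simp: Basis_real_prod)
      ultimately show "(\<integral>\<^sup>+w. ennreal ((norm (multi_pd \<alpha> f w))\<^sup>2) * indicator ?X w \<partial>lborel)
          = ennreal ((L2norm ?X (multi_pd \<alpha> f))\<^sup>2)"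
        by (intro L2norm_square[OF open_X_dom c H_inftyD(2)[OF f]])
    qed
    also have "\<dots> = ennreal (\<Sum>\<alpha>\<in>?F. (L2norm ?X (multi_pd \<alpha> f))\<^sup>2)" by (intro sum_ennreal) auto
    finally show ?thesis .
  qed
  finally show "norm (f z) \<le> sqrt (2 * (1 + 1 / T)) * (\<Sum>\<alpha>\<in>?F. L2norm ?X (multi_pd \<alpha> f))"
    using T unfolding xt by (intro norm_le_sum_L2normI) (auto simp: L2norm_nonneg)
qed

section \<open>Moderate and null families in terms of suprema\<close>

definition bounded_smooth :: "'a::euclidean_space set \<Rightarrow> ('a \<Rightarrow> complex) \<Rightarrow> bool" where
  "bounded_smooth \<Omega> f \<longleftrightarrow> smooth_fun_on \<Omega> f \<and>
     (\<forall>\<alpha>\<in>lists Basis. \<exists>M. \<forall>x\<in>\<Omega>. norm (multi_pd \<alpha> f x) \<le> M)"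

lemma sobolev_box_geometry:
  assumes "sobolev_box \<Omega>"
  shows "open \<Omega>" "convex \<Omega>" "bounded \<Omega>" "\<Omega> \<noteq> {}" "emeasure lborel \<Omega> < \<infinity>"
    "0 < measure lborel \<Omega>" "\<Omega> \<in> sets borel"
proof -
  obtain l u where b: "\<Omega> = box l u" and ne: "\<Omega> \<noteq> {}"
    using assms by (auto simp: sobolev_box_def)
  show "open \<Omega>" "convex \<Omega>" "bounded \<Omega>" "\<Omega> \<noteq> {}" "\<Omega> \<in> sets borel" using b ne by auto
  show f: "emeasure lborel \<Omega> < \<infinity>" unfolding b by (rule emeasure_lborel_box_finite)
  have lu: "\<And>i. i \<in> Basis \<Longrightarrow> l \<bullet> i < u \<bullet> i" using ne by (auto simp: b box_eq_empty not_le)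
  then have "measure lborel \<Omega> = (\<Prod>i\<in>Basis. (u - l) \<bullet> i)"
    unfolding b by (intro measure_lborel_box) (simp add: less_imp_le)
  then show "0 < measure lborel \<Omega>"
    using lu by (auto simp: inner_diff_left intro!: prod_pos)
qed

lemma H_infty_multi_pd: "f \<in> H_infty \<Omega> \<Longrightarrow> \<alpha> \<in> lists Basis \<Longrightarrow> multi_pd \<alpha> f \<in> H_infty \<Omega>"
  unfolding H_infty_def
  by (auto simp: smooth_multi_pd simp flip: multi_pd_append)

lemma bounded_continuous_square_integrable:
  assumes "open \<Omega>" "emeasure lborel \<Omega> < \<infinity>" "continuous_on \<Omega> f" "\<And>x. x \<in> \<Omega> \<Longrightarrow> norm (f x) \<le> M"
  shows "set_integrable lborel \<Omega> (\<lambda>x. (norm (f x :: complex))\<^sup>2)"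
proof -
  have "continuous_on \<Omega> (\<lambda>x. (norm (f x))\<^sup>2)" using assms(3) by (intro continuous_intros)
  then have m: "(\<lambda>x. indicator \<Omega> x *\<^sub>R (norm (f x))\<^sup>2) \<in> borel_measurable borel"
    using assms(1) by (intro borel_measurable_continuous_on_indicator) auto
  have "integrable lborel (\<lambda>x. indicator \<Omega> x *\<^sub>R (indicator \<Omega> x *\<^sub>R (norm (f x))\<^sup>2))"
    using assms(1,2,4) m
    by (intro integrableI_bounded_set_indicator[where B="M\<^sup>2"]) (auto intro!: power_mono)
  moreover have "(\<lambda>x. indicator \<Omega> x *\<^sub>R (indicator \<Omega> x *\<^sub>R (norm (f x))\<^sup>2)) =
      (\<lambda>x. indicator \<Omega> x *\<^sub>R (norm (f x))\<^sup>2)" by (auto simp: indicator_def)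
  ultimately show ?thesis unfolding set_integrable_def by (simp only:)
qed

lemma L2norm_le:
  assumes "open \<Omega>" "emeasure lborel \<Omega> < \<infinity>" "continuous_on \<Omega> f"
    "\<And>x. x \<in> \<Omega> \<Longrightarrow> norm (f x) \<le> M" "0 \<le> M"
  shows "L2norm \<Omega> f \<le> sqrt (measure lborel \<Omega>) * M"
proof -
  have "set_integrable lborel \<Omega> (\<lambda>x. M\<^sup>2)"
    using assms(1,2) by (simp add: set_integrable_def)
  then have "(LINT x:\<Omega>|lborel. (norm (f x))\<^sup>2) \<le> (LINT x:\<Omega>|lborel. M\<^sup>2)"
    using bounded_continuous_square_integrable[OF assms(1-4)] assms(4)
    by (intro set_integral_mono) (auto intro!: power_mono)
  also have "\<dots> = measure lborel \<Omega> * M\<^sup>2"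
    using assms(1,2) by (simp add: set_lebesgue_integral_def)
  finally have "L2norm \<Omega> f \<le> sqrt (measure lborel \<Omega> * M\<^sup>2)"
    unfolding L2norm_def by (rule real_sqrt_le_mono)
  then show ?thesis using assms(5) by (simp add: real_sqrt_mult)
qed

lemma H_infty_iff_bounded_smooth:
  assumes \<Omega>: "sobolev_box \<Omega>"
  shows "f \<in> H_infty \<Omega> \<longleftrightarrow> bounded_smooth \<Omega> f"
proof
  assume f: "f \<in> H_infty \<Omega>"
  obtain F K where FK: "\<And>f x. f \<in> H_infty \<Omega> \<Longrightarrow> x \<in> \<Omega> \<Longrightarrow> norm (f x) \<le> K * (\<Sum>\<alpha>\<in>F. L2norm \<Omega> (multi_pd \<alpha> f))"
    using \<Omega> unfolding sobolev_box_def by blast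
  show "bounded_smooth \<Omega> f"
    unfolding bounded_smooth_def using H_inftyD(1)[OF f] FK[OF H_infty_multi_pd[OF f]] by blast
next
  assume f: "bounded_smooth \<Omega> f"
  have "set_integrable lborel \<Omega> (\<lambda>x. (norm (multi_pd \<alpha> f x))\<^sup>2)" if \<alpha>: "\<alpha> \<in> lists Basis" for \<alpha>
  proof -
    obtain M where "\<And>x. x \<in> \<Omega> \<Longrightarrow> norm (multi_pd \<alpha> f x) \<le> M"
      using f \<alpha> unfolding bounded_smooth_def by blast
    then show ?thesis
      using f sobolev_box_geometry[OF \<Omega>] \<alpha>
      by (intro bounded_continuous_square_integrable smooth_continuous_on) (auto simp: bounded_smooth_def)
  qed
  then show "f \<in> H_infty \<Omega>" using f by (auto simp: H_infty_def bounded_smooth_def)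
qed

lemma growth_of_L2norm:
  assumes \<Omega>: "sobolev_box \<Omega>" and u: "\<And>\<epsilon>. 0 < \<epsilon> \<Longrightarrow> \<epsilon> \<le> 1 \<Longrightarrow> u \<epsilon> \<in> H_infty \<Omega>"
    and o: "\<And>\<beta>. \<beta> \<in> lists Basis \<Longrightarrow> net_order (P \<beta>) (\<lambda>\<epsilon>. L2norm \<Omega> (multi_pd \<beta> (u \<epsilon>)))"
    and \<alpha>: "\<alpha> \<in> lists Basis"
  obtains F where "finite F" "F \<subseteq> lists Basis"
    "\<forall>R. (\<forall>\<beta>\<in>F. P (\<beta> @ \<alpha>) \<le> R) \<longrightarrow> growth (\<lambda>_. \<Omega>) R (\<lambda>\<epsilon>. multi_pd \<alpha> (u \<epsilon>))"
proof -
  obtain F K where F: "finite F" "F \<subseteq> lists Basis"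
    and K: "\<And>f x. f \<in> H_infty \<Omega> \<Longrightarrow> x \<in> \<Omega> \<Longrightarrow> norm (f x) \<le> K * (\<Sum>\<alpha>\<in>F. L2norm \<Omega> (multi_pd \<alpha> f))"
    using \<Omega> unfolding sobolev_box_def by blast
  have "growth (\<lambda>_. \<Omega>) R (\<lambda>\<epsilon>. multi_pd \<alpha> (u \<epsilon>))" if R: "\<forall>\<beta>\<in>F. P (\<beta> @ \<alpha>) \<le> R" for R
  proof (rule growthI)
    show "net_order R (\<lambda>\<epsilon>. K * (\<Sum>\<beta>\<in>F. L2norm \<Omega> (multi_pd (\<beta> @ \<alpha>) (u \<epsilon>))))"
    proof (intro net_order_cmult net_order_sum)
      fix \<beta> assume "\<beta> \<in> F"
      then have "\<beta> @ \<alpha> \<in> lists Basis" "P (\<beta> @ \<alpha>) \<le> R" using F \<alpha> R by force+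
      then show "net_order R (\<lambda>\<epsilon>. L2norm \<Omega> (multi_pd (\<beta> @ \<alpha>) (u \<epsilon>)))"
        by (rule net_order_mono[OF o])
    qed
    show "\<forall>\<^sub>F \<epsilon> in at_right 0. \<forall>p\<in>\<Omega>. norm (multi_pd \<alpha> (u \<epsilon>) p) \<le>
        K * (\<Sum>\<beta>\<in>F. L2norm \<Omega> (multi_pd (\<beta> @ \<alpha>) (u \<epsilon>)))"
      using eventually_unit
    proof eventually_elim
      case (elim \<epsilon>)
      then show ?case
        using K[OF H_infty_multi_pd[OF u \<alpha>]] by (simp add: multi_pd_append)
    qed
  qed
  then show thesis by (intro that[OF F]) blast
qed

lemma growth_of_L2norm_uniform:
  assumes "sobolev_box \<Omega>" "\<And>\<epsilon>. 0 < \<epsilon> \<Longrightarrow> \<epsilon> \<le> 1 \<Longrightarrow> u \<epsilon> \<in> H_infty \<Omega>"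
    and "\<And>\<beta>. \<beta> \<in> lists Basis \<Longrightarrow> net_order P (\<lambda>\<epsilon>. L2norm \<Omega> (multi_pd \<beta> (u \<epsilon>)))"
    and "\<alpha> \<in> lists Basis"
  shows "growth (\<lambda>_. \<Omega>) P (\<lambda>\<epsilon>. multi_pd \<alpha> (u \<epsilon>))"
  by (rule growth_of_L2norm[where u=u and P="\<lambda>_. P", OF assms]) blast+

lemma L2norm_of_growth:
  assumes \<Omega>: "sobolev_box \<Omega>" and u: "\<And>\<epsilon>. 0 < \<epsilon> \<Longrightarrow> \<epsilon> \<le> 1 \<Longrightarrow> smooth_fun_on \<Omega> (u \<epsilon>)"
    and \<alpha>: "\<alpha> \<in> lists Basis" and g: "growth (\<lambda>_. \<Omega>) P (\<lambda>\<epsilon>. multi_pd \<alpha> (u \<epsilon>))"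
  shows "net_order P (\<lambda>\<epsilon>. L2norm \<Omega> (multi_pd \<alpha> (u \<epsilon>)))"
proof -
  obtain m where m: "net_order P m" "\<forall>\<epsilon>. 0 \<le> m \<epsilon>"
    "\<forall>\<^sub>F \<epsilon> in at_right 0. \<forall>p\<in>\<Omega>. norm (multi_pd \<alpha> (u \<epsilon>) p) \<le> m \<epsilon>" using g by (rule growthE)
  have "\<forall>\<^sub>F \<epsilon> in at_right 0. \<bar>L2norm \<Omega> (multi_pd \<alpha> (u \<epsilon>))\<bar> \<le> \<bar>sqrt (measure lborel \<Omega>) * m \<epsilon>\<bar>"
    using m(3) eventually_unit
  proof eventually_elim
    case (elim \<epsilon>)
    have "L2norm \<Omega> (multi_pd \<alpha> (u \<epsilon>)) \<le> sqrt (measure lborel \<Omega>) * m \<epsilon>"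
      using elim m(2) u sobolev_box_geometry[OF \<Omega>] \<alpha>
      by (intro L2norm_le smooth_continuous_on) auto
    then show ?case using L2norm_nonneg[of \<Omega> "multi_pd \<alpha> (u \<epsilon>)"] by linarith
  qed
  then show ?thesis by (rule net_order_le[OF net_order_cmult[OF m(1)] order_refl])
qed

lemma moderate_iff:
  assumes \<Omega>: "sobolev_box \<Omega>"
  shows "u \<in> moderate \<Omega> \<longleftrightarrow> (\<forall>\<epsilon>\<in>{0<..1}. bounded_smooth \<Omega> (u \<epsilon>)) \<and>
    (\<forall>\<alpha>\<in>lists Basis. \<exists>P. growth (\<lambda>_. \<Omega>) P (\<lambda>\<epsilon>. multi_pd \<alpha> (u \<epsilon>)))"
proof
  assume u: "u \<in> moderate \<Omega>"
  then have H: "\<And>\<epsilon>. 0 < \<epsilon> \<Longrightarrow> \<epsilon> \<le> 1 \<Longrightarrow> u \<epsilon> \<in> H_infty \<Omega>" by (auto simp: moderate_def)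
  have "\<forall>\<beta>\<in>lists Basis. \<exists>p. net_order p (\<lambda>\<epsilon>. L2norm \<Omega> (multi_pd \<beta> (u \<epsilon>)))"
    using u net_order_bigo unfolding moderate_def by blast
  then obtain p where p: "\<And>\<beta>. \<beta> \<in> lists Basis \<Longrightarrow> net_order (p \<beta>) (\<lambda>\<epsilon>. L2norm \<Omega> (multi_pd \<beta> (u \<epsilon>)))"
    by metis
  have "\<exists>P. growth (\<lambda>_. \<Omega>) P (\<lambda>\<epsilon>. multi_pd \<alpha> (u \<epsilon>))" if \<alpha>: "\<alpha> \<in> lists Basis" for \<alpha>
  proof -
    obtain F where F: "finite F" "F \<subseteq> lists Basis"
      and R: "\<forall>R. (\<forall>\<beta>\<in>F. p (\<beta> @ \<alpha>) \<le> R) \<longrightarrow> growth (\<lambda>_. \<Omega>) R (\<lambda>\<epsilon>. multi_pd \<alpha> (u \<epsilon>))"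
      by (rule growth_of_L2norm[where u=u and P=p, OF \<Omega> H p \<alpha>])
    have "\<forall>\<beta>\<in>F. p (\<beta> @ \<alpha>) \<le> Max ((\<lambda>\<beta>. p (\<beta> @ \<alpha>)) ` F)" using F by auto
    then show ?thesis using R by blast
  qed
  then show "(\<forall>\<epsilon>\<in>{0<..1}. bounded_smooth \<Omega> (u \<epsilon>)) \<and>
    (\<forall>\<alpha>\<in>lists Basis. \<exists>P. growth (\<lambda>_. \<Omega>) P (\<lambda>\<epsilon>. multi_pd \<alpha> (u \<epsilon>)))"
    using H H_infty_iff_bounded_smooth[OF \<Omega>] by auto
next
  assume u: "(\<forall>\<epsilon>\<in>{0<..1}. bounded_smooth \<Omega> (u \<epsilon>)) \<and>
    (\<forall>\<alpha>\<in>lists Basis. \<exists>P. growth (\<lambda>_. \<Omega>) P (\<lambda>\<epsilon>. multi_pd \<alpha> (u \<epsilon>)))"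
  have "\<exists>p\<ge>0. (\<lambda>\<epsilon>. L2norm \<Omega> (multi_pd \<alpha> (u \<epsilon>))) \<in> O[at_right 0](\<lambda>\<epsilon>. \<epsilon> powr (- p))"
    if \<alpha>: "\<alpha> \<in> lists Basis" for \<alpha>
  proof -
    obtain P where "growth (\<lambda>_. \<Omega>) P (\<lambda>\<epsilon>. multi_pd \<alpha> (u \<epsilon>))" using u \<alpha> by blast
    then have "growth (\<lambda>_. \<Omega>) (max P 0) (\<lambda>\<epsilon>. multi_pd \<alpha> (u \<epsilon>))" by (rule growth_mono) simp
    then have "net_order (max P 0) (\<lambda>\<epsilon>. L2norm \<Omega> (multi_pd \<alpha> (u \<epsilon>)))"
      using u by (intro L2norm_of_growth[OF \<Omega> _ \<alpha>]) (auto simp: bounded_smooth_def)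
    then show ?thesis using net_order_imp_bigo by (intro exI[of _ "max P 0 + 1"]) auto
  qed
  then show "u \<in> moderate \<Omega>"
    using u H_infty_iff_bounded_smooth[OF \<Omega>] unfolding moderate_def by auto
qed

lemma moderateD:
  assumes "sobolev_box \<Omega>" "u \<in> moderate \<Omega>"
  shows "0 < \<epsilon> \<Longrightarrow> \<epsilon> \<le> 1 \<Longrightarrow> bounded_smooth \<Omega> (u \<epsilon>)"
    "0 < \<epsilon> \<Longrightarrow> \<epsilon> \<le> 1 \<Longrightarrow> smooth_fun_on \<Omega> (u \<epsilon>)"
    "\<alpha> \<in> lists Basis \<Longrightarrow> \<exists>P. growth (\<lambda>_. \<Omega>) P (\<lambda>\<epsilon>. multi_pd \<alpha> (u \<epsilon>))"
  using assms moderate_iff[OF assms(1), of u] by (auto simp: bounded_smooth_def)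

lemma lipschitz_of_pd_bound:
  fixes f :: "'a::euclidean_space \<Rightarrow> complex"
  assumes "open \<Omega>" "convex \<Omega>" "\<And>x. x \<in> \<Omega> \<Longrightarrow> f differentiable at x"
    and M: "\<And>i x. i \<in> Basis \<Longrightarrow> x \<in> \<Omega> \<Longrightarrow> norm (pd i f x) \<le> M i"
    and "x \<in> \<Omega>" "y \<in> \<Omega>"
  shows "norm (f x - f y) \<le> (\<Sum>i\<in>Basis. M i) * norm (x - y)"
proof (rule differentiable_bound[OF assms(2)])
  fix z assume z: "z \<in> \<Omega>"
  have D: "(f has_derivative (\<lambda>v. pd v f z)) (at z)" by (rule has_derivative_pd[OF assms(3)[OF z]])
  then show "(f has_derivative (\<lambda>v. pd v f z)) (at z within \<Omega>)" by (rule has_derivative_at_withinI)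
  show "onorm (\<lambda>v. pd v f z) \<le> (\<Sum>i\<in>Basis. M i)"
  proof (rule onorm_le)
    fix v
    have "pd v f z = pd (\<Sum>i\<in>Basis. (v \<bullet> i) *\<^sub>R i) f z" by (simp add: euclidean_representation)
    also have "\<dots> = (\<Sum>i\<in>Basis. (v \<bullet> i) *\<^sub>R pd i f z)"
    proof -
      interpret linear "\<lambda>v. pd v f z" by (rule has_derivative_linear[OF D])
      show ?thesis by (simp only: sum scale)
    qed
    finally have "norm (pd v f z) \<le> (\<Sum>i\<in>Basis. \<bar>v \<bullet> i\<bar> * norm (pd i f z))"
      by (simp add: norm_sum order_trans[OF norm_sum])
    also have "\<dots> \<le> (\<Sum>i\<in>Basis. norm v * M i)"
      using M z by (intro sum_mono mult_mono) (auto simp: Basis_le_norm)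
    finally show "norm (pd v f z) \<le> (\<Sum>i\<in>Basis. M i) * norm v"
      by (simp add: sum_distrib_left mult.commute)
  qed
qed (use assms in auto)

text \<open>The Lipschitz constants are sums of suprema of first derivatives.\<close>

lemma moderate_lipschitz:
  fixes u :: "'a::euclidean_space family"
  assumes \<Omega>: "sobolev_box \<Omega>" and u: "u \<in> moderate \<Omega>" and \<alpha>: "\<alpha> \<in> lists Basis"
  obtains R L where "net_order R L" "\<forall>\<epsilon>. 0 \<le> L \<epsilon>"
    "\<forall>\<^sub>F \<epsilon> in at_right 0. \<forall>x\<in>\<Omega>. \<forall>y\<in>\<Omega>. norm (multi_pd \<alpha> (u \<epsilon>) x - multi_pd \<alpha> (u \<epsilon>) y) \<le> L \<epsilon> * norm (x - y)"
proof -
  note geo = sobolev_box_geometry[OF \<Omega>]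
  define ok where "ok i R m \<longleftrightarrow> net_order R m \<and> (\<forall>\<epsilon>. 0 \<le> m \<epsilon>) \<and>
    (\<forall>\<^sub>F \<epsilon> in at_right 0. \<forall>p\<in>\<Omega>. norm (pd i (multi_pd \<alpha> (u \<epsilon>)) p) \<le> m \<epsilon>)" for i R m
  have "\<exists>R m. ok i R m" if i: "i \<in> Basis" for i
    using moderateD(3)[OF \<Omega> u, of "i # \<alpha>"] i \<alpha> unfolding ok_def by (auto elim!: growthE)
  then have "\<forall>i\<in>Basis. \<exists>R m. ok i R m" by blast
  then obtain R where "\<forall>i\<in>Basis. \<exists>m. ok i (R i) m" by (rule bchoice[THEN exE])
  then obtain m where ok: "\<forall>i\<in>Basis. ok i (R i) (m i)" by (rule bchoice[THEN exE])
  have m: "\<And>i. i \<in> Basis \<Longrightarrow> net_order (R i) (m i)" "\<And>i \<epsilon>. i \<in> Basis \<Longrightarrow> 0 \<le> m i \<epsilon>"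
    "\<And>i. i \<in> Basis \<Longrightarrow> \<forall>\<^sub>F \<epsilon> in at_right 0. \<forall>p\<in>\<Omega>. norm (pd i (multi_pd \<alpha> (u \<epsilon>)) p) \<le> m i \<epsilon>"
    using ok unfolding ok_def by auto
  show thesis
  proof (rule that)
    show "net_order (Max (R ` Basis)) (\<lambda>\<epsilon>. \<Sum>i\<in>Basis. m i \<epsilon>)"
      by (intro net_order_sum net_order_mono[OF m(1)]) auto
    show "\<forall>\<epsilon>. 0 \<le> (\<Sum>i\<in>Basis. m i \<epsilon>)" using m(2) by (auto intro: sum_nonneg)
    have "\<forall>\<^sub>F \<epsilon> in at_right 0. \<forall>i\<in>Basis. \<forall>p\<in>\<Omega>. norm (pd i (multi_pd \<alpha> (u \<epsilon>)) p) \<le> m i \<epsilon>"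
      using m(3) by (intro eventually_ball_finite) auto
    then show "\<forall>\<^sub>F \<epsilon> in at_right 0. \<forall>x\<in>\<Omega>. \<forall>y\<in>\<Omega>.
        norm (multi_pd \<alpha> (u \<epsilon>) x - multi_pd \<alpha> (u \<epsilon>) y) \<le> (\<Sum>i\<in>Basis. m i \<epsilon>) * norm (x - y)"
      using eventually_unit
    proof eventually_elim
      case (elim \<epsilon>)
      have d: "multi_pd \<alpha> (u \<epsilon>) differentiable at x" if "x \<in> \<Omega>" for x
        using smooth_differentiable[OF geo(1) moderateD(2)[OF \<Omega> u] \<alpha> that] elim by blast
      show ?case
        using elim(1) by (intro ballI lipschitz_of_pd_bound[OF geo(1,2) d]) auto
    qed
  qed
qed

text \<open>The value of a Lipschitz function at \<open>p\<close> is compared with its mean square over the image of \<open>\<Omega>\<close>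
  under the homothety with centre \<open>p\<close> and ratio \<open>h\<close>, which stays in \<open>\<Omega>\<close> by convexity.\<close>

lemma square_le_mean_square:
  fixes f :: "'a::euclidean_space \<Rightarrow> complex"
  assumes \<Omega>: "sobolev_box \<Omega>" and f: "f \<in> H_infty \<Omega>" and p: "p \<in> \<Omega>" and h: "0 < h" "h \<le> 1"
    and lip: "\<And>q. q \<in> \<Omega> \<Longrightarrow> norm (f p - f q) \<le> L * norm (p - q)" and L: "0 \<le> L"
  shows "measure lborel \<Omega> * (norm (f p))\<^sup>2 \<le>
    2 / h ^ DIM('a) * (L2norm \<Omega> f)\<^sup>2 + 2 * measure lborel \<Omega> * (h * L * diameter \<Omega>)\<^sup>2"
proof -
  note geo = sobolev_box_geometry[OF \<Omega>]
  have cf: "continuous_on \<Omega> f" using smooth_continuous_on[OF geo(1) H_inftyD(1)[OF f], of "[]"] by simp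
  define G where "G x = ennreal ((norm (f x))\<^sup>2) * indicator \<Omega> x" for x
  have mG[measurable]: "G \<in> borel_measurable borel"
    unfolding G_def by (rule measurable_norm_square_indicator[OF geo(1) cf])
  have IG: "integral\<^sup>N lborel G = ennreal ((L2norm \<Omega> f)\<^sup>2)"
    unfolding G_def using L2norm_square[OF geo(1) cf] H_inftyD(2)[OF f, of "[]"] by simp
  define t where "t = p - h *\<^sub>R p"
  define d where "d = (h * L * diameter \<Omega>)\<^sup>2"
  have scale: "ennreal (h ^ DIM('a)) * (\<integral>\<^sup>+x. G (t + h *\<^sub>R x) \<partial>lborel) = ennreal ((L2norm \<Omega> f)\<^sup>2)"
  proof -
    have "integral\<^sup>N lborel G = integral\<^sup>N (density (distr lborel borel (\<lambda>x. t + h *\<^sub>R x)) (\<lambda>_. \<bar>h\<bar> ^ DIM('a))) G"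
      using lborel_affine[of h t] h by simp
    also have "\<dots> = ennreal (h ^ DIM('a)) * (\<integral>\<^sup>+x. G (t + h *\<^sub>R x) \<partial>lborel)"
      using h by (simp add: nn_integral_density nn_integral_distr nn_integral_cmult)
    finally show ?thesis using IG by simp
  qed
  have pt: "ennreal ((norm (f p))\<^sup>2) * indicator \<Omega> x \<le> 2 * G (t + h *\<^sub>R x) + ennreal (2 * d) * indicator \<Omega> x" for x
  proof (cases "x \<in> \<Omega>")
    case True
    have q: "t + h *\<^sub>R x = (1 - h) *\<^sub>R p + h *\<^sub>R x" by (simp add: t_def algebra_simps)
    then have inq: "t + h *\<^sub>R x \<in> \<Omega>" using convexD[OF geo(2) p True, of "1 - h" h] h by simp
    have "p - (t + h *\<^sub>R x) = h *\<^sub>R (p - x)" by (simp add: t_def algebra_simps)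
    then have "norm (f p - f (t + h *\<^sub>R x)) \<le> L * (h * norm (p - x))"
      using lip[OF inq] h by simp
    also have "\<dots> \<le> L * (h * diameter \<Omega>)"
      using diameter_bounded_bound[OF geo(3) p True] L h by (intro mult_left_mono) (auto simp: dist_norm)
    finally have "norm (f p - f (t + h *\<^sub>R x)) \<le> h * L * diameter \<Omega>" by (simp add: algebra_simps)
    then have le: "(norm (f p - f (t + h *\<^sub>R x)))\<^sup>2 \<le> d" unfolding d_def by (intro power_mono) auto
    have "norm (f p) \<le> norm (f (t + h *\<^sub>R x)) + norm (f p - f (t + h *\<^sub>R x))"
      using norm_triangle_sub[of "f p" "f (t + h *\<^sub>R x)"] by simp
    then have "(norm (f p))\<^sup>2 \<le> (norm (f (t + h *\<^sub>R x)) + norm (f p - f (t + h *\<^sub>R x)))\<^sup>2"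
      by (intro power_mono) auto
    also have "\<dots> \<le> 2 * (norm (f (t + h *\<^sub>R x)))\<^sup>2 + 2 * (norm (f p - f (t + h *\<^sub>R x)))\<^sup>2"
      using abs_2_inner_le[of "norm (f (t + h *\<^sub>R x))" "norm (f p - f (t + h *\<^sub>R x))"]
      by (simp add: power2_sum)
    finally have "(norm (f p))\<^sup>2 \<le> 2 * (norm (f (t + h *\<^sub>R x)))\<^sup>2 + 2 * d" using le by linarith
    then have "ennreal ((norm (f p))\<^sup>2) \<le> ennreal (2 * (norm (f (t + h *\<^sub>R x)))\<^sup>2 + 2 * d)"
      by (rule ennreal_leI)
    also have "\<dots> = 2 * ennreal ((norm (f (t + h *\<^sub>R x)))\<^sup>2) + ennreal (2 * d)"
      by (simp add: ennreal_plus ennreal_mult d_def)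
    finally show ?thesis using True inq by (simp add: G_def)
  qed simp
  have "ennreal (measure lborel \<Omega>) * ennreal ((norm (f p))\<^sup>2) =
      (\<integral>\<^sup>+x. ennreal ((norm (f p))\<^sup>2) * indicator \<Omega> x \<partial>lborel)"
    using geo(5,7) by (subst nn_integral_cmult_indicator) (auto simp: emeasure_eq_ennreal_measure mult.commute)
  also have "\<dots> \<le> (\<integral>\<^sup>+x. 2 * G (t + h *\<^sub>R x) + ennreal (2 * d) * indicator \<Omega> x \<partial>lborel)"
    by (intro nn_integral_mono pt)
  also have "\<dots> = 2 * (\<integral>\<^sup>+x. G (t + h *\<^sub>R x) \<partial>lborel) + ennreal (2 * d) * ennreal (measure lborel \<Omega>)"
    using geo(5,7) by (subst nn_integral_add) (auto simp: nn_integral_cmult nn_integral_cmult_indicator emeasure_eq_ennreal_measure)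
  also have "(\<integral>\<^sup>+x. G (t + h *\<^sub>R x) \<partial>lborel) = ennreal (1 / h ^ DIM('a) * (L2norm \<Omega> f)\<^sup>2)"
  proof -
    have "ennreal (1 / h ^ DIM('a)) * ennreal (h ^ DIM('a)) = 1"
      using h by (subst ennreal_mult[symmetric]) auto
    then have "(\<integral>\<^sup>+x. G (t + h *\<^sub>R x) \<partial>lborel) = ennreal (1 / h ^ DIM('a)) *
        (ennreal (h ^ DIM('a)) * (\<integral>\<^sup>+x. G (t + h *\<^sub>R x) \<partial>lborel))"
      by (simp only: mult.assoc[symmetric] mult_1_left)
    also have "\<dots> = ennreal (1 / h ^ DIM('a) * (L2norm \<Omega> f)\<^sup>2)"
      unfolding scale using h by (subst ennreal_mult[symmetric]) auto
    finally show ?thesis .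
  qed
  finally have "ennreal (measure lborel \<Omega> * (norm (f p))\<^sup>2) \<le>
      ennreal 2 * ennreal (1 / h ^ DIM('a) * (L2norm \<Omega> f)\<^sup>2) + ennreal (2 * d) * ennreal (measure lborel \<Omega>)"
    by (simp add: ennreal_mult)
  also have "\<dots> = ennreal (2 * (1 / h ^ DIM('a) * (L2norm \<Omega> f)\<^sup>2) + 2 * d * measure lborel \<Omega>)"
  proof -
    have "0 \<le> d" by (simp add: d_def)
    then have "ennreal (2 * d) * ennreal (measure lborel \<Omega>) = ennreal (2 * d * measure lborel \<Omega>)"
      by (intro ennreal_mult[symmetric]) auto
    moreover have "ennreal 2 * ennreal (1 / h ^ DIM('a) * (L2norm \<Omega> f)\<^sup>2) =
        ennreal (2 * (1 / h ^ DIM('a) * (L2norm \<Omega> f)\<^sup>2))"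
      using h by (intro ennreal_mult[symmetric]) auto
    ultimately show ?thesis using h \<open>0 \<le> d\<close> by (simp add: ennreal_plus)
  qed
  finally show ?thesis
    using h by (subst (asm) ennreal_le_iff) (auto simp: d_def mult_ac)
qed

text \<open>The ratio \<open>h\<close> of the homothety is a power of \<open>\<epsilon>\<close> so high that the Lipschitz error has the order
  \<open>P\<close>; the negligible \<open>L\<^sup>2\<close> norm compensates for the factor \<open>1 / h ^ DIM('a)\<close>.\<close>

lemma growth_null:
  fixes w :: "'a::euclidean_space family"
  assumes \<Omega>: "sobolev_box \<Omega>" and w: "w \<in> null_fam \<Omega>"
  shows "growth (\<lambda>_. \<Omega>) P w"
proof -
  note geo = sobolev_box_geometry[OF \<Omega>]
  have mod: "w \<in> moderate \<Omega>" using w by (simp add: null_fam_def)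
  obtain R L where L: "net_order R L" "\<forall>\<epsilon>. 0 \<le> L \<epsilon>"
    "\<forall>\<^sub>F \<epsilon> in at_right 0. \<forall>x\<in>\<Omega>. \<forall>y\<in>\<Omega>. norm (w \<epsilon> x - w \<epsilon> y) \<le> L \<epsilon> * norm (x - y)"
    using moderate_lipschitz[OF \<Omega> mod, of "[]"] by auto
  define Q where "Q = max 0 (R - P)"
  define N where "N \<epsilon> = L2norm \<Omega> (w \<epsilon>)" for \<epsilon>
  have LQ: "net_order (Q + P) L" by (rule net_order_mono[OF L(1)]) (simp add: Q_def)
  have N: "net_order (- q) N" if "q \<ge> 0" for q
    using w that unfolding null_fam_def N_def by (intro net_order_bigo) auto
  define h where "h \<epsilon> = \<epsilon> powr Q" for \<epsilon> :: real
  have N2: "net_order (2 * P) (\<lambda>\<epsilon>. 2 / measure lborel \<Omega> * (\<epsilon> powr (- (Q * DIM('a))) * (N \<epsilon>)\<^sup>2))"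
  proof (rule net_order_cmult)
    define q where "q = max 0 (Q * DIM('a) / 2 - P)"
    have "net_order (Q * DIM('a) + 2 * (- q)) (\<lambda>\<epsilon>. \<epsilon> powr (- (Q * DIM('a))) * (N \<epsilon>)\<^sup>2)"
      using net_order_mult[OF net_order_powr[of "- (Q * DIM('a))"] net_order_power2[OF N[of q]]]
      by (simp add: q_def)
    then show "net_order (2 * P) (\<lambda>\<epsilon>. \<epsilon> powr (- (Q * DIM('a))) * (N \<epsilon>)\<^sup>2)"
    proof (rule net_order_mono)
      have "Q * DIM('a) / 2 - P \<le> q" by (simp add: q_def)
      then show "Q * DIM('a) + 2 * (- q) \<le> 2 * P" by linarith
    qed
  qed
  have hL: "net_order (2 * P) (\<lambda>\<epsilon>. 2 * (h \<epsilon> * L \<epsilon> * diameter \<Omega>)\<^sup>2)"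
  proof -
    have "net_order P (\<lambda>\<epsilon>. diameter \<Omega> * (h \<epsilon> * L \<epsilon>))"
      using net_order_mult[OF net_order_powr[of Q] LQ] unfolding h_def by (intro net_order_cmult) simp
    then show ?thesis
      using net_order_cmult[OF net_order_power2, of P _ 2] by (simp add: mult_ac)
  qed
  define M where "M \<epsilon> = sqrt (2 / measure lborel \<Omega> * (\<epsilon> powr (- (Q * DIM('a))) * (N \<epsilon>)\<^sup>2)
      + 2 * (h \<epsilon> * L \<epsilon> * diameter \<Omega>)\<^sup>2)" for \<epsilon>
  show ?thesis
  proof (rule growthI)
    show "net_order P M" unfolding M_def by (intro net_order_sqrt net_order_add N2 hL)
    show "\<forall>\<^sub>F \<epsilon> in at_right 0. \<forall>p\<in>\<Omega>. norm (w \<epsilon> p) \<le> M \<epsilon>"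
      using L(3) eventually_unit
    proof eventually_elim
      case (elim \<epsilon>)
      have H: "w \<epsilon> \<in> H_infty \<Omega>" using mod elim by (auto simp: moderate_def)
      have h1: "0 < h \<epsilon>" "h \<epsilon> \<le> 1" using elim by (auto simp: h_def Q_def intro!: powr_le1)
      have hn: "1 / h \<epsilon> ^ DIM('a) = \<epsilon> powr (- (Q * DIM('a)))"
        using elim by (simp add: h_def powr_minus_divide powr_powr flip: powr_realpow)
      have L0: "0 \<le> L \<epsilon>" using L(2) by blast
      show ?case
      proof
        fix p assume p: "p \<in> \<Omega>"
        have lip: "norm (w \<epsilon> p - w \<epsilon> q) \<le> L \<epsilon> * norm (p - q)" if "q \<in> \<Omega>" for q
          using elim(1) p that by blast
        have "measure lborel \<Omega> * (norm (w \<epsilon> p))\<^sup>2 \<le>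
            2 / h \<epsilon> ^ DIM('a) * (N \<epsilon>)\<^sup>2 + 2 * measure lborel \<Omega> * (h \<epsilon> * L \<epsilon> * diameter \<Omega>)\<^sup>2"
          unfolding N_def by (rule square_le_mean_square[OF \<Omega> H p h1 lip L0])
        also have "2 / h \<epsilon> ^ DIM('a) = 2 * \<epsilon> powr (- (Q * DIM('a)))" using hn by simp
        finally have "(norm (w \<epsilon> p))\<^sup>2 \<le> 2 / measure lborel \<Omega> * (\<epsilon> powr (- (Q * DIM('a))) * (N \<epsilon>)\<^sup>2)
            + 2 * (h \<epsilon> * L \<epsilon> * diameter \<Omega>)\<^sup>2"
          using geo(6) by (simp add: field_simps)
        then show "norm (w \<epsilon> p) \<le> M \<epsilon>" unfolding M_def by (rule real_le_rsqrt)
      qed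
    qed
  qed
qed

text \<open>Taylor's formula of first order on a segment of length \<open>h\<close> that starts at \<open>p\<close>; the sign \<open>\<sigma>\<close> selects
  the direction that stays in the domain.\<close>

lemma derivative_le_of_second_derivative:
  fixes f :: "'a::euclidean_space \<Rightarrow> complex"
  assumes "open \<Omega>" "smooth_fun_on \<Omega> f" "i \<in> Basis" "0 \<le> h" "\<bar>\<sigma>\<bar> = 1"
    and seg: "\<And>t. 0 \<le> t \<Longrightarrow> t \<le> h \<Longrightarrow> p + t *\<^sub>R (\<sigma> *\<^sub>R i) \<in> \<Omega>"
    and m0: "\<And>x. x \<in> \<Omega> \<Longrightarrow> norm (f x) \<le> m0" and m2: "\<And>x. x \<in> \<Omega> \<Longrightarrow> norm (pd i (pd i f) x) \<le> m2"
  shows "h * norm (pd i f p) \<le> 2 * m0 + h * (h * m2)"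
proof -
  let ?e = "\<sigma> *\<^sub>R i"
  have sm1: "smooth_fun_on \<Omega> (pd i f)" using assms smooth_pd by blast
  have pde: "pd ?e g x = \<sigma> *\<^sub>R pd i g x" if "smooth_fun_on \<Omega> g" "x \<in> \<Omega>" for g x
    using has_derivative_linear[OF has_derivative_pd[OF smooth_differentiable0[OF assms(1) that]]]
    by (rule linear_scale)
  have n\<sigma>: "norm (\<sigma> *\<^sub>R z) = norm z" for z :: complex using assms(5) by simp
  have d1: "((\<lambda>t. g (p + t *\<^sub>R ?e)) has_vector_derivative \<sigma> *\<^sub>R pd i g (p + t *\<^sub>R ?e)) (at t)"
    if "smooth_fun_on \<Omega> g" "0 \<le> t" "t \<le> h" for t g
    using smooth_line_derivative[OF assms(1) that(1) seg[OF that(2,3)]] pde[OF that(1) seg[OF that(2,3)]] by simp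
  have inner: "norm (pd i f (p + t *\<^sub>R ?e) - pd i f p) \<le> h * m2" if t: "0 \<le> t" "t \<le> h" for t
  proof -
    have "norm (pd i f (p + t *\<^sub>R ?e) - pd i f (p + 0 *\<^sub>R ?e)) \<le> m2 * t"
    proof (rule norm_diff_le_of_vector_derivative[OF t(1)])
      fix s assume s: "0 \<le> s" "s \<le> t"
      then show "((\<lambda>t. pd i f (p + t *\<^sub>R ?e)) has_vector_derivative \<sigma> *\<^sub>R pd i (pd i f) (p + s *\<^sub>R ?e)) (at s)"
        using d1[OF sm1] t by simp
      show "norm (\<sigma> *\<^sub>R pd i (pd i f) (p + s *\<^sub>R ?e)) \<le> m2"
        unfolding n\<sigma> using m2[OF seg] s t by simp
    qed
    also have "\<dots> \<le> m2 * h"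
      using t m2[OF seg[of 0]] assms(4) by (intro mult_left_mono) (auto intro: order_trans[OF norm_ge_zero])
    finally show ?thesis by (simp add: mult.commute)
  qed
  define \<phi> where "\<phi> t = f (p + t *\<^sub>R ?e) - t *\<^sub>R (\<sigma> *\<^sub>R pd i f p)" for t
  have "norm (\<phi> h - \<phi> 0) \<le> h * m2 * h"
  proof (rule norm_diff_le_of_vector_derivative[OF assms(4)])
    fix t assume t: "0 \<le> t" "t \<le> h"
    show "(\<phi> has_vector_derivative \<sigma> *\<^sub>R (pd i f (p + t *\<^sub>R ?e) - pd i f p)) (at t)"
      unfolding \<phi>_def using d1[OF assms(2) t]
      by (auto intro!: derivative_eq_intros simp: scaleR_diff_right)
    show "norm (\<sigma> *\<^sub>R (pd i f (p + t *\<^sub>R ?e) - pd i f p)) \<le> h * m2"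
      unfolding n\<sigma> using inner[OF t] .
  qed
  moreover have "h *\<^sub>R (\<sigma> *\<^sub>R pd i f p) = f (p + h *\<^sub>R ?e) - f p - (\<phi> h - \<phi> 0)" by (simp add: \<phi>_def)
  then have "norm (h *\<^sub>R (\<sigma> *\<^sub>R pd i f p)) \<le> norm (f (p + h *\<^sub>R ?e)) + norm (f p) + norm (\<phi> h - \<phi> 0)"
    using norm_triangle_ineq4[of "f (p + h *\<^sub>R ?e) - f p" "\<phi> h - \<phi> 0"]
      norm_triangle_ineq4[of "f (p + h *\<^sub>R ?e)" "f p"] by simp
  moreover have "norm (h *\<^sub>R (\<sigma> *\<^sub>R pd i f p)) = h * norm (pd i f p)" using assms(4,5) by (simp add: abs_mult)
  moreover have "norm (f (p + h *\<^sub>R ?e)) \<le> m0" "norm (f p) \<le> m0"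
    using m0[OF seg[of h]] m0[OF seg[of 0]] assms(4) by auto
  ultimately have "h * norm (pd i f p) \<le> m0 + m0 + h * m2 * h" by linarith
  then show ?thesis by (simp add: mult_ac)
qed

text \<open>The length of the segments is again a power of \<open>\<epsilon>\<close>: division by it is harmless for the negligible
  family \<open>w\<close>, and it makes the term with the moderate second derivative small.\<close>

lemma growth_pd_null:
  fixes w :: "'a::euclidean_space family"
  assumes \<Omega>: "sobolev_box \<Omega>" and sm: "\<And>\<epsilon>. 0 < \<epsilon> \<Longrightarrow> \<epsilon> \<le> 1 \<Longrightarrow> smooth_fun_on \<Omega> (w \<epsilon>)"
    and i: "i \<in> Basis" and w0: "\<And>P. growth (\<lambda>_. \<Omega>) P w"
    and w2: "growth (\<lambda>_. \<Omega>) R (\<lambda>\<epsilon>. pd i (pd i (w \<epsilon>)))"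
  shows "growth (\<lambda>_. \<Omega>) P (\<lambda>\<epsilon>. pd i (w \<epsilon>))"
proof -
  obtain l u where b: "\<Omega> = box l u" and ne: "\<Omega> \<noteq> {}" using \<Omega> by (auto simp: sobolev_box_def)
  define s where "s = u \<bullet> i - l \<bullet> i"
  have s: "s > 0" using ne i by (auto simp: b box_eq_empty s_def not_le)
  define Q where "Q = max 0 (R - P)"
  define h where "h \<epsilon> = s / 4 * \<epsilon> powr Q" for \<epsilon> :: real
  obtain m0 where m0: "net_order (P - Q) m0" "\<forall>\<epsilon>. 0 \<le> m0 \<epsilon>" "\<forall>\<^sub>F \<epsilon> in at_right 0. \<forall>p\<in>\<Omega>. norm (w \<epsilon> p) \<le> m0 \<epsilon>"
    using w0 by (rule growthE)
  obtain m2 where m2: "net_order R m2" "\<forall>\<epsilon>. 0 \<le> m2 \<epsilon>" "\<forall>\<^sub>F \<epsilon> in at_right 0. \<forall>p\<in>\<Omega>. norm (pd i (pd i (w \<epsilon>)) p) \<le> m2 \<epsilon>"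
    using w2 by (rule growthE)
  show ?thesis
  proof (rule growthI)
    show "net_order P (\<lambda>\<epsilon>. 8 / s * (\<epsilon> powr (- Q) * m0 \<epsilon>) + s / 4 * (\<epsilon> powr Q * m2 \<epsilon>))"
    proof (intro net_order_add net_order_cmult)
      show "net_order P (\<lambda>\<epsilon>. \<epsilon> powr (- Q) * m0 \<epsilon>)"
        using net_order_mult[OF net_order_powr[of "- Q"] m0(1)] by simp
      show "net_order P (\<lambda>\<epsilon>. \<epsilon> powr Q * m2 \<epsilon>)"
        using net_order_mono[OF net_order_mult[OF net_order_powr[of Q] m2(1)], of P] by (simp add: Q_def)
    qed
    show "\<forall>\<^sub>F \<epsilon> in at_right 0. \<forall>p\<in>\<Omega>. norm (pd i (w \<epsilon>) p) \<le>
        8 / s * (\<epsilon> powr (- Q) * m0 \<epsilon>) + s / 4 * (\<epsilon> powr Q * m2 \<epsilon>)"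
      using m0(3) m2(3) eventually_unit
    proof eventually_elim
      case (elim \<epsilon>)
      have "\<epsilon> powr Q \<le> 1" using elim by (auto simp: Q_def intro!: powr_le1)
      then have h: "0 < h \<epsilon>" "h \<epsilon> \<le> s / 4" using s elim by (auto simp: h_def)
      show ?case
      proof
        fix p assume p: "p \<in> \<Omega>"
        \<comment> \<open>In the direction of the farther face there is room for half of the edge length \<open>s\<close>.\<close>
        define \<sigma> :: real where "\<sigma> = (if p \<bullet> i \<le> (l \<bullet> i + u \<bullet> i) / 2 then 1 else - 1)"
        have seg: "p + t *\<^sub>R (\<sigma> *\<^sub>R i) \<in> \<Omega>" if t: "0 \<le> t" "t \<le> h \<epsilon>" for t
          unfolding b mem_box
        proof
          fix j :: 'a assume j: "j \<in> Basis"
          have pj: "l \<bullet> j < p \<bullet> j" "p \<bullet> j < u \<bullet> j" using p j by (auto simp: b mem_box)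
          show "l \<bullet> j < (p + t *\<^sub>R (\<sigma> *\<^sub>R i)) \<bullet> j \<and> (p + t *\<^sub>R (\<sigma> *\<^sub>R i)) \<bullet> j < u \<bullet> j"
          proof (cases "j = i")
            case True
            have e: "(p + t *\<^sub>R (\<sigma> *\<^sub>R i)) \<bullet> j = p \<bullet> i + t * \<sigma>"
              using i by (simp add: True inner_simps inner_Basis)
            show ?thesis unfolding e using pj t h s unfolding True \<sigma>_def s_def by (auto simp: field_simps)
          next
            case False
            then show ?thesis using pj i j by (simp add: inner_simps inner_Basis)
          qed
        qed
        have "h \<epsilon> * norm (pd i (w \<epsilon>) p) \<le> 2 * m0 \<epsilon> + h \<epsilon> * (h \<epsilon> * m2 \<epsilon>)"
          using elim h sobolev_box_geometry(1)[OF \<Omega>]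
          by (intro derivative_le_of_second_derivative[OF _ sm i _ _ seg]) (auto simp: \<sigma>_def)
        then have "norm (pd i (w \<epsilon>) p) \<le> 2 * m0 \<epsilon> / h \<epsilon> + h \<epsilon> * m2 \<epsilon>"
          using h by (simp add: field_simps)
        also have "2 * m0 \<epsilon> / h \<epsilon> = 8 / s * (\<epsilon> powr (- Q) * m0 \<epsilon>)"
          using s elim by (simp add: h_def powr_minus field_simps)
        finally show "norm (pd i (w \<epsilon>) p) \<le> 8 / s * (\<epsilon> powr (- Q) * m0 \<epsilon>) + s / 4 * (\<epsilon> powr Q * m2 \<epsilon>)"
          by (simp add: h_def)
      qed
    qed
  qed
qed

lemma growth_multi_pd_null:
  fixes w :: "'a::euclidean_space family"
  assumes \<Omega>: "sobolev_box \<Omega>" and w: "w \<in> null_fam \<Omega>" and \<alpha>: "\<alpha> \<in> lists Basis"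
  shows "growth (\<lambda>_. \<Omega>) P (\<lambda>\<epsilon>. multi_pd \<alpha> (w \<epsilon>))"
proof -
  have mod: "w \<in> moderate \<Omega>" using w by (simp add: null_fam_def)
  have "\<forall>P. growth (\<lambda>_. \<Omega>) P (\<lambda>\<epsilon>. multi_pd \<alpha> (w \<epsilon>))"
    using \<alpha>
  proof (induction \<alpha>)
    case Nil
    then show ?case using growth_null[OF \<Omega> w] by simp
  next
    case (Cons i \<alpha>)
    have L: "i \<in> Basis" "\<alpha> \<in> lists Basis" "i # i # \<alpha> \<in> lists Basis" using Cons by auto
    obtain R where R: "growth (\<lambda>_. \<Omega>) R (\<lambda>\<epsilon>. pd i (pd i (multi_pd \<alpha> (w \<epsilon>))))"
      using moderateD(3)[OF \<Omega> mod L(3)] by auto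
    have IH: "growth (\<lambda>_. \<Omega>) P (\<lambda>\<epsilon>. multi_pd \<alpha> (w \<epsilon>))" for P using Cons.IH by simp
    have sm: "smooth_fun_on \<Omega> (multi_pd \<alpha> (w \<epsilon>))" if "0 < \<epsilon>" "\<epsilon> \<le> 1" for \<epsilon>
      using smooth_multi_pd[OF moderateD(2)[OF \<Omega> mod that] L(2)] .
    show ?case
      unfolding multi_pd_Cons using growth_pd_null[OF \<Omega> sm L(1) IH R] by blast
  qed
  then show ?thesis ..
qed

section \<open>Operations on moderate families and on their classes\<close>

lemma bounded_smooth_smooth: "bounded_smooth \<Omega> f \<Longrightarrow> smooth_fun_on \<Omega> f"
  by (simp add: bounded_smooth_def)

lemma bounded_smooth_bound:
  assumes "bounded_smooth \<Omega> f" "\<alpha> \<in> lists Basis"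
  obtains M where "0 \<le> M" "\<And>x. x \<in> \<Omega> \<Longrightarrow> norm (multi_pd \<alpha> f x) \<le> M"
proof -
  obtain M where "\<forall>x\<in>\<Omega>. norm (multi_pd \<alpha> f x) \<le> M"
    using assms unfolding bounded_smooth_def by blast
  then show thesis by (intro that[of "\<bar>M\<bar>"]) force+
qed

lemma bounded_smooth_multi_pd:
  assumes "bounded_smooth \<Omega> f" "\<beta> \<in> lists Basis"
  shows "bounded_smooth \<Omega> (multi_pd \<beta> f)"
  unfolding bounded_smooth_def
proof (intro conjI ballI)
  show "smooth_fun_on \<Omega> (multi_pd \<beta> f)"
    using assms by (intro smooth_multi_pd bounded_smooth_smooth)
  fix \<alpha> assume "\<alpha> \<in> lists (Basis :: 'a set)"
  then have "\<alpha> @ \<beta> \<in> lists Basis" using assms by simp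
  then show "\<exists>M. \<forall>x\<in>\<Omega>. norm (multi_pd \<alpha> (multi_pd \<beta> f) x) \<le> M"
    using assms(1) unfolding bounded_smooth_def multi_pd_append[symmetric] by blast
qed

lemma bounded_smooth_pd: "bounded_smooth \<Omega> f \<Longrightarrow> i \<in> Basis \<Longrightarrow> bounded_smooth \<Omega> (pd i f)"
  using bounded_smooth_multi_pd[of \<Omega> f "[i]"] by simp

lemma bounded_smooth_const: "bounded_smooth \<Omega> (\<lambda>x. k)"
  unfolding bounded_smooth_def multi_pd_const by (auto simp: smooth_const)

lemma bounded_smooth_add:
  assumes \<Omega>: "open \<Omega>" and f: "bounded_smooth \<Omega> f" and g: "bounded_smooth \<Omega> g"
  shows "bounded_smooth \<Omega> (\<lambda>x. f x + g x)"
  unfolding bounded_smooth_def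
proof (intro conjI ballI)
  note sm = bounded_smooth_smooth[OF f] bounded_smooth_smooth[OF g]
  show "smooth_fun_on \<Omega> (\<lambda>x. f x + g x)" by (rule smooth_add[OF \<Omega> sm])
  fix \<alpha> assume \<alpha>: "\<alpha> \<in> lists (Basis :: 'a set)"
  obtain M where M: "\<And>x. x \<in> \<Omega> \<Longrightarrow> norm (multi_pd \<alpha> f x) \<le> M" using bounded_smooth_bound[OF f \<alpha>] by blast
  obtain N where N: "\<And>x. x \<in> \<Omega> \<Longrightarrow> norm (multi_pd \<alpha> g x) \<le> N" using bounded_smooth_bound[OF g \<alpha>] by blast
  show "\<exists>M. \<forall>x\<in>\<Omega>. norm (multi_pd \<alpha> (\<lambda>x. f x + g x) x) \<le> M"
    using multi_pd_add[OF \<Omega> sm \<alpha>] M N by (intro exI[of _ "M + N"]) (simp add: norm_triangle_mono)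
qed

lemma bounded_sum_list:
  assumes "\<And>p. p \<in> set L \<Longrightarrow> \<exists>M. \<forall>x\<in>\<Omega>. norm (f p x) \<le> M"
  shows "\<exists>M. \<forall>x\<in>\<Omega>. norm (\<Sum>p\<leftarrow>L. f p x :: complex) \<le> M"
  using assms
proof (induction L)
  case (Cons p L)
  obtain M where M: "\<forall>x\<in>\<Omega>. norm (\<Sum>p\<leftarrow>L. f p x) \<le> M" using Cons by auto
  obtain N where N: "\<forall>x\<in>\<Omega>. norm (f p x) \<le> N" using Cons.prems[of p] by auto
  show ?case using M N by (intro exI[of _ "N + M"]) (simp add: norm_triangle_mono)
qed auto

lemma bounded_smooth_mult:
  assumes \<Omega>: "open \<Omega>" and f: "bounded_smooth \<Omega> f" and g: "bounded_smooth \<Omega> g"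
  shows "bounded_smooth \<Omega> (\<lambda>x. f x * g x)"
  unfolding bounded_smooth_def
proof (intro conjI ballI)
  note sm = bounded_smooth_smooth[OF f] bounded_smooth_smooth[OF g]
  show "smooth_fun_on \<Omega> (\<lambda>x. f x * g x)" by (rule smooth_mult[OF \<Omega> sm])
  fix \<alpha> assume \<alpha>: "\<alpha> \<in> lists (Basis :: 'a set)"
  have "\<exists>M. \<forall>x\<in>\<Omega>. norm (\<Sum>p\<leftarrow>splits \<alpha>. (case p of (\<beta>, \<gamma>) \<Rightarrow> multi_pd \<beta> f x * multi_pd \<gamma> g x)) \<le> M"
  proof (rule bounded_sum_list)
    fix p assume p: "p \<in> set (splits \<alpha>)"
    obtain \<beta> \<gamma> where [simp]: "p = (\<beta>, \<gamma>)" by (cases p)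
    have \<beta>\<gamma>: "\<beta> \<in> lists Basis" "\<gamma> \<in> lists Basis" using splits_lists[of \<beta> \<gamma> \<alpha>] p \<alpha> by auto
    obtain M where M: "0 \<le> M" "\<And>x. x \<in> \<Omega> \<Longrightarrow> norm (multi_pd \<beta> f x) \<le> M" using bounded_smooth_bound[OF f \<beta>\<gamma>(1)] by blast
    obtain N where N: "\<And>x. x \<in> \<Omega> \<Longrightarrow> norm (multi_pd \<gamma> g x) \<le> N" using bounded_smooth_bound[OF g \<beta>\<gamma>(2)] by blast
    show "\<exists>M. \<forall>x\<in>\<Omega>. norm (case p of (\<beta>, \<gamma>) \<Rightarrow> multi_pd \<beta> f x * multi_pd \<gamma> g x) \<le> M"
      using M N by (intro exI[of _ "M * N"]) (auto simp: norm_mult intro!: mult_mono)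
  qed
  then show "\<exists>M. \<forall>x\<in>\<Omega>. norm (multi_pd \<alpha> (\<lambda>x. f x * g x) x) \<le> M"
    using multi_pd_mult[OF \<Omega> sm \<alpha>] by simp
qed

text \<open>In a product every multi-index is distributed over the factors.  The condition \<open>D\<close> singles out the
  multi-indices that matter, for instance those of bounded order in one of the variables.\<close>

lemma growth_multi_pd_mult:
  assumes \<Omega>: "open \<Omega>"
    and f: "\<And>\<epsilon>. 0 < \<epsilon> \<Longrightarrow> \<epsilon> \<le> 1 \<Longrightarrow> smooth_fun_on \<Omega> (f \<epsilon>)" and g: "\<And>\<epsilon>. 0 < \<epsilon> \<Longrightarrow> \<epsilon> \<le> 1 \<Longrightarrow> smooth_fun_on \<Omega> (g \<epsilon>)"
    and S: "\<And>\<epsilon>. 0 < \<epsilon> \<Longrightarrow> \<epsilon> \<le> 1 \<Longrightarrow> S \<epsilon> \<subseteq> \<Omega>"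
    and gf: "\<And>\<alpha>. \<alpha> \<in> lists Basis \<Longrightarrow> D \<alpha> \<Longrightarrow> growth S P (\<lambda>\<epsilon>. multi_pd \<alpha> (f \<epsilon>))"
    and gg: "\<And>\<alpha>. \<alpha> \<in> lists Basis \<Longrightarrow> D \<alpha> \<Longrightarrow> growth S Q (\<lambda>\<epsilon>. multi_pd \<alpha> (g \<epsilon>))"
    and D: "\<And>\<alpha> \<beta>. D \<alpha> \<Longrightarrow> mset \<beta> \<subseteq># mset \<alpha> \<Longrightarrow> D \<beta>"
    and \<alpha>: "\<alpha> \<in> lists Basis" "D \<alpha>"
  shows "growth S (P + Q) (\<lambda>\<epsilon>. multi_pd \<alpha> (\<lambda>x. f \<epsilon> x * g \<epsilon> x))"
proof (rule growth_cong)
  show "growth S (P + Q) (\<lambda>\<epsilon> x. \<Sum>p\<leftarrow>splits \<alpha>. (case p of (\<beta>, \<gamma>) \<Rightarrow> \<lambda>\<epsilon> x. multi_pd \<beta> (f \<epsilon>) x * multi_pd \<gamma> (g \<epsilon>) x) \<epsilon> x)"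
  proof (rule growth_sum_list)
    fix p assume p: "p \<in> set (splits \<alpha>)"
    obtain \<beta> \<gamma> where [simp]: "p = (\<beta>, \<gamma>)" by (cases p)
    have \<beta>\<gamma>: "\<beta> \<in> lists Basis" "\<gamma> \<in> lists Basis" using splits_lists[of \<beta> \<gamma> \<alpha>] p \<alpha> by auto
    have "mset \<beta> + mset \<gamma> = mset \<alpha>" using splits_mset p by simp
    then have "mset \<beta> \<subseteq># mset \<alpha>" "mset \<gamma> \<subseteq># mset \<alpha>"
      by (metis mset_subset_eq_add_left, metis mset_subset_eq_add_right)
    then have "D \<beta>" "D \<gamma>" using D \<alpha> by auto
    then show "growth S (P + Q) (case p of (\<beta>, \<gamma>) \<Rightarrow> \<lambda>\<epsilon> x. multi_pd \<beta> (f \<epsilon>) x * multi_pd \<gamma> (g \<epsilon>) x)"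
      using growth_mult[OF gf[OF \<beta>\<gamma>(1)] gg[OF \<beta>\<gamma>(2)]] by simp
  qed
  fix \<epsilon> p assume \<epsilon>: "0 < \<epsilon>" "\<epsilon> \<le> 1" and p: "p \<in> S \<epsilon>"
  show "multi_pd \<alpha> (\<lambda>x. f \<epsilon> x * g \<epsilon> x) p =
      (\<Sum>q\<leftarrow>splits \<alpha>. (case q of (\<beta>, \<gamma>) \<Rightarrow> \<lambda>\<epsilon> x. multi_pd \<beta> (f \<epsilon>) x * multi_pd \<gamma> (g \<epsilon>) x) \<epsilon> p)"
    using multi_pd_mult[OF \<Omega> f[OF \<epsilon>] g[OF \<epsilon>] \<alpha>(1)] S[OF \<epsilon>] p
    by (auto simp: case_prod_beta' intro!: arg_cong[where f=sum_list])
qed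

lemma moderate_mult:
  assumes \<Omega>: "sobolev_box \<Omega>" and u: "u \<in> moderate \<Omega>" and v: "v \<in> moderate \<Omega>"
  shows "(\<lambda>\<epsilon> x. u \<epsilon> x * v \<epsilon> x) \<in> moderate \<Omega>"
  unfolding moderate_iff[OF \<Omega>]
proof (intro conjI ballI)
  note o = sobolev_box_geometry(1)[OF \<Omega>]
  show "bounded_smooth \<Omega> (\<lambda>x. u \<epsilon> x * v \<epsilon> x)" if "\<epsilon> \<in> {0<..1}" for \<epsilon>
    using that moderateD(1)[OF \<Omega> u] moderateD(1)[OF \<Omega> v] by (intro bounded_smooth_mult[OF o]) auto
  fix \<alpha> assume \<alpha>: "\<alpha> \<in> lists (Basis :: 'a set)"
  define B where "B = {\<beta>. mset \<beta> \<subseteq># mset \<alpha> }"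
  have sub: "set \<beta> \<subseteq> set \<alpha>" if "mset \<beta> \<subseteq># mset \<alpha>" for \<beta> using set_mset_mono[OF that] by simp
  have "B \<subseteq> {\<beta>. set \<beta> \<subseteq> set \<alpha> \<and> length \<beta> \<le> length \<alpha>}"
    unfolding B_def using sub by (auto dest: size_mset_mono)
  then have fin: "finite B" using finite_lists_length_le[of "set \<alpha>" "length \<alpha>"] by (rule finite_subset) simp
  have BL: "\<beta> \<in> lists Basis" if "\<beta> \<in> B" for \<beta>
    using that \<alpha> sub by (auto simp: B_def in_lists_conv_set)
  have ex: "\<exists>R. \<forall>\<beta>\<in>B. growth (\<lambda>_. \<Omega>) R (\<lambda>\<epsilon>. multi_pd \<beta> (w \<epsilon>))" if "w \<in> moderate \<Omega>" for w
  proof -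
    have "\<forall>\<beta>\<in>B. \<exists>R. growth (\<lambda>_. \<Omega>) R (\<lambda>\<epsilon>. multi_pd \<beta> (w \<epsilon>))"
      using moderateD(3)[OF \<Omega> that] BL by blast
    then obtain R where R: "\<forall>\<beta>\<in>B. growth (\<lambda>_. \<Omega>) (R \<beta>) (\<lambda>\<epsilon>. multi_pd \<beta> (w \<epsilon>))" by (rule bchoice[THEN exE])
    have "growth (\<lambda>_. \<Omega>) (Max (R ` B)) (\<lambda>\<epsilon>. multi_pd \<beta> (w \<epsilon>))" if "\<beta> \<in> B" for \<beta>
      using R that fin by (intro growth_mono[OF R[rule_format, OF that]]) auto
    then show ?thesis by blast
  qed
  obtain P where P: "\<forall>\<beta>\<in>B. growth (\<lambda>_. \<Omega>) P (\<lambda>\<epsilon>. multi_pd \<beta> (u \<epsilon>))" using ex[OF u] by blast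
  obtain Q where Q: "\<forall>\<beta>\<in>B. growth (\<lambda>_. \<Omega>) Q (\<lambda>\<epsilon>. multi_pd \<beta> (v \<epsilon>))" using ex[OF v] by blast
  have "growth (\<lambda>_. \<Omega>) (P + Q) (\<lambda>\<epsilon>. multi_pd \<alpha> (\<lambda>x. u \<epsilon> x * v \<epsilon> x))"
    by (rule growth_multi_pd_mult[OF o, where D="\<lambda>\<beta>. \<beta> \<in> B"])
      (use P Q \<alpha> moderateD(2)[OF \<Omega> u] moderateD(2)[OF \<Omega> v] in \<open>auto simp: B_def intro: subset_mset.order_trans\<close>)
  then show "\<exists>P. growth (\<lambda>_. \<Omega>) P (\<lambda>\<epsilon>. multi_pd \<alpha> (\<lambda>x. u \<epsilon> x * v \<epsilon> x))" ..
qed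

lemma moderate_add:
  assumes \<Omega>: "sobolev_box \<Omega>" and u: "u \<in> moderate \<Omega>" and v: "v \<in> moderate \<Omega>"
  shows "(\<lambda>\<epsilon> x. u \<epsilon> x + v \<epsilon> x) \<in> moderate \<Omega>"
  unfolding moderate_iff[OF \<Omega>]
proof (intro conjI ballI)
  note o = sobolev_box_geometry(1)[OF \<Omega>]
  show "bounded_smooth \<Omega> (\<lambda>x. u \<epsilon> x + v \<epsilon> x)" if "\<epsilon> \<in> {0<..1}" for \<epsilon>
    using that moderateD(1)[OF \<Omega> u] moderateD(1)[OF \<Omega> v] by (intro bounded_smooth_add[OF o]) auto
  fix \<alpha> assume \<alpha>: "\<alpha> \<in> lists (Basis :: 'a set)"
  obtain P where P: "growth (\<lambda>_. \<Omega>) P (\<lambda>\<epsilon>. multi_pd \<alpha> (u \<epsilon>))" using moderateD(3)[OF \<Omega> u \<alpha>] by blast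
  obtain Q where Q: "growth (\<lambda>_. \<Omega>) Q (\<lambda>\<epsilon>. multi_pd \<alpha> (v \<epsilon>))" using moderateD(3)[OF \<Omega> v \<alpha>] by blast
  have "growth (\<lambda>_. \<Omega>) (max P Q) (\<lambda>\<epsilon> p. multi_pd \<alpha> (u \<epsilon>) p + multi_pd \<alpha> (v \<epsilon>) p)"
    by (intro growth_add growth_mono[OF P] growth_mono[OF Q]) auto
  then have "growth (\<lambda>_. \<Omega>) (max P Q) (\<lambda>\<epsilon>. multi_pd \<alpha> (\<lambda>x. u \<epsilon> x + v \<epsilon> x))"
    by (rule growth_cong) (intro multi_pd_add[OF o] moderateD(2)[OF \<Omega> u] moderateD(2)[OF \<Omega> v] \<alpha>)
  then show "\<exists>P. growth (\<lambda>_. \<Omega>) P (\<lambda>\<epsilon>. multi_pd \<alpha> (\<lambda>x. u \<epsilon> x + v \<epsilon> x))" ..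
qed

lemma moderate_pd:
  assumes \<Omega>: "sobolev_box \<Omega>" and u: "u \<in> moderate \<Omega>" and i: "i \<in> Basis"
  shows "(\<lambda>\<epsilon>. pd i (u \<epsilon>)) \<in> moderate \<Omega>"
  unfolding moderate_iff[OF \<Omega>]
proof (intro conjI ballI)
  show "bounded_smooth \<Omega> (pd i (u \<epsilon>))" if "\<epsilon> \<in> {0<..1}" for \<epsilon>
    using that moderateD(1)[OF \<Omega> u] i by (intro bounded_smooth_pd) auto
  fix \<alpha> assume "\<alpha> \<in> lists (Basis :: 'a set)"
  then show "\<exists>P. growth (\<lambda>_. \<Omega>) P (\<lambda>\<epsilon>. multi_pd \<alpha> (pd i (u \<epsilon>)))"
    using moderateD(3)[OF \<Omega> u, of "\<alpha> @ [i]"] i by (simp add: multi_pd_append)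
qed

lemma moderate_zero:
  assumes \<Omega>: "sobolev_box \<Omega>"
  shows "(\<lambda>\<epsilon> x. 0) \<in> moderate \<Omega>"
  unfolding moderate_iff[OF \<Omega>] multi_pd_const
  by (auto simp: bounded_smooth_const growth_zero)

lemma zero_in_null_fam: "sobolev_box \<Omega> \<Longrightarrow> (\<lambda>\<epsilon> x. 0) \<in> null_fam \<Omega>"
  by (simp add: null_fam_def moderate_zero L2norm_def)

lemma in_gclass_self: "sobolev_box \<Omega> \<Longrightarrow> u \<in> moderate \<Omega> \<Longrightarrow> u \<in> gclass \<Omega> u"
  by (simp add: gclass_def null_rel_def zero_in_null_fam)

text \<open>The union that defines a lifted operation contains the image of every representative for which this
  image is moderate.  Hence all estimates can be made for one fixed representative.\<close>

lemma glift_memI: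
  "sobolev_box \<Omega>' \<Longrightarrow> u \<in> U \<Longrightarrow> (\<lambda>\<epsilon>. F (u \<epsilon>)) \<in> moderate \<Omega>' \<Longrightarrow> (\<lambda>\<epsilon>. F (u \<epsilon>)) \<in> glift \<Omega>' F U"
  unfolding glift_def using in_gclass_self by blast

lemma gpd_memI:
  "sobolev_box \<Omega> \<Longrightarrow> u \<in> U \<Longrightarrow> u \<in> moderate \<Omega> \<Longrightarrow> i \<in> Basis \<Longrightarrow> (\<lambda>\<epsilon>. pd i (u \<epsilon>)) \<in> gpd \<Omega> i U"
  unfolding gpd_def by (intro glift_memI moderate_pd)

lemma gadd_memI:
  assumes "sobolev_box \<Omega>" "u \<in> U" "v \<in> V" "u \<in> moderate \<Omega>" "v \<in> moderate \<Omega>"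
  shows "(\<lambda>\<epsilon> x. u \<epsilon> x + v \<epsilon> x) \<in> gadd \<Omega> U V"
  unfolding gadd_def glift2_def using in_gclass_self[OF assms(1) moderate_add[OF assms(1,4,5)]] assms(2,3) by blast

lemma gmult_memI:
  assumes "sobolev_box \<Omega>" "u \<in> U" "v \<in> V" "u \<in> moderate \<Omega>" "v \<in> moderate \<Omega>"
  shows "(\<lambda>\<epsilon> x. u \<epsilon> x * v \<epsilon> x) \<in> gmult \<Omega> U V"
  unfolding gmult_def glift2_def using in_gclass_self[OF assms(1) moderate_mult[OF assms(1,4,5)]] assms(2,3) by blast

lemma colombeau_memD:
  assumes "U \<in> colombeau \<Omega>"
  obtains w where "w \<in> moderate \<Omega>" "U = gclass \<Omega> w"
  using assms unfolding colombeau_def gclass_def by (auto elim: quotientE)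

lemma gclassD:
  assumes \<Omega>: "sobolev_box \<Omega>" and u: "u \<in> gclass \<Omega> w"
  shows "u \<in> moderate \<Omega>" "w \<in> moderate \<Omega>"
    "\<alpha> \<in> lists Basis \<Longrightarrow> growth (\<lambda>_. \<Omega>) P (\<lambda>\<epsilon> x. multi_pd \<alpha> (w \<epsilon>) x - multi_pd \<alpha> (u \<epsilon>) x)"
proof -
  have *: "u \<in> moderate \<Omega>" "w \<in> moderate \<Omega>" "(\<lambda>\<epsilon> x. w \<epsilon> x - u \<epsilon> x) \<in> null_fam \<Omega>"
    using u by (auto simp: gclass_def null_rel_def)
  show "u \<in> moderate \<Omega>" "w \<in> moderate \<Omega>" using * by auto
  assume \<alpha>: "\<alpha> \<in> lists Basis"
  have "growth (\<lambda>_. \<Omega>) P (\<lambda>\<epsilon>. multi_pd \<alpha> (\<lambda>x. w \<epsilon> x - u \<epsilon> x))"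
    by (rule growth_multi_pd_null[OF \<Omega> *(3) \<alpha>])
  then show "growth (\<lambda>_. \<Omega>) P (\<lambda>\<epsilon> x. multi_pd \<alpha> (w \<epsilon>) x - multi_pd \<alpha> (u \<epsilon>) x)"
  proof (rule growth_cong)
    fix \<epsilon> :: real and p assume \<epsilon>: "0 < \<epsilon>" "\<epsilon> \<le> 1" and p: "p \<in> \<Omega>"
    show "multi_pd \<alpha> (w \<epsilon>) p - multi_pd \<alpha> (u \<epsilon>) p = multi_pd \<alpha> (\<lambda>x. w \<epsilon> x - u \<epsilon> x) p"
      using multi_pd_diff[OF sobolev_box_geometry(1)[OF \<Omega>] moderateD(2)[OF \<Omega> *(2) \<epsilon>] moderateD(2)[OF \<Omega> *(1) \<epsilon>] \<alpha> p]
      by simp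
  qed
qed

lemma colombeau_moderate: "sobolev_box \<Omega> \<Longrightarrow> U \<in> colombeau \<Omega> \<Longrightarrow> u \<in> U \<Longrightarrow> u \<in> moderate \<Omega>"
  by (metis colombeau_memD gclassD(1))

text \<open>Representatives differ by null families, all of whose derivatives are negligible.\<close>

lemma colombeau_growth_transfer:
  assumes \<Omega>: "sobolev_box \<Omega>" and U: "U \<in> colombeau \<Omega>" and u: "u \<in> U" and v: "v \<in> U"
    and \<alpha>: "\<alpha> \<in> lists Basis" and g: "growth (\<lambda>_. \<Omega>) P (\<lambda>\<epsilon>. multi_pd \<alpha> (u \<epsilon>))"
  shows "growth (\<lambda>_. \<Omega>) P (\<lambda>\<epsilon>. multi_pd \<alpha> (v \<epsilon>))"
proof -
  obtain w where w: "U = gclass \<Omega> w" using U by (rule colombeau_memD)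
  have "growth (\<lambda>_. \<Omega>) P (\<lambda>\<epsilon> x. multi_pd \<alpha> (u \<epsilon>) x + (multi_pd \<alpha> (w \<epsilon>) x - multi_pd \<alpha> (u \<epsilon>) x))"
    using gclassD(3)[OF \<Omega> u[unfolded w] \<alpha>] by (intro growth_add g)
  then have "growth (\<lambda>_. \<Omega>) P (\<lambda>\<epsilon> x. (multi_pd \<alpha> (u \<epsilon>) x + (multi_pd \<alpha> (w \<epsilon>) x - multi_pd \<alpha> (u \<epsilon>) x))
      - (multi_pd \<alpha> (w \<epsilon>) x - multi_pd \<alpha> (v \<epsilon>) x))"
    using gclassD(3)[OF \<Omega> v[unfolded w] \<alpha>] by (rule growth_diff)
  then show ?thesis by simp
qed

lemma regular_growth:
  assumes \<Omega>: "sobolev_box \<Omega>" and U: "U \<in> regular \<Omega>"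
  obtains P where "0 \<le> P" "\<And>u \<alpha>. u \<in> U \<Longrightarrow> \<alpha> \<in> lists Basis \<Longrightarrow> growth (\<lambda>_. \<Omega>) P (\<lambda>\<epsilon>. multi_pd \<alpha> (u \<epsilon>))"
proof -
  obtain u P where u: "u \<in> U" "0 \<le> P" and b: "\<And>\<alpha>. \<alpha> \<in> lists Basis \<Longrightarrow>
      (\<lambda>\<epsilon>. L2norm \<Omega> (multi_pd \<alpha> (u \<epsilon>))) \<in> O[at_right 0](\<lambda>\<epsilon>. \<epsilon> powr (- P))"
    using U unfolding regular_def by blast
  have UC: "U \<in> colombeau \<Omega>" using U by (simp add: regular_def)
  have "u \<in> moderate \<Omega>" by (rule colombeau_moderate[OF \<Omega> UC u(1)])
  then have H: "\<And>\<epsilon>. 0 < \<epsilon> \<Longrightarrow> \<epsilon> \<le> 1 \<Longrightarrow> u \<epsilon> \<in> H_infty \<Omega>" by (auto simp: moderate_def)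
  show thesis
  proof (rule that[OF u(2)])
    fix v \<alpha> assume v: "v \<in> U" and \<alpha>: "\<alpha> \<in> lists (Basis :: 'a set)"
    have "growth (\<lambda>_. \<Omega>) P (\<lambda>\<epsilon>. multi_pd \<alpha> (u \<epsilon>))"
    proof (rule growth_of_L2norm_uniform[OF \<Omega> _ _ \<alpha>])
      show "u \<epsilon> \<in> H_infty \<Omega>" if "0 < \<epsilon>" "\<epsilon> \<le> 1" for \<epsilon> by (rule H[OF that])
      show "net_order P (\<lambda>\<epsilon>. L2norm \<Omega> (multi_pd \<beta> (u \<epsilon>)))" if "\<beta> \<in> lists Basis" for \<beta>
        by (rule net_order_bigo[OF b[OF that]])
    qed
    then show "growth (\<lambda>_. \<Omega>) P (\<lambda>\<epsilon>. multi_pd \<alpha> (v \<epsilon>))"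
      by (rule colombeau_growth_transfer[OF \<Omega> UC u(1) v \<alpha>])
  qed
qed

lemma slow_scale_derivs_growth:
  assumes \<Omega>: "sobolev_box \<Omega>" and U: "U \<in> colombeau \<Omega>" and s: "slow_scale_derivs \<Omega> U"
    and v: "v \<in> U" and \<alpha>: "\<alpha> \<in> lists Basis"
  shows "growth (\<lambda>_. \<Omega>) 0 (\<lambda>\<epsilon>. multi_pd \<alpha> (v \<epsilon>))"
proof -
  obtain u where u: "u \<in> U" and b: "\<And>\<alpha>. \<alpha> \<in> lists Basis \<Longrightarrow> slow_scale (\<lambda>\<epsilon>. L2norm \<Omega> (multi_pd \<alpha> (u \<epsilon>)))"
    using s unfolding slow_scale_derivs_def by blast
  have "u \<in> moderate \<Omega>" by (rule colombeau_moderate[OF \<Omega> U u(1)])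
  then have H: "\<And>\<epsilon>. 0 < \<epsilon> \<Longrightarrow> \<epsilon> \<le> 1 \<Longrightarrow> u \<epsilon> \<in> H_infty \<Omega>" by (auto simp: moderate_def)
  have "net_order 0 (\<lambda>\<epsilon>. L2norm \<Omega> (multi_pd \<beta> (u \<epsilon>)))" if "\<beta> \<in> lists Basis" for \<beta>
    using net_order_slow_scale[OF b[OF that]] by (simp add: net_order_abs)
  then have "growth (\<lambda>_. \<Omega>) 0 (\<lambda>\<epsilon>. multi_pd \<alpha> (u \<epsilon>))"
    by (intro growth_of_L2norm_uniform[where u=u, OF \<Omega> _ _ \<alpha>] H)
  then show ?thesis by (rule colombeau_growth_transfer[OF \<Omega> U u v \<alpha>])
qed

lemma regularI:
  assumes \<Omega>: "sobolev_box \<Omega>" and U: "U \<in> colombeau \<Omega>" "u \<in> U" and P: "0 \<le> P"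
    and g: "\<And>\<alpha>. \<alpha> \<in> lists Basis \<Longrightarrow> growth (\<lambda>_. \<Omega>) P (\<lambda>\<epsilon>. multi_pd \<alpha> (u \<epsilon>))"
  shows "U \<in> regular \<Omega>"
proof -
  have "(\<lambda>\<epsilon>. L2norm \<Omega> (multi_pd \<alpha> (u \<epsilon>))) \<in> O[at_right 0](\<lambda>\<epsilon>. \<epsilon> powr (- (P + 1)))"
    if \<alpha>: "\<alpha> \<in> lists Basis" for \<alpha>
    using L2norm_of_growth[where u=u, OF \<Omega> moderateD(2)[OF \<Omega> colombeau_moderate[OF \<Omega> U]] \<alpha> g[OF \<alpha>]]
    by (rule net_order_imp_bigo)
  moreover have "0 \<le> P + 1" using P by simp
  ultimately show ?thesis using U unfolding regular_def by blast
qed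

text \<open>The set where the bound fails is open and a null set, hence empty.\<close>

lemma norm_le_of_Linf_norm:
  fixes f :: "'a::euclidean_space \<Rightarrow> complex"
  assumes o: "open \<Omega>" and c: "continuous_on \<Omega> f" and b: "Linf_norm \<Omega> f \<le> ereal M" and x: "x \<in> \<Omega>"
  shows "norm (f x) \<le> M"
proof -
  define A where "A = {x \<in> \<Omega>. M < norm (f x)}"
  have "open A"
  proof -
    have "continuous_on \<Omega> (\<lambda>x. norm (f x))" using c by (intro continuous_intros)
    then have "open (\<Omega> \<inter> (\<lambda>x. norm (f x)) -` {M<..})"
      by (rule continuous_open_preimage[OF _ o open_greaterThan])
    moreover have "A = \<Omega> \<inter> (\<lambda>x. norm (f x)) -` {M<..}" by (auto simp: A_def)
    ultimately show ?thesis by simp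
  qed
  have "AE x in restrict_space lborel \<Omega>. ereal (norm (f x)) \<le> ereal M"
    using esssup_AE[of "\<lambda>x. ereal (norm (f x))" "restrict_space lborel \<Omega>"]
    by (rule eventually_mono) (rule order_trans[OF _ b[unfolded Linf_norm_def]])
  then have "AE x in lborel. x \<in> \<Omega> \<longrightarrow> norm (f x) \<le> M"
    using o by (subst (asm) AE_restrict_space_iff) auto
  then have "AE x in lborel. x \<notin> A" by (rule eventually_mono) (auto simp: A_def)
  then have "A \<in> null_sets lborel" using \<open>open A\<close> by (subst AE_iff_null_sets) auto
  then have "negligible A" using null_sets_completionI negligible_iff_null_sets by blast
  then have "A = {}" using open_not_negligible[OF \<open>open A\<close>] by blast
  then show ?thesis using x by (auto simp: A_def not_less)
qed

section \<open>Functions of the space variable as functions on the space-time domain\<close>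

lemma multi_pd_embed:
  fixes \<alpha> :: "(real \<times> real) list"
  assumes f: "smooth_fun_on I01 f" and \<alpha>: "\<alpha> \<in> lists Basis" and z: "z \<in> X_dom T"
  shows "multi_pd \<alpha> (\<lambda>(x, t). f x) z =
    (if (0, 1) \<in> set \<alpha> then 0 else multi_pd (replicate (length \<alpha>) 1) f (fst z))"
  using \<alpha> z
proof (induction \<alpha> arbitrary: z)
  case Nil
  then show ?case by (simp add: case_prod_beta)
next
  case (Cons i \<alpha>)
  define g where "g = (if (0, 1) \<in> set \<alpha> then (\<lambda>x. 0) else multi_pd (replicate (length \<alpha>) 1) f)"
  have i: "i = (1, 0) \<or> i = (0, 1)" using Cons by (auto simp: Basis_real_prod)
  have z: "z \<in> X_dom T" "fst z \<in> I01" using Cons by (auto simp: X_dom_def)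
  have "multi_pd (i # \<alpha>) (\<lambda>(x, t). f x) z = pd i (\<lambda>w. g (fst w)) z"
    unfolding multi_pd_Cons using Cons by (intro pd_cong[OF open_X_dom]) (auto simp: g_def)
  also have "\<dots> = pd (fst i) g (fst z)"
  proof (rule pd_eqI)
    have "g differentiable at (fst z)"
      unfolding g_def using smooth_differentiable[OF _ f _ z(2)] by (auto simp: in_lists_conv_set)
    then show "((\<lambda>w. g (fst w)) has_derivative (\<lambda>v. pd (fst v) g (fst z))) (at z)"
      by (intro has_derivative_compose[OF has_derivative_fst[OF has_derivative_ident] has_derivative_pd])
  qed
  also have "pd (fst i) g (fst z) = (if i = (0, 1) then 0 else pd 1 g (fst z))"
  proof -
    have "g differentiable at (fst z)"
      unfolding g_def using smooth_differentiable[OF _ f _ z(2)] by (auto simp: in_lists_conv_set)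
    then have "pd 0 g (fst z) = 0" using linear_0[OF has_derivative_linear[OF has_derivative_pd]] by blast
    then show ?thesis using i by auto
  qed
  finally show ?case using i by (auto simp: g_def)
qed

lemma smooth_embed:
  assumes f: "smooth_fun_on I01 f"
  shows "smooth_fun_on (X_dom T) (\<lambda>(x, t). f x)"
proof (rule smoothI)
  fix \<alpha> :: "(real \<times> real) list" and z :: "real \<times> real" assume \<alpha>: "\<alpha> \<in> lists Basis" and z: "z \<in> X_dom T"
  define g where "g = (if (0, 1) \<in> set \<alpha> then (\<lambda>x. 0) else multi_pd (replicate (length \<alpha>) 1) f)"
  have "fst z \<in> I01" using z by (auto simp: X_dom_def)
  then have "g differentiable at (fst z)"
    unfolding g_def using smooth_differentiable[OF _ f] by (auto simp: in_lists_conv_set)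
  then have "((\<lambda>w. g (fst w)) has_derivative (\<lambda>v. pd (fst v) g (fst z))) (at z)"
    by (intro has_derivative_compose[OF has_derivative_fst[OF has_derivative_ident] has_derivative_pd])
  then have d: "(\<lambda>w. g (fst w)) differentiable at z" by (rule differentiableI)
  have e: "g (fst w) = multi_pd \<alpha> (\<lambda>(x, t). f x) w" if "w \<in> X_dom T" for w
    using multi_pd_embed[OF f \<alpha> that] by (simp add: g_def)
  show "multi_pd \<alpha> (\<lambda>(x, t). f x) differentiable at z"
    by (rule differentiable_cong_open[OF open_X_dom z e d])
qed

lemma growth_embed:
  assumes f: "\<And>\<epsilon>. 0 < \<epsilon> \<Longrightarrow> \<epsilon> \<le> 1 \<Longrightarrow> smooth_fun_on I01 (f \<epsilon>)" and \<alpha>: "\<alpha> \<in> lists Basis"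
    and g: "growth (\<lambda>_. I01) P (\<lambda>\<epsilon>. multi_pd (replicate (length \<alpha>) 1) (f \<epsilon>))"
  shows "growth (\<lambda>_. X_dom T) P (\<lambda>\<epsilon>. multi_pd \<alpha> (\<lambda>(x, t). f \<epsilon> x))"
proof -
  obtain m where m: "net_order P m" "\<forall>\<epsilon>. 0 \<le> m \<epsilon>"
    "\<forall>\<^sub>F \<epsilon> in at_right 0. \<forall>p\<in>I01. norm (multi_pd (replicate (length \<alpha>) 1) (f \<epsilon>) p) \<le> m \<epsilon>"
    using g by (rule growthE)
  have "\<forall>\<^sub>F \<epsilon> in at_right 0. \<forall>p\<in>X_dom T. norm (multi_pd \<alpha> (\<lambda>(x, t). f \<epsilon> x) p) \<le> m \<epsilon>"
    using m(3) eventually_unit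
  proof eventually_elim
    case (elim \<epsilon>)
    then show ?case using multi_pd_embed[OF f \<alpha>] m(2) by (auto simp: X_dom_def)
  qed
  then show ?thesis by (rule growthI[OF m(1)])
qed

lemma moderate_embed:
  assumes T: "T > 0" and f: "f \<in> moderate I01"
  shows "(\<lambda>\<epsilon> (x, t). f \<epsilon> x) \<in> moderate (X_dom T)"
  unfolding moderate_iff[OF sobolev_box_X_dom[OF T]]
proof (intro conjI ballI)
  have \<Omega>: "sobolev_box I01" by (rule sobolev_box_interval) simp
  fix \<epsilon> :: real assume "\<epsilon> \<in> {0<..1}"
  then have \<epsilon>: "0 < \<epsilon>" "\<epsilon> \<le> 1" by auto
  note sm = moderateD(2)[OF \<Omega> f \<epsilon>]
  show "bounded_smooth (X_dom T) (\<lambda>(x, t). f \<epsilon> x)"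
    unfolding bounded_smooth_def
  proof (intro conjI ballI smooth_embed[OF sm])
    fix \<alpha> assume \<alpha>: "\<alpha> \<in> lists (Basis :: (real \<times> real) set)"
    have "replicate (length \<alpha>) 1 \<in> lists (Basis :: real set)" by (auto simp: in_lists_conv_set)
    then obtain M where "0 \<le> M" "\<And>x. x \<in> I01 \<Longrightarrow> norm (multi_pd (replicate (length \<alpha>) 1) (f \<epsilon>) x) \<le> M"
      using bounded_smooth_bound[OF moderateD(1)[OF \<Omega> f \<epsilon>]] by blast
    then show "\<exists>M. \<forall>x\<in>X_dom T. norm (multi_pd \<alpha> (\<lambda>(x, t). f \<epsilon> x) x) \<le> M"
      using multi_pd_embed[OF sm \<alpha>] by (intro exI[of _ M]) (auto simp: X_dom_def)
  qed
next
  have \<Omega>: "sobolev_box I01" by (rule sobolev_box_interval) simp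
  fix \<alpha> assume \<alpha>: "\<alpha> \<in> lists (Basis :: (real \<times> real) set)"
  have "replicate (length \<alpha>) 1 \<in> lists (Basis :: real set)" by (auto simp: in_lists_conv_set)
  then obtain P where "growth (\<lambda>_. I01) P (\<lambda>\<epsilon>. multi_pd (replicate (length \<alpha>) 1) (f \<epsilon>))"
    using moderateD(3)[OF \<Omega> f] by blast
  then show "\<exists>P. growth (\<lambda>_. X_dom T) P (\<lambda>\<epsilon>. multi_pd \<alpha> (case_prod (\<lambda>x t. f \<epsilon> x)))"
    using growth_embed[where f=f, OF moderateD(2)[OF \<Omega> f] \<alpha>] by blast
qed

section \<open>Boundary values\<close>

text \<open>A quadratic error bound, unlike differentiability itself, survives pointwise limits.\<close>

lemma has_vector_derivative_of_quadratic_error: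
  fixes F :: "real \<Rightarrow> 'b::real_normed_vector"
  assumes r: "0 < r" and b: "\<And>s. \<bar>s - s0\<bar> < r \<Longrightarrow> norm (F s - F s0 - (s - s0) *\<^sub>R D) \<le> K * \<bar>s - s0\<bar>\<^sup>2"
  shows "(F has_vector_derivative D) (at s0)"
  unfolding has_vector_derivative_def
proof (rule has_derivativeI_sandwich[OF r])
  show "bounded_linear (\<lambda>x. x *\<^sub>R D)" by (rule bounded_linear_scaleR_left)
  show "((\<lambda>s. K * \<bar>s - s0\<bar>) \<longlongrightarrow> 0) (at s0)"
    by (rule tendsto_eq_intros refl | simp)+
  fix s assume s: "s \<noteq> s0" "dist s s0 < r"
  then have "norm (F s - F s0 - (s - s0) *\<^sub>R D) \<le> K * \<bar>s - s0\<bar>\<^sup>2" by (intro b) (simp add: dist_real_def)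
  then show "norm (F s - F s0 - (s - s0) *\<^sub>R D) / norm (s - s0) \<le> K * \<bar>s - s0\<bar>"
    using s by (simp add: field_simps power2_eq_square abs_mult)
qed

lemma bounded_smooth_lipschitz:
  assumes \<Omega>: "sobolev_box \<Omega>" and f: "bounded_smooth \<Omega> f"
  obtains L where "0 \<le> L" "\<And>x y. x \<in> \<Omega> \<Longrightarrow> y \<in> \<Omega> \<Longrightarrow> norm (f x - f y) \<le> L * norm (x - y)"
proof -
  note geo = sobolev_box_geometry[OF \<Omega>]
  have "\<forall>i\<in>Basis. \<exists>M. \<forall>x\<in>\<Omega>. norm (pd i f x) \<le> M"
    using bounded_smooth_bound[OF f, of "[i]" for i] by (simp, metis)
  then obtain M where M: "\<forall>i\<in>Basis. \<forall>x\<in>\<Omega>. norm (pd i f x) \<le> M i" by (rule bchoice[THEN exE])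
  have d: "f differentiable at x" if "x \<in> \<Omega>" for x
    by (rule smooth_differentiable0[OF geo(1) bounded_smooth_smooth[OF f] that])
  have l: "norm (f x - f y) \<le> (\<Sum>i\<in>Basis. M i) * norm (x - y)" if "x \<in> \<Omega>" "y \<in> \<Omega>" for x y
    using M by (intro lipschitz_of_pd_bound[OF geo(1,2) d _ that]) auto
  show thesis
  proof (rule that[of "\<bar>\<Sum>i\<in>Basis. M i\<bar>"])
    fix x y assume "x \<in> \<Omega>" "y \<in> \<Omega>"
    from l[OF this] show "norm (f x - f y) \<le> \<bar>\<Sum>i\<in>Basis. M i\<bar> * norm (x - y)"
      by (rule order_trans) (simp add: mult_right_mono)
  qed simp
qed

lemma bval_tendsto:
  assumes \<Omega>: "sobolev_box \<Omega>" and f: "bounded_smooth \<Omega> f" and y: "y \<in> closure \<Omega>"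
  shows "(f \<longlongrightarrow> bval \<Omega> f y) (at y within \<Omega>)" "at y within \<Omega> \<noteq> bot"
proof -
  note geo = sobolev_box_geometry[OF \<Omega>]
  show nb: "at y within \<Omega> \<noteq> bot"
  proof (cases "y \<in> \<Omega>")
    case True
    then have "y \<in> interior \<Omega>" using geo(1) by (simp add: interior_open)
    then show ?thesis unfolding trivial_limit_within by (simp add: interior_limit_point)
  next
    case False
    then show ?thesis using y unfolding trivial_limit_within closure_def by simp
  qed
  obtain L where L: "0 \<le> L" "\<And>x y. x \<in> \<Omega> \<Longrightarrow> y \<in> \<Omega> \<Longrightarrow> norm (f x - f y) \<le> L * norm (x - y)"
    using bounded_smooth_lipschitz[OF \<Omega> f] by blast
  have "uniformly_continuous_on \<Omega> f"
    by (rule lipschitz_on_uniformly_continuous[of L]) (use L in \<open>auto simp: lipschitz_on_def dist_norm\<close>)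
  then obtain l where l: "(f \<longlongrightarrow> l) (at y within \<Omega>)"
    using uniformly_continuous_on_extension_at_closure y by blast
  then show "(f \<longlongrightarrow> bval \<Omega> f y) (at y within \<Omega>)"
    unfolding bval_def using tendsto_Lim[OF nb l] by simp
qed

text \<open>The Lipschitz estimate is inherited by the limit at the boundary.\<close>

lemma norm_diff_bval_le:
  assumes \<Omega>: "sobolev_box \<Omega>" and f: "bounded_smooth \<Omega> f" and y: "y \<in> closure \<Omega>" and x: "x \<in> \<Omega>"
    and L: "\<And>z. z \<in> \<Omega> \<Longrightarrow> norm (f x - f z) \<le> L * norm (x - z)"
  shows "norm (f x - bval \<Omega> f y) \<le> L * norm (x - y)"
proof (rule tendsto_le[OF bval_tendsto(2)[OF \<Omega> f y]])
  show "((\<lambda>z. L * norm (x - z)) \<longlongrightarrow> L * norm (x - y)) (at y within \<Omega>)"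
    by (intro tendsto_intros)
  show "((\<lambda>z. norm (f x - f z)) \<longlongrightarrow> norm (f x - bval \<Omega> f y)) (at y within \<Omega>)"
    by (intro tendsto_intros bval_tendsto(1)[OF \<Omega> f y])
  show "\<forall>\<^sub>F z in at y within \<Omega>. norm (f x - f z) \<le> L * norm (x - z)"
    unfolding eventually_at_filter using L by simp
qed

text \<open>A side of the space-time domain, parametrized by \<open>s\<close> along the edge direction \<open>e\<close>; the direction
  \<open>n\<close> points into the domain.\<close>

locale side =
  fixes T p q :: real and z e n :: "real \<times> real" and h0 :: real
  assumes T: "T > 0" and pq: "p < q" and e: "e \<in> Basis" and h0: "0 < h0" and n: "norm n \<le> 1"
    and inside: "\<And>s h. p < s \<Longrightarrow> s < q \<Longrightarrow> 0 < h \<Longrightarrow> h < h0 \<Longrightarrow> z + s *\<^sub>R e + h *\<^sub>R n \<in> X_dom T"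
begin

definition tr :: "(real \<times> real \<Rightarrow> complex) \<Rightarrow> real \<Rightarrow> complex" where
  "tr f s = bval (X_dom T) f (z + s *\<^sub>R e)"

lemma box: "sobolev_box (X_dom T)" "sobolev_box {p<..<q}"
  by (rule sobolev_box_X_dom[OF T], rule sobolev_box_interval[OF pq])

lemma inward_tendsto: "((\<lambda>h. z + s *\<^sub>R e + h *\<^sub>R n) \<longlongrightarrow> z + s *\<^sub>R e) (at_right 0)"
  by (rule tendsto_eq_intros refl | simp)+

lemma eventually_inward: "\<forall>\<^sub>F h in at_right 0. 0 < h \<and> h < h0"
  using eventually_at_right_real[OF h0] by simp

lemma side_closure:
  assumes "p < s" "s < q"
  shows "z + s *\<^sub>R e \<in> closure (X_dom T)"
proof (rule Lim_in_closed_set[OF closed_closure _ _ inward_tendsto])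
  show "\<forall>\<^sub>F h in at_right 0. z + s *\<^sub>R e + h *\<^sub>R n \<in> closure (X_dom T)"
    using eventually_inward by eventually_elim (use inside[OF assms] closure_subset in blast)
qed simp

lemma norm_diff_tr_le:
  assumes f: "bounded_smooth (X_dom T) f" and s: "p < s" "s < q" and h: "0 < h" "h < h0"
    and L: "\<And>x y. x \<in> X_dom T \<Longrightarrow> y \<in> X_dom T \<Longrightarrow> norm (f x - f y) \<le> L * norm (x - y)" "0 \<le> L"
  shows "norm (f (z + s *\<^sub>R e + h *\<^sub>R n) - tr f s) \<le> L * h"
proof -
  have "norm (f (z + s *\<^sub>R e + h *\<^sub>R n) - tr f s) \<le> L * norm (z + s *\<^sub>R e + h *\<^sub>R n - (z + s *\<^sub>R e))"
    unfolding tr_def using inside[OF s h]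
    by (intro norm_diff_bval_le[OF box(1) f side_closure[OF s]] L(1)) auto
  also have "\<dots> \<le> L * h"
    using n L(2) h by (intro mult_left_mono) (auto intro: mult_left_le)
  finally show ?thesis .
qed

lemma tr_tendsto:
  assumes f: "bounded_smooth (X_dom T) f" and s: "p < s" "s < q"
  shows "((\<lambda>h. f (z + s *\<^sub>R e + h *\<^sub>R n)) \<longlongrightarrow> tr f s) (at_right 0)"
proof -
  obtain L where L: "0 \<le> L" "\<And>x y. x \<in> X_dom T \<Longrightarrow> y \<in> X_dom T \<Longrightarrow> norm (f x - f y) \<le> L * norm (x - y)"
    using bounded_smooth_lipschitz[OF box(1) f] by blast
  have "((\<lambda>h. L * h) \<longlongrightarrow> 0) (at_right 0)" by (rule tendsto_eq_intros refl | simp)+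
  moreover have "\<forall>\<^sub>F h in at_right 0. norm (f (z + s *\<^sub>R e + h *\<^sub>R n) - tr f s) \<le> L * h"
    using eventually_inward by eventually_elim (intro norm_diff_tr_le[OF f s _ _ L(2,1)]; simp)
  ultimately have "((\<lambda>h. f (z + s *\<^sub>R e + h *\<^sub>R n) - tr f s) \<longlongrightarrow> 0) (at_right 0)"
    by (rule Lim_null_comparison[rotated])
  then show ?thesis by (simp add: LIM_zero_iff)
qed

lemma norm_tr_le:
  assumes f: "bounded_smooth (X_dom T) f" and s: "p < s" "s < q"
    and M: "\<And>x. x \<in> X_dom T \<Longrightarrow> norm (f x) \<le> M"
  shows "norm (tr f s) \<le> M"
proof (rule tendsto_upperbound[OF tendsto_norm[OF tr_tendsto[OF f s]]])
  show "\<forall>\<^sub>F h in at_right 0. norm (f (z + s *\<^sub>R e + h *\<^sub>R n)) \<le> M"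
    using eventually_inward by eventually_elim (use M inside[OF s] in simp)
qed simp

text \<open>The error of the first order Taylor formula along lines parallel to the side is quadratic, uniformly
  up to the side, and the limit at the side preserves this.\<close>

lemma tr_derivative:
  assumes f: "bounded_smooth (X_dom T) f" and s0: "p < s0" "s0 < q"
  shows "(tr f has_vector_derivative tr (pd e f) s0) (at s0)"
proof -
  note sm = bounded_smooth_smooth[OF f]
  have f1: "bounded_smooth (X_dom T) (pd e f)" by (rule bounded_smooth_pd[OF f e])
  obtain L where L: "0 \<le> L" "\<And>x y. x \<in> X_dom T \<Longrightarrow> y \<in> X_dom T \<Longrightarrow> norm (pd e f x - pd e f y) \<le> L * norm (x - y)"
    using bounded_smooth_lipschitz[OF box(1) f1] by blast
  define r where "r = min (s0 - p) (q - s0)"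
  show ?thesis
  proof (rule has_vector_derivative_of_quadratic_error[where K=L])
    show "0 < r" using s0 by (simp add: r_def)
    fix s assume sr: "\<bar>s - s0\<bar> < r"
    then have s: "p < s" "s < q" by (auto simp: r_def)
    have pre: "norm (f (z + s *\<^sub>R e + h *\<^sub>R n) - f (z + s0 *\<^sub>R e + h *\<^sub>R n)
        - (s - s0) *\<^sub>R pd e f (z + s0 *\<^sub>R e + h *\<^sub>R n)) \<le> L * \<bar>s - s0\<bar>\<^sup>2" if h: "0 < h" "h < h0" for h
    proof -
      define g where "g s = f (z + s *\<^sub>R e + h *\<^sub>R n) - s *\<^sub>R pd e f (z + s0 *\<^sub>R e + h *\<^sub>R n)" for s
      define D where "D s = pd e f (z + s *\<^sub>R e + h *\<^sub>R n) - pd e f (z + s0 *\<^sub>R e + h *\<^sub>R n)" for s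
      have seg: "p < t" "t < q" "\<bar>t - s0\<bar> \<le> \<bar>s - s0\<bar>" if "t \<in> closed_segment s0 s" for t
        using that s s0 by (auto simp: closed_segment_eq_real_ivl split: if_splits)
      have "norm (g s - g s0) \<le> (L * \<bar>s - s0\<bar>) * norm (s - s0)"
      proof (rule differentiable_bound[where S="closed_segment s0 s"])
        fix t assume t: "t \<in> closed_segment s0 s"
        have "((\<lambda>s. f ((z + h *\<^sub>R n) + s *\<^sub>R e)) has_vector_derivative pd e f ((z + h *\<^sub>R n) + t *\<^sub>R e)) (at t)"
          using inside[OF seg(1,2)[OF t] h] by (intro smooth_line_derivative[OF open_X_dom sm]) (simp add: algebra_simps)
        then have "(g has_vector_derivative D t) (at t)"
          unfolding g_def D_def by (auto intro!: derivative_eq_intros simp: algebra_simps)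
        then show "(g has_derivative (\<lambda>u. u *\<^sub>R D t)) (at t within closed_segment s0 s)"
          unfolding has_vector_derivative_def by (rule has_derivative_at_withinI)
        have "norm (D t) \<le> L * norm ((t - s0) *\<^sub>R e)"
          using L(2)[OF inside[OF seg(1,2)[OF t] h] inside[OF s0 h]] unfolding D_def by (simp add: algebra_simps)
        also have "\<dots> \<le> L * \<bar>s - s0\<bar>"
          using seg(3)[OF t] L(1) e by (intro mult_left_mono) auto
        finally have "norm (D t) \<le> L * \<bar>s - s0\<bar>" .
        then have "norm (u *\<^sub>R D t) \<le> L * \<bar>s - s0\<bar> * norm u" for u :: real
          using mult_left_mono[of "norm (D t)" "L * \<bar>s - s0\<bar>" "norm u"] by (simp add: mult_ac)
        then show "onorm (\<lambda>u. u *\<^sub>R D t) \<le> L * \<bar>s - s0\<bar>" by (rule onorm_le)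
      qed auto
      then show ?thesis by (simp add: g_def power2_eq_square algebra_simps)
    qed
    show "norm (tr f s - tr f s0 - (s - s0) *\<^sub>R tr (pd e f) s0) \<le> L * \<bar>s - s0\<bar>\<^sup>2"
    proof (rule tendsto_upperbound)
      show "((\<lambda>h. norm (f (z + s *\<^sub>R e + h *\<^sub>R n) - f (z + s0 *\<^sub>R e + h *\<^sub>R n)
        - (s - s0) *\<^sub>R pd e f (z + s0 *\<^sub>R e + h *\<^sub>R n))) \<longlongrightarrow>
          norm (tr f s - tr f s0 - (s - s0) *\<^sub>R tr (pd e f) s0)) (at_right 0)"
        by (intro tendsto_intros tr_tendsto f f1 s s0)
      show "\<forall>\<^sub>F h in at_right 0. norm (f (z + s *\<^sub>R e + h *\<^sub>R n) - f (z + s0 *\<^sub>R e + h *\<^sub>R n)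
        - (s - s0) *\<^sub>R pd e f (z + s0 *\<^sub>R e + h *\<^sub>R n)) \<le> L * \<bar>s - s0\<bar>\<^sup>2"
        using eventually_inward by eventually_elim (rule pre; simp)
    qed simp
  qed
qed

lemma multi_pd_tr:
  assumes f: "bounded_smooth (X_dom T) f" and s: "s \<in> {p<..<q}"
  shows "multi_pd (replicate k 1) (tr f) s = tr (multi_pd (replicate k e) f) s"
  using s
proof (induction k arbitrary: s)
  case (Suc k)
  have L: "replicate k e \<in> lists Basis" using e by (auto simp: in_lists_conv_set)
  have "multi_pd (replicate (Suc k) 1) (tr f) s = pd 1 (tr (multi_pd (replicate k e) f)) s"
    using Suc by (auto intro!: pd_cong[of "{p<..<q}"])
  also have "\<dots> = 1 *\<^sub>R tr (pd e (multi_pd (replicate k e) f)) s"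
    using tr_derivative[OF bounded_smooth_multi_pd[OF f L]] Suc.prems
    unfolding has_vector_derivative_def by (intro pd_eqI) auto
  finally show ?case by simp
qed simp

lemma lists_Basis_real: "\<alpha> \<in> lists (Basis :: real set) \<Longrightarrow> \<alpha> = replicate (length \<alpha>) 1"
  by (simp add: in_lists_conv_set replicate_eqI)

lemma bounded_smooth_tr:
  assumes f: "bounded_smooth (X_dom T) f"
  shows "bounded_smooth {p<..<q} (tr f)"
  unfolding bounded_smooth_def
proof (intro conjI ballI smoothI)
  have L: "replicate k e \<in> lists Basis" for k using e by (auto simp: in_lists_conv_set)
  fix \<alpha> assume "\<alpha> \<in> lists (Basis :: real set)"
  then have \<alpha>: "\<alpha> = replicate (length \<alpha>) 1" by (rule lists_Basis_real)
  let ?g = "multi_pd (replicate (length \<alpha>) e) f"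
  have eq: "multi_pd \<alpha> (tr f) s = tr ?g s" if "s \<in> {p<..<q}" for s
    using multi_pd_tr[OF f that, of "length \<alpha>"] \<alpha> by simp
  note bs = bounded_smooth_multi_pd[OF f L[of "length \<alpha>"]]
  obtain M where M: "\<And>x. x \<in> X_dom T \<Longrightarrow> norm (?g x) \<le> M"
    using bounded_smooth_bound[OF f L[of "length \<alpha>"]] by blast
  show "\<exists>M. \<forall>s\<in>{p<..<q}. norm (multi_pd \<alpha> (tr f) s) \<le> M"
    using norm_tr_le[OF bs _ _ M] eq by (intro exI[of _ M]) auto
  fix s assume s: "s \<in> {p<..<q}"
  have "tr ?g differentiable at s"
    using tr_derivative[OF bs] s unfolding has_vector_derivative_def differentiable_def by auto
  then show "multi_pd \<alpha> (tr f) differentiable at s"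
    by (intro differentiable_cong_open[OF _ s eq[symmetric]]) auto
qed

lemma moderate_tr:
  assumes u: "u \<in> moderate (X_dom T)"
  shows "(\<lambda>\<epsilon>. tr (u \<epsilon>)) \<in> moderate {p<..<q}"
  unfolding moderate_iff[OF box(2)]
proof (intro conjI ballI)
  show "bounded_smooth {p<..<q} (tr (u \<epsilon>))" if "\<epsilon> \<in> {0<..1}" for \<epsilon>
    using that moderateD(1)[OF box(1) u] by (intro bounded_smooth_tr) auto
  fix \<alpha> assume "\<alpha> \<in> lists (Basis :: real set)"
  then have \<alpha>: "\<alpha> = replicate (length \<alpha>) 1" by (rule lists_Basis_real)
  have L: "replicate (length \<alpha>) e \<in> lists Basis" using e by (auto simp: in_lists_conv_set)
  obtain P where "growth (\<lambda>_. X_dom T) P (\<lambda>\<epsilon>. multi_pd (replicate (length \<alpha>) e) (u \<epsilon>))"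
    using moderateD(3)[OF box(1) u L] by blast
  then obtain m where m: "net_order P m" "\<forall>\<epsilon>. 0 \<le> m \<epsilon>"
    "\<forall>\<^sub>F \<epsilon> in at_right 0. \<forall>x\<in>X_dom T. norm (multi_pd (replicate (length \<alpha>) e) (u \<epsilon>) x) \<le> m \<epsilon>"
    by (rule growthE)
  have "\<forall>\<^sub>F \<epsilon> in at_right 0. \<forall>s\<in>{p<..<q}. norm (multi_pd \<alpha> (tr (u \<epsilon>)) s) \<le> m \<epsilon>"
    using m(3) eventually_unit
  proof eventually_elim
    case (elim \<epsilon>)
    then have bs: "bounded_smooth (X_dom T) (u \<epsilon>)" using moderateD(1)[OF box(1) u] by simp
    show ?case
    proof
      fix s assume s: "s \<in> {p<..<q}"
      have "multi_pd \<alpha> (tr (u \<epsilon>)) s = tr (multi_pd (replicate (length \<alpha>) e) (u \<epsilon>)) s"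
        using multi_pd_tr[OF bs s, of "length \<alpha>"] \<alpha> by simp
      then show "norm (multi_pd \<alpha> (tr (u \<epsilon>)) s) \<le> m \<epsilon>"
        using norm_tr_le[OF bounded_smooth_multi_pd[OF bs L]] s elim by auto
    qed
  qed
  then have "growth (\<lambda>_. {p<..<q}) P (\<lambda>\<epsilon>. multi_pd \<alpha> (tr (u \<epsilon>)))" by (rule growthI[OF m(1)])
  then show "\<exists>P. growth (\<lambda>_. {p<..<q}) P (\<lambda>\<epsilon>. multi_pd \<alpha> (tr (u \<epsilon>)))" ..
qed

text \<open>At a negligible distance \<open>h \<epsilon>\<close> from the side a moderate family differs negligibly from its boundary
  values, because its Lipschitz constants are moderate.\<close>

lemma growth_near_side:
  assumes u: "u \<in> moderate (X_dom T)"
    and h: "\<And>\<epsilon>. 0 < \<epsilon> \<Longrightarrow> \<epsilon> \<le> 1 \<Longrightarrow> 0 < h \<epsilon> \<and> h \<epsilon> < h0" and hn: "\<And>R. net_order R h"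
    and g: "growth (\<lambda>_. {p<..<q}) P (\<lambda>\<epsilon>. multi_pd (replicate k 1) (tr (u \<epsilon>)))"
  shows "growth (\<lambda>\<epsilon>. (\<lambda>s. z + s *\<^sub>R e + h \<epsilon> *\<^sub>R n) ` {p<..<q}) P (\<lambda>\<epsilon>. multi_pd (replicate k e) (u \<epsilon>))"
proof -
  have L: "replicate k e \<in> lists Basis" using e by (auto simp: in_lists_conv_set)
  obtain R M where M: "net_order R M" "\<forall>\<epsilon>. 0 \<le> M \<epsilon>" "\<forall>\<^sub>F \<epsilon> in at_right 0. \<forall>x\<in>X_dom T. \<forall>y\<in>X_dom T.
      norm (multi_pd (replicate k e) (u \<epsilon>) x - multi_pd (replicate k e) (u \<epsilon>) y) \<le> M \<epsilon> * norm (x - y)"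
    by (rule moderate_lipschitz[OF box(1) u L])
  obtain m where m: "net_order P m" "\<forall>\<epsilon>. 0 \<le> m \<epsilon>"
    "\<forall>\<^sub>F \<epsilon> in at_right 0. \<forall>s\<in>{p<..<q}. norm (multi_pd (replicate k 1) (tr (u \<epsilon>)) s) \<le> m \<epsilon>"
    using g by (rule growthE)
  show ?thesis
  proof (rule growthI)
    show "net_order P (\<lambda>\<epsilon>. m \<epsilon> + M \<epsilon> * h \<epsilon>)"
      using net_order_mult[OF M(1) hn[of "P - R"]] by (intro net_order_add m(1)) auto
    show "\<forall>\<^sub>F \<epsilon> in at_right 0. \<forall>x\<in>(\<lambda>s. z + s *\<^sub>R e + h \<epsilon> *\<^sub>R n) ` {p<..<q}.
        norm (multi_pd (replicate k e) (u \<epsilon>) x) \<le> m \<epsilon> + M \<epsilon> * h \<epsilon>"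
      using m(3) M(3) eventually_unit
    proof eventually_elim
      case (elim \<epsilon>)
      have bs: "bounded_smooth (X_dom T) (u \<epsilon>)" using elim moderateD(1)[OF box(1) u] by simp
      let ?g = "multi_pd (replicate k e) (u \<epsilon>)"
      note bg = bounded_smooth_multi_pd[OF bs L]
      show ?case
      proof
        fix x assume "x \<in> (\<lambda>s. z + s *\<^sub>R e + h \<epsilon> *\<^sub>R n) ` {p<..<q}"
        then obtain s where s: "p < s" "s < q" and x: "x = z + s *\<^sub>R e + h \<epsilon> *\<^sub>R n" by auto
        have "norm (?g x - tr ?g s) \<le> M \<epsilon> * h \<epsilon>"
          unfolding x using elim(2,3) h[of \<epsilon>] M(2) by (intro norm_diff_tr_le[OF bg s]) auto
        moreover have "norm (tr ?g s) \<le> m \<epsilon>"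
          using multi_pd_tr[OF bs, of s k] elim(1) s by (metis greaterThanLessThan_iff)
        ultimately show "norm (?g x) \<le> m \<epsilon> + M \<epsilon> * h \<epsilon>"
          using norm_triangle_sub[of "?g x" "tr ?g s"] by simp
      qed
    qed
  qed
qed

end

section \<open>Interpolation on an interval\<close>

text \<open>For a constant \<open>m\<close> the integral of \<open>(norm f - m)\<^sup>2\<close> is nonnegative; here \<open>m\<close> is the integral of
  \<open>norm f\<close>.\<close>

lemma square_integral_norm_le:
  fixes f :: "real \<Rightarrow> 'b::real_normed_vector"
  assumes "a \<le> b" "b - a \<le> 1" "continuous_on {a..b} f"
  shows "(integral {a..b} (\<lambda>x. norm (f x)))\<^sup>2 \<le> integral {a..b} (\<lambda>x. (norm (f x))\<^sup>2)"
proof -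
  define m where "m = integral {a..b} (\<lambda>x. norm (f x))"
  have i: "(\<lambda>x. norm (f x)) integrable_on {a..b}" "(\<lambda>x. (norm (f x))\<^sup>2) integrable_on {a..b}"
    using assms(3) by (auto intro!: integrable_continuous_real continuous_intros)
  have "0 \<le> integral {a..b} (\<lambda>x. (norm (f x) - m)\<^sup>2)"
    by (intro Henstock_Kurzweil_Integration.integral_nonneg integrable_continuous_real continuous_intros assms(3)) auto
  also have "integral {a..b} (\<lambda>x. (norm (f x) - m)\<^sup>2) =
      integral {a..b} (\<lambda>x. (norm (f x))\<^sup>2 - 2 * m * norm (f x) + m\<^sup>2)"
    by (intro integral_cong) (simp add: power2_diff)
  also have "\<dots> = integral {a..b} (\<lambda>x. (norm (f x))\<^sup>2) - 2 * m * m + (b - a) * m\<^sup>2"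
  proof (rule integral_unique)
    show "((\<lambda>x. (norm (f x))\<^sup>2 - 2 * m * norm (f x) + m\<^sup>2) has_integral
        (integral {a..b} (\<lambda>x. (norm (f x))\<^sup>2) - 2 * m * m + (b - a) * m\<^sup>2)) {a..b}"
      using has_integral_add[OF has_integral_diff[OF integrable_integral[OF i(2)]
          has_integral_mult_right[OF integrable_integral[OF i(1)], of "2 * m"]]
          has_integral_const_real[of "m\<^sup>2" a b]] assms(1) by (simp add: m_def[symmetric])
  qed
  finally have "(2 - (b - a)) * m\<^sup>2 \<le> integral {a..b} (\<lambda>x. (norm (f x))\<^sup>2)"
    by (simp add: power2_eq_square algebra_simps)
  moreover have "1 * m\<^sup>2 \<le> (2 - (b - a)) * m\<^sup>2" using assms(2) by (intro mult_right_mono) auto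
  ultimately show ?thesis by (simp add: m_def)
qed

lemma exists_le_mean:
  fixes g :: "real \<Rightarrow> real"
  assumes "a \<le> b" "continuous_on {a..b} g"
  obtains y where "y \<in> {a..b}" "(b - a) * g y \<le> integral {a..b} g"
proof -
  obtain y where y: "y \<in> {a..b}" "\<And>x. x \<in> {a..b} \<Longrightarrow> g y \<le> g x"
    using continuous_attains_inf[OF compact_Icc _ assms(2)] assms(1) by auto
  have "integral {a..b} (\<lambda>x. g y) \<le> integral {a..b} g"
    using y assms(2) by (intro integral_le integrable_continuous_real) auto
  then show thesis using that[OF y(1)] assms(1) by simp
qed

text \<open>The derivative at \<open>x\<close> is compared with a difference quotient of \<open>w\<close> between points \<open>z\<close> and \<open>y\<close> of the
  outer thirds of the interval at which \<open>(norm w)\<^sup>2\<close> is at most its mean there; the derivative varies by at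
  most the integral of \<open>norm w''\<close>.  The mean value inequality then controls \<open>w\<close> itself.\<close>

lemma interpolation:
  fixes w w' w'' :: "real \<Rightarrow> complex"
  assumes ab: "1 / 2 \<le> b - a" "b - a \<le> 1"
    and d1: "\<And>y. y \<in> {a..b} \<Longrightarrow> (w has_vector_derivative w' y) (at y)"
    and d2: "\<And>y. y \<in> {a..b} \<Longrightarrow> (w' has_vector_derivative w'' y) (at y)"
    and c2: "continuous_on {a..b} w''" and x: "x \<in> {a..b}"
  defines "I \<equiv> integral {a..b} (\<lambda>x. (norm (w x))\<^sup>2) + integral {a..b} (\<lambda>x. (norm (w'' x))\<^sup>2)"
  shows "(norm (w x))\<^sup>2 \<le> 3000 * I" "(norm (w' x))\<^sup>2 \<le> 3000 * I"
proof -
  define N where "N = integral {a..b} (\<lambda>x. (norm (w x))\<^sup>2)"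
  define N2 where "N2 = integral {a..b} (\<lambda>x. (norm (w'' x))\<^sup>2)"
  define L where "L = b - a"
  define m where "m = integral {a..b} (\<lambda>x. norm (w'' x))"
  have L: "1 / 2 \<le> L" "L \<le> 1" using ab by (auto simp: L_def)
  have c0: "continuous_on {a..b} w"
    using d1 by (meson continuous_at_imp_continuous_on has_vector_derivative_continuous)
  have csq: "continuous_on {a..b} (\<lambda>x. (norm (w x))\<^sup>2)" using c0 by (intro continuous_intros)
  have Nnn: "0 \<le> N" "0 \<le> N2" unfolding N_def N2_def
    by (intro Henstock_Kurzweil_Integration.integral_nonneg integrable_continuous_real continuous_intros c0 c2; simp)+
  have m0: "0 \<le> m" unfolding m_def
    by (intro Henstock_Kurzweil_Integration.integral_nonneg integrable_continuous_real continuous_intros c2) simp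
  have mN2: "m\<^sup>2 \<le> N2" unfolding m_def N2_def using ab by (intro square_integral_norm_le c2) auto
  have slope: "norm (w' r - w' q) \<le> m" if "q \<in> {a..b}" "r \<in> {a..b}" "q \<le> r" for q r
  proof -
    have sub: "{q..r} \<subseteq> {a..b}" using that by auto
    have cqr: "continuous_on {q..r} w''" using c2 sub by (rule continuous_on_subset)
    have "(w'' has_integral (w' r - w' q)) {q..r}"
      using that sub by (intro fundamental_theorem_of_calculus) (auto intro!: has_vector_derivative_at_within d2)
    then have "w' r - w' q = integral {q..r} w''" by (rule integral_unique[symmetric])
    also have "norm \<dots> \<le> integral {q..r} (\<lambda>x. norm (w'' x))"
      by (intro integral_norm_bound_integral integrable_continuous_real continuous_intros cqr) auto
    also have "\<dots> \<le> m" unfolding m_def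
      by (intro integral_subset_le[OF sub] integrable_continuous_real continuous_intros cqr c2) auto
    finally show ?thesis .
  qed
  have slope': "norm (w' r - w' q) \<le> m" if "q \<in> {a..b}" "r \<in> {a..b}" for q r
    using slope[of q r] slope[of r q] that by (cases "q \<le> r") (auto simp: norm_minus_commute)
  have sub_le: "integral {p..q} (\<lambda>x. (norm (w x))\<^sup>2) \<le> N" if "{p..q} \<subseteq> {a..b}" for p q
    unfolding N_def using that csq
    by (intro integral_subset_le[OF that] integrable_continuous_real continuous_on_subset[OF csq that]) auto
  have third: "\<exists>y\<in>{p..q}. (norm (w y))\<^sup>2 \<le> 6 * N" if "{p..q} \<subseteq> {a..b}" "q - p = L / 3" for p q
  proof -
    have c: "continuous_on {p..q} (\<lambda>x. (norm (w x))\<^sup>2)" using csq that(1) by (rule continuous_on_subset)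
    have "p \<le> q" using that(2) L by simp
    then obtain y where y: "y \<in> {p..q}" "(q - p) * (norm (w y))\<^sup>2 \<le> integral {p..q} (\<lambda>x. (norm (w x))\<^sup>2)"
      using exists_le_mean[OF _ c] by blast
    have "1 / 6 * (norm (w y))\<^sup>2 \<le> (q - p) * (norm (w y))\<^sup>2" using that(2) L by (intro mult_right_mono) auto
    then show ?thesis using y sub_le[OF that(1)] by (intro bexI[of _ y]) auto
  qed
  have thirds: "{a..a + L / 3} \<subseteq> {a..b}" "{b - L / 3..b} \<subseteq> {a..b}" using ab by (auto simp: L_def field_simps)
  obtain z where z: "z \<in> {a..a + L / 3}" "(norm (w z))\<^sup>2 \<le> 6 * N"
    using third[OF thirds(1)] by auto
  obtain y where y: "y \<in> {b - L / 3..b}" "(norm (w y))\<^sup>2 \<le> 6 * N"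
    using third[OF thirds(2)] by auto
  have zy: "z \<in> {a..b}" "y \<in> {a..b}" "1 / 6 \<le> y - z"
  proof -
    show "z \<in> {a..b}" "y \<in> {a..b}" using z(1) y(1) thirds by blast+
    have "z \<le> a + L / 3" "b - L / 3 \<le> y" "b = a + L" using z(1) y(1) by (auto simp: L_def)
    then show "1 / 6 \<le> y - z" using L(1) by linarith
  qed
  have sq3: "(p + q + r)\<^sup>2 \<le> 3 * p\<^sup>2 + 3 * q\<^sup>2 + 3 * r\<^sup>2" for p q r :: real
  proof -
    have "0 \<le> (p - q)\<^sup>2 + (q - r)\<^sup>2 + (p - r)\<^sup>2" by simp
    then show ?thesis by (simp add: power2_eq_square algebra_simps)
  qed
  have d: "(norm (w' x))\<^sup>2 \<le> 1300 * (N + N2)" if x: "x \<in> {a..b}" for x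
  proof -
    define \<phi> where "\<phi> s = w s - s *\<^sub>R w' x" for s
    have "norm (\<phi> y - \<phi> z) \<le> m * norm (y - z)"
    proof (rule differentiable_bound[where S="{a..b}"])
      fix s assume s: "s \<in> {a..b}"
      have "(\<phi> has_vector_derivative w' s - w' x) (at s)"
        unfolding \<phi>_def by (auto intro!: derivative_eq_intros d1[OF s])
      then show "(\<phi> has_derivative (\<lambda>u. u *\<^sub>R (w' s - w' x))) (at s within {a..b})"
        unfolding has_vector_derivative_def by (rule has_derivative_at_withinI)
      have "norm (u *\<^sub>R (w' s - w' x)) \<le> m * norm u" for u :: real
        using mult_left_mono[OF slope'[OF x s], of "norm u"] by (simp add: mult.commute)
      then show "onorm (\<lambda>u. u *\<^sub>R (w' s - w' x)) \<le> m" by (rule onorm_le)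
    qed (use zy in auto)
    also have "m * norm (y - z) = m * (y - z)" using zy(3) by simp
    finally have b1: "norm (\<phi> y - \<phi> z) \<le> m * (y - z)" .
    have "(y - z) *\<^sub>R w' x = w y - w z - (\<phi> y - \<phi> z)" by (simp add: \<phi>_def algebra_simps)
    then have "norm ((y - z) *\<^sub>R w' x) \<le> norm (w y) + norm (w z) + m * (y - z)"
      using b1 norm_triangle_ineq4[of "w y - w z" "\<phi> y - \<phi> z"] norm_triangle_ineq4[of "w y" "w z"] by simp
    moreover have "norm ((y - z) *\<^sub>R w' x) = (y - z) * norm (w' x)" using zy(3) by simp
    ultimately have "(y - z) * norm (w' x) \<le> norm (w y) + norm (w z) + m * (y - z)" by (simp only:)
    moreover have "(y - z) * (norm (w' x) - m) = (y - z) * norm (w' x) - m * (y - z)"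
      by (simp add: algebra_simps)
    ultimately have b2: "(y - z) * (norm (w' x) - m) \<le> norm (w y) + norm (w z)" by linarith
    have "norm (w' x) - m \<le> 6 * norm (w y) + 6 * norm (w z)"
    proof (cases "norm (w' x) - m \<le> 0")
      case True
      then show ?thesis by (smt (verit) norm_ge_zero)
    next
      case False
      then have "1 / 6 * (norm (w' x) - m) \<le> (y - z) * (norm (w' x) - m)"
        using zy(3) by (intro mult_right_mono) auto
      then have "1 / 6 * (norm (w' x) - m) \<le> norm (w y) + norm (w z)" using b2 by (rule order_trans)
      then show ?thesis by (simp add: field_simps)
    qed
    then have "norm (w' x) \<le> 6 * norm (w y) + 6 * norm (w z) + m" by simp
    then have "(norm (w' x))\<^sup>2 \<le> (6 * norm (w y) + 6 * norm (w z) + m)\<^sup>2" by (intro power_mono) auto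
    also have "\<dots> \<le> 3 * (6 * norm (w y))\<^sup>2 + 3 * (6 * norm (w z))\<^sup>2 + 3 * m\<^sup>2" by (rule sq3)
    \<comment> \<open>The square of \<open>6 * norm (w y)\<close> is at most \<open>216 * N\<close>, so the sum is at most \<open>1296 * N + 3 * N2\<close>.\<close>
    also have "\<dots> \<le> 1300 * (N + N2)" using y(2) z(2) mN2 Nnn by (simp add: power_mult_distrib)
    finally show ?thesis .
  qed
  have I: "I = N + N2" by (simp add: I_def N_def N2_def)
  show "(norm (w' x))\<^sup>2 \<le> 3000 * I" using d[OF x] Nnn unfolding I by simp
  define R where "R = sqrt (1300 * (N + N2))"
  have R2: "R\<^sup>2 = 1300 * (N + N2)" using Nnn by (simp add: R_def)
  have "norm (w x - w y) \<le> R * norm (x - y)"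
  proof (rule differentiable_bound[where S="{a..b}"])
    fix s assume s: "s \<in> {a..b}"
    show "(w has_derivative (\<lambda>u. u *\<^sub>R w' s)) (at s within {a..b})"
      using d1[OF s] unfolding has_vector_derivative_def by (rule has_derivative_at_withinI)
    have "norm (w' s) \<le> R" using d[OF s] unfolding R_def by (rule real_le_rsqrt)
    then have "norm (u *\<^sub>R w' s) \<le> R * norm u" for u :: real
      using mult_left_mono[of "norm (w' s)" R "norm u"] by (simp add: mult.commute)
    then show "onorm (\<lambda>u. u *\<^sub>R w' s) \<le> R" by (rule onorm_le)
  qed (use x zy in auto)
  also have "\<dots> \<le> R * 1" using x zy ab Nnn by (intro mult_left_mono) (auto simp: R_def)
  finally have "norm (w x) \<le> norm (w y) + R + 0" using norm_triangle_sub[of "w x" "w y"] by simp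
  then have "(norm (w x))\<^sup>2 \<le> (norm (w y) + R + 0)\<^sup>2" by (intro power_mono) auto
  also have "\<dots> \<le> 2 * (norm (w y))\<^sup>2 + 2 * R\<^sup>2"
    using abs_2_inner_le[of "norm (w y)" R] by (simp add: power2_sum)
  also have "\<dots> \<le> 3000 * I" using y(2) R2 Nnn unfolding I by simp
  finally show "(norm (w x))\<^sup>2 \<le> 3000 * I" .
qed

section \<open>The energy inequality\<close>

abbreviation dx :: "(real \<times> real \<Rightarrow> complex) \<Rightarrow> real \<times> real \<Rightarrow> complex" where
  "dx \<equiv> pd (1, 0)"

abbreviation dt :: "(real \<times> real \<Rightarrow> complex) \<Rightarrow> real \<times> real \<Rightarrow> complex" where
  "dt \<equiv> pd (0, 1)"

lemma smooth_dx: "smooth_fun_on (X_dom T) f \<Longrightarrow> smooth_fun_on (X_dom T) (dx f)"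
  and smooth_dt: "smooth_fun_on (X_dom T) f \<Longrightarrow> smooth_fun_on (X_dom T) (dt f)"
  by (rule smooth_pd, simp_all add: Basis_real_prod)+

lemma dx_dt: "smooth_fun_on (X_dom T) f \<Longrightarrow> z \<in> X_dom T \<Longrightarrow> dt (dx f) z = dx (dt f) z"
  by (rule smooth_pd_commute[OF open_X_dom]) (auto simp: Basis_real_prod)

lemma dxx_dt:
  assumes "smooth_fun_on (X_dom T) f" "z \<in> X_dom T"
  shows "dt (dx (dx f)) z = dx (dx (dt f)) z"
proof -
  have "dt (dx (dx f)) z = dx (dt (dx f)) z" by (rule dx_dt[OF smooth_dx[OF assms(1)] assms(2)])
  also have "\<dots> = dx (dx (dt f)) z" by (rule pd_cong[OF open_X_dom assms(2)]) (rule dx_dt[OF assms(1)])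
  finally show ?thesis .
qed

lemma smooth_continuous: "smooth_fun_on (X_dom T) f \<Longrightarrow> continuous_on (X_dom T) f"
  using smooth_continuous_on[OF open_X_dom, of T f "[]"] by simp

lemma has_vector_derivative_inner:
  assumes "(f has_vector_derivative f') (at x)" "(g has_vector_derivative g') (at x)"
  shows "((\<lambda>x. f x \<bullet> g x) has_vector_derivative (f x \<bullet> g' + f' \<bullet> g x)) (at x)"
  using bounded_bilinear.has_vector_derivative[OF bounded_bilinear_inner assms] .

text \<open>The function \<open>exp (- \<Lambda> * (r - s)) * E r - G * (r - s)\<close> of \<open>r\<close> does not increase.\<close>

lemma gronwall:
  fixes E E' :: "real \<Rightarrow> real"
  assumes "s \<le> t" and d: "\<And>r. s \<le> r \<Longrightarrow> r \<le> t \<Longrightarrow> (E has_real_derivative E' r) (at r)"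
    and b: "\<And>r. s \<le> r \<Longrightarrow> r \<le> t \<Longrightarrow> E' r \<le> \<Lambda> * E r + G" and "0 \<le> G" "0 \<le> \<Lambda>"
  shows "E t \<le> exp (\<Lambda> * (t - s)) * (E s + (t - s) * G)"
proof -
  define F where "F r = exp (- \<Lambda> * (r - s)) * E r - G * (r - s)" for r
  have "F t \<le> F s"
  proof (rule DERIV_nonpos_imp_nonincreasing[OF assms(1)])
    fix r assume r: "s \<le> r" "r \<le> t"
    let ?k = "exp (- \<Lambda> * (r - s))"
    have "(F has_real_derivative ?k * E' r + (?k * (- \<Lambda>)) * E r - G) (at r)"
      unfolding F_def by (rule derivative_eq_intros d[OF r] refl | simp)+
    moreover have "?k * (E' r - \<Lambda> * E r) \<le> ?k * G" using b[OF r] by (intro mult_left_mono) auto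
    moreover have "?k * G \<le> 1 * G" using assms(4,5) r by (intro mult_right_mono) auto
    ultimately show "\<exists>y. (F has_real_derivative y) (at r) \<and> y \<le> 0"
      by (intro exI[of _ "?k * E' r + (?k * (- \<Lambda>)) * E r - G"]) (auto simp: algebra_simps)
  qed
  then have "exp (- \<Lambda> * (t - s)) * E t \<le> E s + (t - s) * G" by (simp add: F_def algebra_simps)
  then have "exp (\<Lambda> * (t - s)) * (exp (- \<Lambda> * (t - s)) * E t) \<le> exp (\<Lambda> * (t - s)) * (E s + (t - s) * G)"
    by (intro mult_left_mono) auto
  then show ?thesis by (simp add: mult.assoc[symmetric] flip: exp_add)
qed

text \<open>The equation is multiplied by \<open>2 * dt v\<close> and integrated over the space interval.  Two integrations by
  parts turn the term of highest order into the time derivative of the elastic energy, up to boundary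
  terms, which \<open>G\<close> absorbs.  The term with \<open>b\<close> is bounded by \<open>B * (1 + 1 / c0)\<close> times the energy.  The
  summand \<open>(norm v)\<^sup>2\<close> belongs to the energy in order to control \<open>v\<close> as well.\<close>

lemma energy_inequality:
  fixes v W b H :: "real \<times> real \<Rightarrow> complex" and \<kappa> :: "real \<Rightarrow> real"
  assumes v: "smooth_fun_on (X_dom T) v" and W: "smooth_fun_on (X_dom T) W"
    and Wv: "\<And>z. z \<in> X_dom T \<Longrightarrow> W z = \<kappa> (fst z) *\<^sub>R dx (dx v) z"
    and \<kappa>: "continuous_on I01 \<kappa>" "0 < c0" "\<And>x. x \<in> I01 \<Longrightarrow> c0 \<le> \<kappa> x"
    and eq: "\<And>z. z \<in> X_dom T \<Longrightarrow> dt (dt v) z + dx (dx W) z + b z * dx (dx v) z = H z"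
    and H: "continuous_on (X_dom T) H"
    and b: "\<And>z. z \<in> X_dom T \<Longrightarrow> norm (b z) \<le> B"
    and a: "0 < a1" "a1 < a2" "a2 < 1" and s: "0 < s" "s \<le> t" "t < T"
    and G: "\<And>r. s \<le> r \<Longrightarrow> r \<le> t \<Longrightarrow> integral {a1..a2} (\<lambda>x. (norm (H (x, r)))\<^sup>2)
      + 2 * (norm (dx W (a1, r)) * norm (dt v (a1, r)) + norm (W (a1, r)) * norm (dx (dt v) (a1, r)))
      + 2 * (norm (dx W (a2, r)) * norm (dt v (a2, r)) + norm (W (a2, r)) * norm (dx (dt v) (a2, r))) \<le> G"
  defines "E \<equiv> \<lambda>r. integral {a1..a2} (\<lambda>x. (norm (dt v (x, r)))\<^sup>2 + \<kappa> x * (norm (dx (dx v) (x, r)))\<^sup>2 + (norm (v (x, r)))\<^sup>2)"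
  shows "E t \<le> exp ((2 + B * (1 + 1 / c0)) * (t - s)) * (E s + (t - s) * G)"
proof -
  let ?X = "X_dom T" and ?\<Lambda> = "2 + B * (1 + 1 / c0)"
  note sm = v smooth_dt[OF v] smooth_dt[OF smooth_dt[OF v]] smooth_dx[OF smooth_dx[OF v]]
    smooth_dt[OF smooth_dx[OF smooth_dx[OF v]]] smooth_dx[OF smooth_dt[OF v]]
    smooth_dx[OF smooth_dx[OF smooth_dt[OF v]]] W smooth_dx[OF W] smooth_dx[OF smooth_dx[OF W]]
  note smc = sm[THEN smooth_continuous]
  have sub: "{a1..a2} \<subseteq> I01" using a by auto
  have inX: "(x, r) \<in> ?X" if "x \<in> {a1..a2}" "r \<in> {0<..<T}" for x r
    using that sub by (auto simp: X_dom_def)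
  have B: "0 \<le> B"
    using b[OF inX[of a1 t]] a s by (auto intro: order_trans[OF norm_ge_zero])
  have c\<kappa>: "continuous_on {a1..a2} \<kappa>" using \<kappa>(1) sub by (rule continuous_on_subset)
  have cx: "continuous_on {a1..a2} (\<lambda>x. f (x, r))" if "continuous_on ?X f" "r \<in> {0<..<T}"
    for f :: "real \<times> real \<Rightarrow> complex" and r
    using inX that(2) by (intro continuous_on_compose2[OF that(1)] continuous_intros) auto
  have crx: "continuous_on ({0<..<T} \<times> cbox a1 a2) (\<lambda>(r, x). f (x, r))" if "continuous_on ?X f"
    for f :: "real \<times> real \<Rightarrow> complex"
    unfolding case_prod_beta using inX by (intro continuous_on_compose2[OF that] continuous_intros) auto
  define e where "e r x = (norm (dt v (x, r)))\<^sup>2 + \<kappa> x * (norm (dx (dx v) (x, r)))\<^sup>2 + (norm (v (x, r)))\<^sup>2" for r x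
  define e' where "e' r x = 2 * (dt v (x, r) \<bullet> dt (dt v) (x, r))
      + \<kappa> x * (2 * (dx (dx v) (x, r) \<bullet> dt (dx (dx v)) (x, r))) + 2 * (v (x, r) \<bullet> dt v (x, r))" for r x
  have ce: "continuous_on {a1..a2} (e r)" if "r \<in> {0<..<T}" for r
    unfolding e_def by (intro continuous_intros c\<kappa> cx[OF _ that] smc)
  have ce': "continuous_on {a1..a2} (e' r)" if "r \<in> {0<..<T}" for r
    unfolding e'_def by (intro continuous_intros c\<kappa> cx[OF _ that] smc)
  have ce'2: "continuous_on ({0<..<T} \<times> cbox a1 a2) (\<lambda>(r, x). e' r x)"
  proof -
    have "continuous_on ({0<..<T} \<times> cbox a1 a2) (\<lambda>(r, x). \<kappa> x)"
      unfolding case_prod_beta by (intro continuous_on_compose2[OF c\<kappa>] continuous_intros) auto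
    then show ?thesis
      unfolding e'_def case_prod_beta
      by (intro continuous_intros crx[unfolded case_prod_beta] smc) (simp_all add: case_prod_beta)
  qed
  have dE: "(E has_real_derivative integral {a1..a2} (e' r)) (at r)" if r: "r \<in> {0<..<T}" for r
  proof -
    have "((\<lambda>r. integral (cbox a1 a2) (e r)) has_vector_derivative integral (cbox a1 a2) (e' r)) (at r within {0<..<T})"
    proof (rule leibniz_rule_vector_derivative[OF _ _ ce'2 r])
      fix q x assume q: "q \<in> {0<..<T}" and x: "x \<in> cbox a1 a2"
      have d: "((\<lambda>q. f (x, q)) has_vector_derivative dt f (x, q)) (at q)" if "smooth_fun_on ?X f" for f
        using X_dom_line_derivative(2)[OF that] inX q x by simp
      have "((\<lambda>q. e q x) has_real_derivative e' q x) (at q)"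
        unfolding e_def e'_def
        by (intro DERIV_add DERIV_cmult has_real_derivative_norm_square d sm)
      then show "((\<lambda>q. e q x) has_vector_derivative e' q x) (at q within {0<..<T})"
        using has_real_derivative_iff_has_vector_derivative has_vector_derivative_at_within by blast
    next
      show "e q integrable_on cbox a1 a2" if "q \<in> {0<..<T}" for q
        using ce[OF that] by (simp add: integrable_continuous_real)
    qed simp
    moreover have "(\<lambda>r. integral (cbox a1 a2) (e r)) = E" by (simp add: E_def e_def[abs_def])
    ultimately show ?thesis
      using r by (simp add: has_real_derivative_iff_has_vector_derivative at_within_open[of r "{0<..<T}"])
  qed
  have ineq: "integral {a1..a2} (e' r) \<le> ?\<Lambda> * E r + G" if r: "s \<le> r" "r \<le> t" for r
  proof -
    have r0: "r \<in> {0<..<T}" using r s by auto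
    define D where "D x = dx (dx W) (x, r) \<bullet> dt v (x, r) - W (x, r) \<bullet> dx (dx (dt v)) (x, r)" for x
    define S where "S x = dx W (x, r) \<bullet> dt v (x, r) - W (x, r) \<bullet> dx (dt v) (x, r)" for x
    have cD: "continuous_on {a1..a2} D"
      unfolding D_def by (intro continuous_intros cx[OF _ r0] smc)
    have cH: "continuous_on {a1..a2} (\<lambda>x. (norm (H (x, r)))\<^sup>2)"
      by (intro continuous_intros cx[OF H r0])
    \<comment> \<open>The integral of \<open>D\<close> consists of boundary terms: \<open>dx (dx W)\<close> is moved to \<open>dt v\<close> by parts.\<close>
    have "(D has_integral (S a2 - S a1)) {a1..a2}"
    proof (rule fundamental_theorem_of_calculus)
      fix x assume x: "x \<in> {a1..a2}"
      have d: "((\<lambda>x. f (x, r)) has_vector_derivative dx f (x, r)) (at x)" if "smooth_fun_on ?X f" for f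
        using X_dom_line_derivative(1)[OF that] inX r0 x by simp
      have "(S has_vector_derivative D x) (at x)"
        unfolding S_def D_def
        using has_vector_derivative_diff[OF has_vector_derivative_inner[OF d[OF sm(9)] d[OF sm(2)]]
            has_vector_derivative_inner[OF d[OF sm(8)] d[OF sm(6)]]] by simp
      then show "(S has_vector_derivative D x) (at x within {a1..a2})"
        by (rule has_vector_derivative_at_within)
    qed (use a in simp)
    then have iD: "integral {a1..a2} D = S a2 - S a1" by (rule integral_unique)
    have "integral {a1..a2} (e' r) + 2 * integral {a1..a2} D = integral {a1..a2} (\<lambda>x. e' r x + 2 * D x)"
      using ce'[OF r0] cD by (subst integral_add) (auto intro!: integrable_continuous_real continuous_intros)
    also have "\<dots> \<le> integral {a1..a2} (\<lambda>x. (norm (H (x, r)))\<^sup>2 + ?\<Lambda> * e r x)"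
    proof (intro integral_le integrable_continuous_real continuous_intros ce'[OF r0] cD cx[OF H r0] ce[OF r0])
      fix x assume x: "x \<in> {a1..a2}"
      note z = inX[OF x r0]
      have x01: "x \<in> I01" using x sub by auto
      let ?p = "dt v (x, r)" and ?q = "dx (dx v) (x, r)" and ?w = "v (x, r)"
      have k: "c0 \<le> \<kappa> x" "0 \<le> \<kappa> x" using \<kappa>(2) \<kappa>(3)[OF x01] by auto
      have tt: "dt (dt v) (x, r) = H (x, r) - dx (dx W) (x, r) - b (x, r) * ?q"
        using eq[OF z] by (simp add: algebra_simps)
      have "e' r x + 2 * D x = 2 * (?p \<bullet> H (x, r)) - 2 * (?p \<bullet> (b (x, r) * ?q)) + 2 * (?w \<bullet> ?p)"
        unfolding e'_def D_def tt using Wv[OF z] dxx_dt[OF v z]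
        by (simp add: inner_diff_right inner_commute algebra_simps)
      moreover have "2 * (?p \<bullet> H (x, r)) \<le> (norm ?p)\<^sup>2 + (norm (H (x, r)))\<^sup>2"
        using abs_2_inner_le[of ?p "H (x, r)"] by simp
      moreover have "2 * (?w \<bullet> ?p) \<le> (norm ?w)\<^sup>2 + (norm ?p)\<^sup>2"
        using abs_2_inner_le[of ?w ?p] by simp
      moreover have "- (2 * (?p \<bullet> (b (x, r) * ?q))) \<le> B * ((norm ?p)\<^sup>2 + (norm ?q)\<^sup>2)"
      proof -
        have "- (?p \<bullet> (b (x, r) * ?q)) \<le> norm ?p * norm (b (x, r) * ?q)"
          using norm_cauchy_schwarz[of "- ?p" "b (x, r) * ?q"] by simp
        also have "\<dots> \<le> norm ?p * (B * norm ?q)"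
          using b[OF z] by (intro mult_left_mono) (auto simp: norm_mult intro: mult_right_mono)
        finally have "- (?p \<bullet> (b (x, r) * ?q)) \<le> norm ?p * (B * norm ?q)" .
        moreover have "B * (2 * norm ?p * norm ?q) = 2 * (norm ?p * (B * norm ?q))" by (simp only: mult_ac)
        ultimately have 1: "- (2 * (?p \<bullet> (b (x, r) * ?q))) \<le> B * (2 * norm ?p * norm ?q)" by linarith
        have "2 * norm ?p * norm ?q \<le> (norm ?p)\<^sup>2 + (norm ?q)\<^sup>2" by (rule sum_squares_bound)
        then have "B * (2 * norm ?p * norm ?q) \<le> B * ((norm ?p)\<^sup>2 + (norm ?q)\<^sup>2)"
          using B by (rule mult_left_mono)
        with 1 show ?thesis by (rule order_trans)
      qed
      moreover have "B * ((norm ?p)\<^sup>2 + (norm ?q)\<^sup>2) \<le> B * ((1 + 1 / c0) * e r x)"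
      proof (intro mult_left_mono B)
        have "(norm ?q)\<^sup>2 \<le> 1 / c0 * (\<kappa> x * (norm ?q)\<^sup>2)"
          using k(1) \<kappa>(2) mult_right_mono[of c0 "\<kappa> x" "(norm ?q)\<^sup>2"] by (simp add: field_simps)
        also have "\<dots> \<le> 1 / c0 * e r x" using \<kappa>(2) by (intro mult_left_mono) (auto simp: e_def)
        finally have "(norm ?q)\<^sup>2 \<le> 1 / c0 * e r x" .
        moreover have "(norm ?p)\<^sup>2 \<le> e r x" using k(2) by (simp add: e_def)
        moreover have "(1 + 1 / c0) * e r x = e r x + 1 / c0 * e r x" by (simp add: distrib_right)
        ultimately show "(norm ?p)\<^sup>2 + (norm ?q)\<^sup>2 \<le> (1 + 1 / c0) * e r x" by linarith
      qed
      moreover have "(norm ?w)\<^sup>2 + 2 * (norm ?p)\<^sup>2 \<le> 2 * e r x" using k(2) by (simp add: e_def)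
      ultimately have "e' r x + 2 * D x \<le> (norm (H (x, r)))\<^sup>2 + 2 * e r x + B * ((1 + 1 / c0) * e r x)" by linarith
      then show "e' r x + 2 * D x \<le> (norm (H (x, r)))\<^sup>2 + ?\<Lambda> * e r x" by (simp add: algebra_simps)
    qed
    also have "\<dots> = integral {a1..a2} (\<lambda>x. (norm (H (x, r)))\<^sup>2) + ?\<Lambda> * E r"
      unfolding E_def e_def[symmetric] using ce[OF r0] cH
      by (subst integral_add) (auto intro!: integrable_continuous_real continuous_intros)
    finally have 1: "integral {a1..a2} (e' r) + 2 * (S a2 - S a1) \<le>
        integral {a1..a2} (\<lambda>x. (norm (H (x, r)))\<^sup>2) + ?\<Lambda> * E r"
      unfolding iD .
    have arith: "i \<le> y + g" if "i + 2 * (s2 - s1) \<le> h + y" "\<bar>s1\<bar> \<le> t1" "\<bar>s2\<bar> \<le> t2" "h + 2 * t1 + 2 * t2 \<le> g"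
      for i s1 s2 t1 t2 h y g :: real
      using that by (simp add: abs_le_iff)
    have "\<bar>S x\<bar> \<le> norm (dx W (x, r)) * norm (dt v (x, r)) + norm (W (x, r)) * norm (dx (dt v) (x, r))" for x
      using Cauchy_Schwarz_ineq2[of "dx W (x, r)" "dt v (x, r)"]
        Cauchy_Schwarz_ineq2[of "W (x, r)" "dx (dt v) (x, r)"] unfolding S_def by linarith
    from arith[OF 1 this[of a1] this[of a2] G[OF r]] show ?thesis .
  qed
  show ?thesis
  proof (rule gronwall[OF s(2) dE ineq])
    have "0 \<le> integral {a1..a2} (\<lambda>x. (norm (H (x, s)))\<^sup>2)"
      using s by (intro Henstock_Kurzweil_Integration.integral_nonneg integrable_continuous_real continuous_intros cx[OF H]) auto
    then show "0 \<le> G" using G[of s] s by (smt (verit) mult_nonneg_nonneg norm_ge_zero)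
    show "0 \<le> ?\<Lambda>" using B \<kappa>(2) by simp
  qed (use s in auto)
qed

section \<open>Regularity estimates for the beam equation\<close>

lemma sum_list_splits:
  fixes F :: "'a list \<times> 'a list \<Rightarrow> complex"
  shows "(\<Sum>p\<leftarrow>splits \<alpha>. F p) = F ([], \<alpha>) + (\<Sum>p\<leftarrow>filter (\<lambda>p. length (snd p) < length \<alpha>) (splits \<alpha>). F p)"
proof (induction \<alpha> arbitrary: F)
  case (Cons i \<alpha>)
  let ?A = "\<lambda>(\<beta>, \<gamma>). (i # \<beta>, \<gamma>)" and ?B = "\<lambda>(\<beta>, \<gamma>). (\<beta>, i # \<gamma>)"
  have le: "length (snd p) \<le> length \<alpha>" if "p \<in> set (splits \<alpha>)" for p
  proof -
    have "mset (fst p) + mset (snd p) = mset \<alpha>" using splits_mset[of "fst p" "snd p" \<alpha>] that by simp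
    then have "size (mset (snd p)) \<le> size (mset \<alpha>)" by (metis le_add2 size_union)
    then show ?thesis by simp
  qed
  have 1: "filter (\<lambda>p. length (snd p) < length (i # \<alpha>)) (map ?A (splits \<alpha>)) = map ?A (splits \<alpha>)"
    using le by (auto simp: filter_id_conv less_Suc_eq_le)
  have 2: "filter (\<lambda>p. length (snd p) < length (i # \<alpha>)) (map ?B (splits \<alpha>))
      = map ?B (filter (\<lambda>p. length (snd p) < length \<alpha>) (splits \<alpha>))"
    by (simp add: filter_map comp_def case_prod_beta)
  show ?case
    using Cons.IH[of "\<lambda>p. F (?B p)"] unfolding splits.simps filter_append 1 2
    by (simp add: comp_def)
qed simp

text \<open>In the sum that remains the second factor is differentiated fewer times, which allows inductions on
  the number of derivatives.\<close>

lemma multi_pd_mult_commutator: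
  assumes "open \<Omega>" "smooth_fun_on \<Omega> f" "smooth_fun_on \<Omega> g" "\<alpha> \<in> lists Basis" "x \<in> \<Omega>"
  shows "multi_pd \<alpha> (\<lambda>x. f x * g x) x = f x * multi_pd \<alpha> g x +
    (\<Sum>(\<beta>, \<gamma>)\<leftarrow>filter (\<lambda>p. length (snd p) < length \<alpha>) (splits \<alpha>). multi_pd \<beta> f x * multi_pd \<gamma> g x)"
  unfolding multi_pd_mult[OF assms] by (subst sum_list_splits) simp

lemma growth_multi_pd_diff:
  assumes \<Omega>: "open \<Omega>"
    and f: "\<And>\<epsilon>. 0 < \<epsilon> \<Longrightarrow> \<epsilon> \<le> 1 \<Longrightarrow> smooth_fun_on \<Omega> (f \<epsilon>)" and g: "\<And>\<epsilon>. 0 < \<epsilon> \<Longrightarrow> \<epsilon> \<le> 1 \<Longrightarrow> smooth_fun_on \<Omega> (g \<epsilon>)"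
    and S: "\<And>\<epsilon>. 0 < \<epsilon> \<Longrightarrow> \<epsilon> \<le> 1 \<Longrightarrow> S \<epsilon> \<subseteq> \<Omega>" and \<alpha>: "\<alpha> \<in> lists Basis"
    and "growth S P (\<lambda>\<epsilon>. multi_pd \<alpha> (f \<epsilon>))" "growth S P (\<lambda>\<epsilon>. multi_pd \<alpha> (g \<epsilon>))"
  shows "growth S P (\<lambda>\<epsilon>. multi_pd \<alpha> (\<lambda>x. f \<epsilon> x - g \<epsilon> x))"
  by (rule growth_cong[OF growth_diff[OF assms(6,7)]])
    (use S in \<open>auto intro!: multi_pd_diff[OF \<Omega> f g \<alpha>]\<close>)

lemma growth_multi_pd_perm:
  assumes \<Omega>: "open \<Omega>" and f: "\<And>\<epsilon>. 0 < \<epsilon> \<Longrightarrow> \<epsilon> \<le> 1 \<Longrightarrow> smooth_fun_on \<Omega> (f \<epsilon>)"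
    and S: "\<And>\<epsilon>. 0 < \<epsilon> \<Longrightarrow> \<epsilon> \<le> 1 \<Longrightarrow> S \<epsilon> \<subseteq> \<Omega>"
    and m: "mset \<alpha> = mset \<beta>" and \<alpha>: "\<alpha> \<in> lists Basis" and g: "growth S P (\<lambda>\<epsilon>. multi_pd \<alpha> (f \<epsilon>))"
  shows "growth S P (\<lambda>\<epsilon>. multi_pd \<beta> (f \<epsilon>))"
  by (rule growth_cong[OF g]) (use S in \<open>auto intro!: multi_pd_perm[OF \<Omega> f m \<alpha>, symmetric]\<close>)

lemma growth_multi_pd_cong:
  assumes \<Omega>: "open \<Omega>" and S: "\<And>\<epsilon>. 0 < \<epsilon> \<Longrightarrow> \<epsilon> \<le> 1 \<Longrightarrow> S \<epsilon> \<subseteq> \<Omega>"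
    and g: "growth S P (\<lambda>\<epsilon>. multi_pd \<alpha> (f \<epsilon>))"
    and e: "\<And>\<epsilon> x. 0 < \<epsilon> \<Longrightarrow> \<epsilon> \<le> 1 \<Longrightarrow> x \<in> \<Omega> \<Longrightarrow> g \<epsilon> x = f \<epsilon> x"
  shows "growth S P (\<lambda>\<epsilon>. multi_pd \<alpha> (g \<epsilon>))"
  by (rule growth_cong[OF g]) (use S in \<open>auto intro!: multi_pd_cong[OF \<Omega> e]\<close>)

text \<open>In the Leibniz formula for \<open>f * w\<close> the leading term is \<open>f\<close> times the derivative in question, and the
  other terms contain fewer derivatives of \<open>w\<close>; the induction is on their number.\<close>

lemma growth_multi_pd_divide:
  fixes f w :: "'a::euclidean_space family"
  assumes \<Omega>: "open \<Omega>"
    and f: "\<And>\<epsilon>. 0 < \<epsilon> \<Longrightarrow> \<epsilon> \<le> 1 \<Longrightarrow> smooth_fun_on \<Omega> (f \<epsilon>)" and w: "\<And>\<epsilon>. 0 < \<epsilon> \<Longrightarrow> \<epsilon> \<le> 1 \<Longrightarrow> smooth_fun_on \<Omega> (w \<epsilon>)"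
    and S: "\<And>\<epsilon>. 0 < \<epsilon> \<Longrightarrow> \<epsilon> \<le> 1 \<Longrightarrow> S \<epsilon> \<subseteq> \<Omega>"
    and gf: "\<And>\<alpha>. \<alpha> \<in> lists Basis \<Longrightarrow> growth S 0 (\<lambda>\<epsilon>. multi_pd \<alpha> (f \<epsilon>))"
    and c0: "0 < c0" "\<And>\<epsilon> x. 0 < \<epsilon> \<Longrightarrow> \<epsilon> \<le> 1 \<Longrightarrow> x \<in> \<Omega> \<Longrightarrow> c0 \<le> norm (f \<epsilon> x)"
    and fw: "\<And>\<alpha>. \<alpha> \<in> lists Basis \<Longrightarrow> D \<alpha> \<Longrightarrow> growth S P (\<lambda>\<epsilon>. multi_pd \<alpha> (\<lambda>x. f \<epsilon> x * w \<epsilon> x))"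
    and D: "\<And>\<alpha> \<beta>. D \<alpha> \<Longrightarrow> mset \<beta> \<subseteq># mset \<alpha> \<Longrightarrow> D \<beta>"
  shows "\<alpha> \<in> lists Basis \<Longrightarrow> D \<alpha> \<Longrightarrow> growth S P (\<lambda>\<epsilon>. multi_pd \<alpha> (w \<epsilon>))"
proof (induction "length \<alpha>" arbitrary: \<alpha> rule: less_induct)
  case less
  note \<alpha> = less.prems
  let ?L = "filter (\<lambda>p. length (snd p) < length \<alpha>) (splits \<alpha>)"
  let ?R = "\<lambda>\<epsilon> x. \<Sum>p\<leftarrow>?L. (case p of (\<beta>, \<gamma>) \<Rightarrow> \<lambda>\<epsilon> x. multi_pd \<beta> (f \<epsilon>) x * multi_pd \<gamma> (w \<epsilon>) x) \<epsilon> x"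
  have "growth S P ?R"
  proof (rule growth_sum_list)
    fix p assume p: "p \<in> set ?L"
    obtain \<beta> \<gamma> where [simp]: "p = (\<beta>, \<gamma>)" by (cases p)
    have p': "(\<beta>, \<gamma>) \<in> set (splits \<alpha>)" "length \<gamma> < length \<alpha>" using p by auto
    have \<beta>\<gamma>: "\<beta> \<in> lists Basis" "\<gamma> \<in> lists Basis" using splits_lists[OF p'(1)] \<alpha> by auto
    have "mset \<gamma> \<subseteq># mset \<alpha>" using splits_mset[OF p'(1)] by (metis mset_subset_eq_add_right)
    then have "growth S P (\<lambda>\<epsilon>. multi_pd \<gamma> (w \<epsilon>))" using less.hyps[OF p'(2) \<beta>\<gamma>(2)] D \<alpha> by blast
    then show "growth S P (case p of (\<beta>, \<gamma>) \<Rightarrow> \<lambda>\<epsilon> x. multi_pd \<beta> (f \<epsilon>) x * multi_pd \<gamma> (w \<epsilon>) x)"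
      using growth_mult[OF gf[OF \<beta>\<gamma>(1)]] by simp
  qed
  then have "growth S P (\<lambda>\<epsilon> x. multi_pd \<alpha> (\<lambda>x. f \<epsilon> x * w \<epsilon> x) x - ?R \<epsilon> x)"
    by (intro growth_diff fw \<alpha>)
  then have fa: "growth S P (\<lambda>\<epsilon> x. f \<epsilon> x * multi_pd \<alpha> (w \<epsilon>) x)"
  proof (rule growth_cong)
    fix \<epsilon> x assume \<epsilon>: "0 < \<epsilon>" "\<epsilon> \<le> 1" and x: "x \<in> S \<epsilon>"
    show "f \<epsilon> x * multi_pd \<alpha> (w \<epsilon>) x = multi_pd \<alpha> (\<lambda>x. f \<epsilon> x * w \<epsilon> x) x - ?R \<epsilon> x"
      using multi_pd_mult_commutator[OF \<Omega> f[OF \<epsilon>] w[OF \<epsilon>] \<alpha>(1), of x] S[OF \<epsilon>] x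
      by (auto simp: case_prod_beta')
  qed
  obtain m where m: "net_order P m" "\<forall>\<^sub>F \<epsilon> in at_right 0. \<forall>x\<in>S \<epsilon>. norm (f \<epsilon> x * multi_pd \<alpha> (w \<epsilon>) x) \<le> m \<epsilon>"
    using fa unfolding growth_def by blast
  show ?case
  proof (rule growthI[OF net_order_cmult[OF m(1), of "1 / c0"]])
    show "\<forall>\<^sub>F \<epsilon> in at_right 0. \<forall>x\<in>S \<epsilon>. norm (multi_pd \<alpha> (w \<epsilon>) x) \<le> 1 / c0 * m \<epsilon>"
      using m(2) eventually_unit
    proof eventually_elim
      case (elim \<epsilon>)
      show ?case
      proof
        fix x assume x: "x \<in> S \<epsilon>"
        have "c0 * norm (multi_pd \<alpha> (w \<epsilon>) x) \<le> norm (f \<epsilon> x) * norm (multi_pd \<alpha> (w \<epsilon>) x)"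
          using c0(2) S x elim by (intro mult_right_mono) auto
        also have "\<dots> \<le> m \<epsilon>" using elim x by (auto simp: norm_mult)
        finally show "norm (multi_pd \<alpha> (w \<epsilon>) x) \<le> 1 / c0 * m \<epsilon>"
          using c0(1) by (simp add: field_simps)
      qed
    qed
  qed
qed

lemma mset_eq_replicate_append:
  assumes "\<alpha> \<in> lists (Basis :: (real \<times> real) set)"
  shows "mset \<alpha> = mset (replicate (count (mset \<alpha>) (1, 0)) (1, 0) @ replicate (count (mset \<alpha>) (0, 1)) (0, 1))"
proof (rule multiset_eqI)
  fix i :: "real \<times> real"
  show "count (mset \<alpha>) i = count (mset (replicate (count (mset \<alpha>) (1, 0)) (1, 0) @ replicate (count (mset \<alpha>) (0, 1)) (0, 1))) i"
  proof (cases "i \<in> Basis")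
    case True
    then show ?thesis by (auto simp: Basis_real_prod)
  next
    case False
    then have "i \<notin> set \<alpha>" "i \<noteq> (1, 0)" "i \<noteq> (0, 1)"
      using assms by (auto simp: in_lists_conv_set Basis_real_prod)
    then show ?thesis by (simp add: count_eq_zero_iff not_in_iff[symmetric])
  qed
qed

text \<open>The family \<open>u\<close> solves the equation with right-hand side \<open>G\<close>.  The estimates take place at distance
  at least \<open>h \<epsilon>\<close> from the lateral sides and from the initial side, where everything is smooth; the
  initial and boundary data enter as estimates of \<open>u \<epsilon>\<close> on the lines at distance \<open>h \<epsilon>\<close>.\<close>

locale beam_family =
  fixes T P c0 :: real and u b C G :: "(real \<times> real) family" and \<kappa> :: "real \<Rightarrow> real \<Rightarrow> real"
    and r h :: "real \<Rightarrow> real"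
  assumes T: "T > 0"
    and mod_u: "u \<in> moderate (X_dom T)" and mod_b: "b \<in> moderate (X_dom T)" and mod_C: "C \<in> moderate (X_dom T)"
    and slow_b: "\<And>\<alpha>. \<alpha> \<in> lists Basis \<Longrightarrow> growth (\<lambda>_. X_dom T) 0 (\<lambda>\<epsilon>. multi_pd \<alpha> (b \<epsilon>))"
    and slow_C: "\<And>\<alpha>. \<alpha> \<in> lists Basis \<Longrightarrow> growth (\<lambda>_. X_dom T) 0 (\<lambda>\<epsilon>. multi_pd \<alpha> (C \<epsilon>))"
    and C_eq: "\<And>\<epsilon> z. 0 < \<epsilon> \<Longrightarrow> \<epsilon> \<le> 1 \<Longrightarrow> z \<in> X_dom T \<Longrightarrow> C \<epsilon> z = of_real (\<kappa> \<epsilon> (fst z))"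
    and c0: "0 < c0" and \<kappa>_ge: "\<And>\<epsilon> x. 0 < \<epsilon> \<Longrightarrow> \<epsilon> \<le> 1 \<Longrightarrow> x \<in> I01 \<Longrightarrow> c0 \<le> \<kappa> \<epsilon> x"
    and \<kappa>_cont: "\<And>\<epsilon>. 0 < \<epsilon> \<Longrightarrow> \<epsilon> \<le> 1 \<Longrightarrow> continuous_on I01 (\<kappa> \<epsilon>)"
    and b_le: "\<forall>\<^sub>F \<epsilon> in at_right 0. \<forall>z\<in>X_dom T. norm (b \<epsilon> z) \<le> ln (r \<epsilon>)"
    and slow_r: "net_order 0 r" and r_ge: "\<And>\<epsilon>. 0 < \<epsilon> \<Longrightarrow> \<epsilon> \<le> 1 \<Longrightarrow> 1 \<le> r \<epsilon>"
    and equation: "\<And>\<epsilon>. G \<epsilon> = (\<lambda>z. dt (dt (u \<epsilon>)) z + dx (dx (\<lambda>z. C \<epsilon> z * dx (dx (u \<epsilon>)) z)) z + b \<epsilon> z * dx (dx (u \<epsilon>)) z)"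
    and reg_G: "\<And>\<alpha>. \<alpha> \<in> lists Basis \<Longrightarrow> growth (\<lambda>_. X_dom T) P (\<lambda>\<epsilon>. multi_pd \<alpha> (G \<epsilon>))"
    and h: "\<And>\<epsilon>. 0 < \<epsilon> \<Longrightarrow> \<epsilon> \<le> 1 \<Longrightarrow> 0 < h \<epsilon> \<and> h \<epsilon> \<le> 1 / 4 \<and> h \<epsilon> < T" and null_h: "\<And>Q. net_order Q h"
    and initial0: "\<And>k. growth (\<lambda>\<epsilon>. (\<lambda>x. (x, h \<epsilon>)) ` I01) P (\<lambda>\<epsilon>. multi_pd (replicate k (1, 0)) (u \<epsilon>))"
    and initial1: "\<And>k. growth (\<lambda>\<epsilon>. (\<lambda>x. (x, h \<epsilon>)) ` I01) P (\<lambda>\<epsilon>. multi_pd (replicate k (1, 0)) (dt (u \<epsilon>)))"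
    and lateral0: "\<And>k Q. growth (\<lambda>\<epsilon>. {h \<epsilon>, 1 - h \<epsilon>} \<times> {0<..<T}) Q (\<lambda>\<epsilon>. multi_pd (replicate k (0, 1)) (u \<epsilon>))"
    and lateral1: "\<And>k Q. growth (\<lambda>\<epsilon>. {h \<epsilon>, 1 - h \<epsilon>} \<times> {0<..<T}) Q (\<lambda>\<epsilon>. multi_pd (replicate k (0, 1)) (dx (u \<epsilon>)))"
begin

abbreviation "X \<equiv> X_dom T"

lemma X_box: "sobolev_box X" by (rule sobolev_box_X_dom[OF T])

lemmas oX = open_X_dom[of T]

lemma sm_u: "0 < \<epsilon> \<Longrightarrow> \<epsilon> \<le> 1 \<Longrightarrow> smooth_fun_on X (u \<epsilon>)" by (rule moderateD(2)[OF X_box mod_u])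
lemma sm_b: "0 < \<epsilon> \<Longrightarrow> \<epsilon> \<le> 1 \<Longrightarrow> smooth_fun_on X (b \<epsilon>)" by (rule moderateD(2)[OF X_box mod_b])
lemma sm_C: "0 < \<epsilon> \<Longrightarrow> \<epsilon> \<le> 1 \<Longrightarrow> smooth_fun_on X (C \<epsilon>)" by (rule moderateD(2)[OF X_box mod_C])

definition W :: "(real \<times> real) family" where
  "W \<epsilon> = (\<lambda>z. C \<epsilon> z * dx (dx (u \<epsilon>)) z)"

lemma basis: "(1, 0) \<in> (Basis :: (real \<times> real) set)" "(0, 1) \<in> (Basis :: (real \<times> real) set)"
  by (auto simp: Basis_real_prod)

lemma reps: "replicate i (1, 0) @ replicate k (0, 1) \<in> lists (Basis :: (real \<times> real) set)"
  by (auto simp: in_lists_conv_set Basis_real_prod)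

lemma rep_t: "replicate k (0, 1) \<in> lists (Basis :: (real \<times> real) set)"
  and rep_x: "replicate k (1, 0) \<in> lists (Basis :: (real \<times> real) set)"
  by (auto simp: in_lists_conv_set Basis_real_prod)

lemma mod_W: "W \<in> moderate X"
  unfolding W_def[abs_def] using moderate_pd[OF X_box moderate_pd[OF X_box mod_u basis(1)] basis(1)]
  by (intro moderate_mult[OF X_box mod_C])

lemma sm_W: "0 < \<epsilon> \<Longrightarrow> \<epsilon> \<le> 1 \<Longrightarrow> smooth_fun_on X (W \<epsilon>)" by (rule moderateD(2)[OF X_box mod_W])

lemma G_eq: "G \<epsilon> = (\<lambda>z. dt (dt (u \<epsilon>)) z + dx (dx (W \<epsilon>)) z + b \<epsilon> z * dx (dx (u \<epsilon>)) z)"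
  unfolding equation W_def ..

lemma sm_G: "0 < \<epsilon> \<Longrightarrow> \<epsilon> \<le> 1 \<Longrightarrow> smooth_fun_on X (G \<epsilon>)"
  unfolding G_eq by (intro smooth_add[OF oX] smooth_mult[OF oX] smooth_dt smooth_dx sm_u sm_W sm_b)

lemma multi_pd_xx: "multi_pd \<alpha> (dx (dx f)) = multi_pd (\<alpha> @ [(1, 0), (1, 0)]) f"
  and multi_pd_tt: "multi_pd \<alpha> (dt (dt f)) = multi_pd (\<alpha> @ [(0, 1), (0, 1)]) f"
  by (simp_all add: multi_pd_append)

lemma count_mono: "mset \<beta> \<subseteq># mset \<alpha> \<Longrightarrow> count (mset \<beta>) i \<le> count (mset \<alpha>) i"
  by (rule mset_subset_eq_count)

subsection \<open>Initial data\<close>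

text \<open>The equation expresses two time derivatives by space derivatives, so that the space derivatives of
  \<open>u\<close> and \<open>dt u\<close> at the initial time control all derivatives there.\<close>

lemma growth_initial_aux:
  "\<alpha> \<in> lists Basis \<Longrightarrow> count (mset \<alpha>) (0, 1) \<le> Suc k \<Longrightarrow>
    growth (\<lambda>\<epsilon>. (\<lambda>x. (x, h \<epsilon>)) ` I01) P (\<lambda>\<epsilon>. multi_pd \<alpha> (u \<epsilon>))"
proof (induction k arbitrary: \<alpha>)
  let ?S = "\<lambda>\<epsilon>. (\<lambda>x. (x, h \<epsilon>)) ` I01"
  have S: "?S \<epsilon> \<subseteq> X" if "0 < \<epsilon>" "\<epsilon> \<le> 1" for \<epsilon>
    using h[OF that] by (auto simp: X_dom_def)
  have perm: "growth ?S P (\<lambda>\<epsilon>. multi_pd \<alpha> (u \<epsilon>))" if "mset \<beta> = mset \<alpha>" "\<beta> \<in> lists Basis"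
    "growth ?S P (\<lambda>\<epsilon>. multi_pd \<beta> (u \<epsilon>))" for \<alpha> \<beta>
    by (rule growth_multi_pd_perm[where S="?S" and f=u, OF oX _ _ that]) (use sm_u S in auto)
  {
    case 0
    let ?i = "count (mset \<alpha>) (1, 0)"
    have "count (mset \<alpha>) (0, 1) = 0 \<or> count (mset \<alpha>) (0, 1) = 1" using 0(2) by linarith
    then show ?case
    proof
      assume c: "count (mset \<alpha>) (0, 1) = 0"
      have "mset (replicate ?i (1, 0)) = mset \<alpha>" using mset_eq_replicate_append[OF 0(1)] unfolding c by simp
      then show ?thesis using initial0[of ?i] by (intro perm[OF _ rep_x]) auto
    next
      assume c: "count (mset \<alpha>) (0, 1) = 1"
      have m: "mset (replicate ?i (1, 0) @ [(0, 1)]) = mset \<alpha>"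
        using mset_eq_replicate_append[OF 0(1)] unfolding c by simp
      have "growth ?S P (\<lambda>\<epsilon>. multi_pd (replicate ?i (1, 0) @ [(0, 1)]) (u \<epsilon>))"
        using initial1[of ?i] by (simp add: multi_pd_append)
      then show ?thesis using reps[of ?i 1] by (intro perm[OF m]) auto
    qed
  next
    case (Suc k)
    show ?case
    proof (cases "count (mset \<alpha>) (0, 1) \<le> Suc k")
      case True
      then show ?thesis using Suc.IH Suc.prems by blast
    next
      case False
      let ?\<beta> = "replicate (count (mset \<alpha>) (1, 0)) (1, 0) @ replicate k (0, 1) :: (real \<times> real) list"
      have c: "count (mset \<alpha>) (0, 1) = Suc (Suc k)" using False Suc.prems by simp
      have m: "mset (?\<beta> @ [(0, 1), (0, 1)]) = mset \<alpha>"
        using mset_eq_replicate_append[OF Suc.prems(1)] unfolding c by (simp add: ac_simps)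
      let ?D = "\<lambda>\<gamma> :: (real \<times> real) list. count (mset \<gamma>) (0, 1) \<le> Suc k"
      have uxx: "growth ?S P (\<lambda>\<epsilon>. multi_pd \<gamma> (dx (dx (u \<epsilon>))))" if "\<gamma> \<in> lists Basis" "?D \<gamma>" for \<gamma>
        unfolding multi_pd_xx using that basis by (intro Suc.IH) auto
      have prod: "growth ?S P (\<lambda>\<epsilon>. multi_pd \<gamma> (\<lambda>z. f \<epsilon> z * dx (dx (u \<epsilon>)) z))"
        if f: "\<And>\<epsilon>. 0 < \<epsilon> \<Longrightarrow> \<epsilon> \<le> 1 \<Longrightarrow> smooth_fun_on X (f \<epsilon>)"
          "\<And>\<alpha>. \<alpha> \<in> lists Basis \<Longrightarrow> growth (\<lambda>_. X) 0 (\<lambda>\<epsilon>. multi_pd \<alpha> (f \<epsilon>))"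
          and \<gamma>: "\<gamma> \<in> lists Basis" "?D \<gamma>" for f \<gamma>
      proof -
        have f0: "growth ?S 0 (\<lambda>\<epsilon>. multi_pd \<alpha> (f \<epsilon>))" if "\<alpha> \<in> lists Basis" for \<alpha>
          using growth_subset[OF f(2)[OF that] S] .
        have "growth ?S (0 + P) (\<lambda>\<epsilon>. multi_pd \<gamma> (\<lambda>z. f \<epsilon> z * dx (dx (u \<epsilon>)) z))"
          by (rule growth_multi_pd_mult[where D="?D", OF oX f(1) smooth_dx[OF smooth_dx[OF sm_u]] S f0 uxx _ \<gamma>])
            (auto dest: count_mono[where i="(0, 1)"])
        then show ?thesis by simp
      qed
      have \<beta>: "?\<beta> \<in> lists Basis" "?D ?\<beta>" using reps by auto
      have wxx: "growth ?S P (\<lambda>\<epsilon>. multi_pd ?\<beta> (dx (dx (W \<epsilon>))))"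
        unfolding multi_pd_xx W_def using reps basis by (intro prod[OF sm_C slow_C]) auto
      have bxx: "growth ?S P (\<lambda>\<epsilon>. multi_pd ?\<beta> (\<lambda>z. b \<epsilon> z * dx (dx (u \<epsilon>)) z))"
        by (rule prod[OF sm_b slow_b \<beta>])
      have d: "growth ?S P (\<lambda>\<epsilon>. multi_pd ?\<beta> (\<lambda>z. G \<epsilon> z - dx (dx (W \<epsilon>)) z - b \<epsilon> z * dx (dx (u \<epsilon>)) z))"
        by (intro growth_multi_pd_diff[OF oX _ _ S \<beta>(1)] smooth_diff[OF oX] smooth_mult[OF oX]
            sm_G sm_b smooth_dx sm_W sm_u wxx bxx growth_subset[OF reg_G[OF \<beta>(1)] S])
      have "growth ?S P (\<lambda>\<epsilon>. multi_pd ?\<beta> (dt (dt (u \<epsilon>))))"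
        by (rule growth_multi_pd_cong[OF oX _ d]) (use S in \<open>auto simp: G_eq\<close>)
      then have "growth ?S P (\<lambda>\<epsilon>. multi_pd (?\<beta> @ [(0, 1), (0, 1)]) (u \<epsilon>))" unfolding multi_pd_tt .
      then show ?thesis using \<beta>(1) basis by (intro perm[OF m]) auto
    qed
  }
qed

lemma growth_initial:
  "\<alpha> \<in> lists Basis \<Longrightarrow> growth (\<lambda>\<epsilon>. (\<lambda>x. (x, h \<epsilon>)) ` I01) P (\<lambda>\<epsilon>. multi_pd \<alpha> (u \<epsilon>))"
  by (rule growth_initial_aux[of _ "count (mset \<alpha>) (0, 1)"]) auto

subsection \<open>Energy estimates\<close>

abbreviation msq :: "real \<Rightarrow> (real \<times> real \<Rightarrow> complex) \<Rightarrow> real \<Rightarrow> real" where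
  "msq \<epsilon> f t \<equiv> integral {h \<epsilon>..1 - h \<epsilon>} (\<lambda>x. (norm (f (x, t)))\<^sup>2)"

text \<open>The order is twice \<open>P\<close> because the mean squares are not followed by a root.\<close>

definition slice_growth :: "(real \<times> real) family \<Rightarrow> bool" where
  "slice_growth w \<longleftrightarrow> growth (\<lambda>\<epsilon>. {h \<epsilon>..<T}) (2 * P) (\<lambda>\<epsilon> t. msq \<epsilon> (w \<epsilon>) t)"

lemma slice_in_X: "0 < \<epsilon> \<Longrightarrow> \<epsilon> \<le> 1 \<Longrightarrow> x \<in> {h \<epsilon>..1 - h \<epsilon>} \<Longrightarrow> t \<in> {h \<epsilon>..<T} \<Longrightarrow> (x, t) \<in> X"
  using h[of \<epsilon>] by (auto simp: X_dom_def)

lemma slice_continuous: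
  fixes f :: "real \<times> real \<Rightarrow> complex"
  assumes "continuous_on X f" "0 < \<epsilon>" "\<epsilon> \<le> 1" "t \<in> {h \<epsilon>..<T}"
  shows "continuous_on {h \<epsilon>..1 - h \<epsilon>} (\<lambda>x. f (x, t))"
  using slice_in_X[OF assms(2,3) _ assms(4)]
  by (intro continuous_on_compose2[OF assms(1)] continuous_intros) auto

lemma slice_integrable:
  fixes f :: "real \<times> real \<Rightarrow> complex"
  assumes "continuous_on X f" "0 < \<epsilon>" "\<epsilon> \<le> 1" "t \<in> {h \<epsilon>..<T}"
  shows "(\<lambda>x. (norm (f (x, t)))\<^sup>2) integrable_on {h \<epsilon>..1 - h \<epsilon>}"
  by (intro integrable_continuous_real continuous_intros slice_continuous[OF assms])

lemma abs_integral_square [simp]: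
  fixes f :: "real \<Rightarrow> complex"
  shows "\<bar>integral S (\<lambda>x. (norm (f x))\<^sup>2)\<bar> = integral S (\<lambda>x. (norm (f x))\<^sup>2)"
proof (cases "(\<lambda>x. (norm (f x))\<^sup>2) integrable_on S")
  case True
  then show ?thesis by (intro abs_of_nonneg Henstock_Kurzweil_Integration.integral_nonneg) auto
qed (simp add: not_integrable_integral)

lemma slice_growthI:
  assumes "net_order (2 * P) m"
    and "\<forall>\<^sub>F \<epsilon> in at_right 0. \<forall>t\<in>{h \<epsilon>..<T}. msq \<epsilon> (w \<epsilon>) t \<le> m \<epsilon>"
  shows "slice_growth w"
  unfolding slice_growth_def by (intro growthI[OF assms(1)]) (simp add: assms(2))

lemma slice_growthE:
  assumes "slice_growth w"
  obtains m where "net_order (2 * P) m" "\<forall>\<epsilon>. 0 \<le> m \<epsilon>"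
    "\<forall>\<^sub>F \<epsilon> in at_right 0. \<forall>t\<in>{h \<epsilon>..<T}. msq \<epsilon> (w \<epsilon>) t \<le> m \<epsilon>"
proof -
  obtain m where m: "net_order (2 * P) m" "\<forall>\<epsilon>. 0 \<le> m \<epsilon>"
    "\<forall>\<^sub>F \<epsilon> in at_right 0. \<forall>t\<in>{h \<epsilon>..<T}. norm (msq \<epsilon> (w \<epsilon>) t) \<le> m \<epsilon>"
    using assms unfolding slice_growth_def by (rule growthE)
  then show thesis by (intro that[OF m(1,2)]) simp
qed

lemma slice_growth_cong:
  assumes "slice_growth v" "\<And>\<epsilon> z. 0 < \<epsilon> \<Longrightarrow> \<epsilon> \<le> 1 \<Longrightarrow> z \<in> X \<Longrightarrow> w \<epsilon> z = v \<epsilon> z"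
  shows "slice_growth w"
  using assms(1) unfolding slice_growth_def
  by (rule growth_cong) (auto intro!: integral_cong simp: assms(2) slice_in_X)

lemma slice_growth_add:
  assumes v: "slice_growth v" "\<And>\<epsilon>. 0 < \<epsilon> \<Longrightarrow> \<epsilon> \<le> 1 \<Longrightarrow> continuous_on X (v \<epsilon>)"
    and w: "slice_growth w" "\<And>\<epsilon>. 0 < \<epsilon> \<Longrightarrow> \<epsilon> \<le> 1 \<Longrightarrow> continuous_on X (w \<epsilon>)"
  shows "slice_growth (\<lambda>\<epsilon> z. v \<epsilon> z + w \<epsilon> z)"
proof -
  obtain m where m: "net_order (2 * P) m"
    "\<forall>\<^sub>F \<epsilon> in at_right 0. \<forall>t\<in>{h \<epsilon>..<T}. msq \<epsilon> (v \<epsilon>) t \<le> m \<epsilon>"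
    by (rule slice_growthE[OF v(1)])
  obtain n where n: "net_order (2 * P) n"
    "\<forall>\<^sub>F \<epsilon> in at_right 0. \<forall>t\<in>{h \<epsilon>..<T}. msq \<epsilon> (w \<epsilon>) t \<le> n \<epsilon>"
    by (rule slice_growthE[OF w(1)])
  show ?thesis
  proof (rule slice_growthI)
    show "net_order (2 * P) (\<lambda>\<epsilon>. 2 * m \<epsilon> + 2 * n \<epsilon>)"
      by (intro net_order_add net_order_cmult m(1) n(1))
    show "\<forall>\<^sub>F \<epsilon> in at_right 0. \<forall>t\<in>{h \<epsilon>..<T}.
        integral {h \<epsilon>..1 - h \<epsilon>} (\<lambda>x. (norm (v \<epsilon> (x, t) + w \<epsilon> (x, t)))\<^sup>2) \<le> 2 * m \<epsilon> + 2 * n \<epsilon>"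
      using m(2) n(2) eventually_unit
    proof eventually_elim
      case (elim \<epsilon>)
      then have \<epsilon>: "0 < \<epsilon>" "\<epsilon> \<le> 1" by auto
      show ?case
      proof
        fix t assume t: "t \<in> {h \<epsilon>..<T}"
        note c = slice_continuous[OF v(2)[OF \<epsilon>] \<epsilon> t] slice_continuous[OF w(2)[OF \<epsilon>] \<epsilon> t]
        note i = slice_integrable[OF v(2)[OF \<epsilon>] \<epsilon> t] slice_integrable[OF w(2)[OF \<epsilon>] \<epsilon> t]
        have "integral {h \<epsilon>..1 - h \<epsilon>} (\<lambda>x. (norm (v \<epsilon> (x, t) + w \<epsilon> (x, t)))\<^sup>2)
          \<le> integral {h \<epsilon>..1 - h \<epsilon>} (\<lambda>x. 2 * (norm (v \<epsilon> (x, t)))\<^sup>2 + 2 * (norm (w \<epsilon> (x, t)))\<^sup>2)"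
        proof (intro integral_le integrable_continuous_real continuous_intros c)
          fix x
          have "(norm (v \<epsilon> (x, t) + w \<epsilon> (x, t)))\<^sup>2 \<le> (norm (v \<epsilon> (x, t)) + norm (w \<epsilon> (x, t)))\<^sup>2"
            by (intro power_mono norm_triangle_ineq) auto
          then show "(norm (v \<epsilon> (x, t) + w \<epsilon> (x, t)))\<^sup>2 \<le> 2 * (norm (v \<epsilon> (x, t)))\<^sup>2 + 2 * (norm (w \<epsilon> (x, t)))\<^sup>2"
            using abs_2_inner_le[of "norm (v \<epsilon> (x, t))" "norm (w \<epsilon> (x, t))"] by (simp add: power2_sum)
        qed
        also have "\<dots> = 2 * msq \<epsilon> (v \<epsilon>) t
            + 2 * msq \<epsilon> (w \<epsilon>) t"
          by (rule integral_unique)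
            (intro has_integral_add has_integral_mult_right integrable_integral i)
        also have "\<dots> \<le> 2 * m \<epsilon> + 2 * n \<epsilon>" using elim t by (intro add_mono mult_left_mono) auto
        finally show "integral {h \<epsilon>..1 - h \<epsilon>} (\<lambda>x. (norm (v \<epsilon> (x, t) + w \<epsilon> (x, t)))\<^sup>2) \<le> 2 * m \<epsilon> + 2 * n \<epsilon>" .
      qed
    qed
  qed
qed

lemma slice_growth_mult:
  assumes f: "growth (\<lambda>_. X) 0 f" "\<And>\<epsilon>. 0 < \<epsilon> \<Longrightarrow> \<epsilon> \<le> 1 \<Longrightarrow> continuous_on X (f \<epsilon>)"
    and w: "slice_growth w" "\<And>\<epsilon>. 0 < \<epsilon> \<Longrightarrow> \<epsilon> \<le> 1 \<Longrightarrow> continuous_on X (w \<epsilon>)"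
  shows "slice_growth (\<lambda>\<epsilon> z. f \<epsilon> z * w \<epsilon> z)"
proof -
  obtain m where m: "net_order 0 m" "\<forall>\<^sub>F \<epsilon> in at_right 0. \<forall>z\<in>X. norm (f \<epsilon> z) \<le> m \<epsilon>"
    using f(1) unfolding growth_def by blast
  obtain n where n: "net_order (2 * P) n"
    "\<forall>\<^sub>F \<epsilon> in at_right 0. \<forall>t\<in>{h \<epsilon>..<T}. msq \<epsilon> (w \<epsilon>) t \<le> n \<epsilon>"
    by (rule slice_growthE[OF w(1)])
  show ?thesis
  proof (rule slice_growthI)
    show "net_order (2 * P) (\<lambda>\<epsilon>. (m \<epsilon>)\<^sup>2 * n \<epsilon>)"
      using net_order_mult[OF net_order_power2[OF m(1)] n(1)] by simp
    show "\<forall>\<^sub>F \<epsilon> in at_right 0. \<forall>t\<in>{h \<epsilon>..<T}.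
        integral {h \<epsilon>..1 - h \<epsilon>} (\<lambda>x. (norm (f \<epsilon> (x, t) * w \<epsilon> (x, t)))\<^sup>2) \<le> (m \<epsilon>)\<^sup>2 * n \<epsilon>"
      using m(2) n(2) eventually_unit
    proof eventually_elim
      case (elim \<epsilon>)
      then have \<epsilon>: "0 < \<epsilon>" "\<epsilon> \<le> 1" by auto
      show ?case
      proof
        fix t assume t: "t \<in> {h \<epsilon>..<T}"
        note c = slice_continuous[OF f(2)[OF \<epsilon>] \<epsilon> t] slice_continuous[OF w(2)[OF \<epsilon>] \<epsilon> t]
        have "integral {h \<epsilon>..1 - h \<epsilon>} (\<lambda>x. (norm (f \<epsilon> (x, t) * w \<epsilon> (x, t)))\<^sup>2)
          \<le> integral {h \<epsilon>..1 - h \<epsilon>} (\<lambda>x. (m \<epsilon>)\<^sup>2 * (norm (w \<epsilon> (x, t)))\<^sup>2)"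
        proof (intro integral_le integrable_continuous_real continuous_intros c)
          fix x assume "x \<in> {h \<epsilon>..1 - h \<epsilon>}"
          then have "norm (f \<epsilon> (x, t)) \<le> m \<epsilon>" using elim slice_in_X[OF \<epsilon> _ t] by blast
          then have "(norm (f \<epsilon> (x, t)))\<^sup>2 \<le> (m \<epsilon>)\<^sup>2" by (intro power_mono) auto
          then show "(norm (f \<epsilon> (x, t) * w \<epsilon> (x, t)))\<^sup>2 \<le> (m \<epsilon>)\<^sup>2 * (norm (w \<epsilon> (x, t)))\<^sup>2"
            unfolding norm_mult power_mult_distrib by (rule mult_right_mono) simp
        qed
        also have "\<dots> \<le> (m \<epsilon>)\<^sup>2 * n \<epsilon>" using elim t by (simp add: mult_left_mono)
        finally show "integral {h \<epsilon>..1 - h \<epsilon>} (\<lambda>x. (norm (f \<epsilon> (x, t) * w \<epsilon> (x, t)))\<^sup>2) \<le> (m \<epsilon>)\<^sup>2 * n \<epsilon>" .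
      qed
    qed
  qed
qed

lemma slice_growth_of_growth:
  assumes f: "growth (\<lambda>_. X) P f" "\<And>\<epsilon>. 0 < \<epsilon> \<Longrightarrow> \<epsilon> \<le> 1 \<Longrightarrow> continuous_on X (f \<epsilon>)"
  shows "slice_growth f"
proof -
  obtain m where m: "net_order P m" "\<forall>\<^sub>F \<epsilon> in at_right 0. \<forall>z\<in>X. norm (f \<epsilon> z) \<le> m \<epsilon>"
    using f(1) unfolding growth_def by blast
  show ?thesis
  proof (rule slice_growthI[OF net_order_power2[OF m(1)]])
    show "\<forall>\<^sub>F \<epsilon> in at_right 0. \<forall>t\<in>{h \<epsilon>..<T}. msq \<epsilon> (f \<epsilon>) t \<le> (m \<epsilon>)\<^sup>2"
      using m(2) eventually_unit
    proof eventually_elim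
      case (elim \<epsilon>)
      then have \<epsilon>: "0 < \<epsilon>" "\<epsilon> \<le> 1" by auto
      show ?case
      proof
        fix t assume t: "t \<in> {h \<epsilon>..<T}"
        have "msq \<epsilon> (f \<epsilon>) t \<le> integral {h \<epsilon>..1 - h \<epsilon>} (\<lambda>x. (m \<epsilon>)\<^sup>2)"
        proof (intro integral_le slice_integrable[OF f(2)[OF \<epsilon>] \<epsilon> t])
          fix x assume "x \<in> {h \<epsilon>..1 - h \<epsilon>}"
          then have "norm (f \<epsilon> (x, t)) \<le> m \<epsilon>" using elim slice_in_X[OF \<epsilon> _ t] by blast
          then show "(norm (f \<epsilon> (x, t)))\<^sup>2 \<le> (m \<epsilon>)\<^sup>2" by (intro power_mono) auto
        qed auto
        also have "\<dots> = (1 - h \<epsilon> - h \<epsilon>) * (m \<epsilon>)\<^sup>2" using h[OF \<epsilon>] by simp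
        also have "\<dots> \<le> 1 * (m \<epsilon>)\<^sup>2" using h[OF \<epsilon>] by (intro mult_right_mono) auto
        finally show "msq \<epsilon> (f \<epsilon>) t \<le> (m \<epsilon>)\<^sup>2" by simp
      qed
    qed
  qed
qed

lemma slice_growth_sum_list:
  assumes "\<And>p. p \<in> set L \<Longrightarrow> slice_growth (w p)"
    "\<And>p \<epsilon>. p \<in> set L \<Longrightarrow> 0 < \<epsilon> \<Longrightarrow> \<epsilon> \<le> 1 \<Longrightarrow> continuous_on X (w p \<epsilon>)"
  shows "slice_growth (\<lambda>\<epsilon> z. \<Sum>p\<leftarrow>L. w p \<epsilon> z)
    \<and> (\<forall>\<epsilon>. 0 < \<epsilon> \<longrightarrow> \<epsilon> \<le> 1 \<longrightarrow> continuous_on X (\<lambda>z. \<Sum>p\<leftarrow>L. w p \<epsilon> z))"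
  using assms
proof (induction L)
  case Nil
  show ?case by (auto intro!: slice_growth_of_growth growth_zero)
next
  case (Cons p L)
  then have IH: "slice_growth (\<lambda>\<epsilon> z. \<Sum>p\<leftarrow>L. w p \<epsilon> z)"
    "\<And>\<epsilon>. 0 < \<epsilon> \<Longrightarrow> \<epsilon> \<le> 1 \<Longrightarrow> continuous_on X (\<lambda>z. \<Sum>p\<leftarrow>L. w p \<epsilon> z)" by auto
  have p: "slice_growth (w p)" "\<And>\<epsilon>. 0 < \<epsilon> \<Longrightarrow> \<epsilon> \<le> 1 \<Longrightarrow> continuous_on X (w p \<epsilon>)" using Cons.prems by auto
  show ?case using slice_growth_add[OF p IH] p(2) IH(2) by (auto intro!: continuous_intros)
qed

text \<open>Differentiating the coefficient \<open>b\<close> costs only slow scale factors, and it leaves fewer time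
  derivatives on \<open>w\<close>.\<close>

lemma slice_growth_commutator:
  assumes w: "\<And>\<epsilon>. 0 < \<epsilon> \<Longrightarrow> \<epsilon> \<le> 1 \<Longrightarrow> smooth_fun_on X (w \<epsilon>)"
    and sl: "\<And>j. j < k \<Longrightarrow> slice_growth (\<lambda>\<epsilon>. multi_pd (replicate j (0, 1)) (w \<epsilon>))"
  shows "slice_growth (\<lambda>\<epsilon> z. multi_pd (replicate k (0, 1)) (\<lambda>z. b \<epsilon> z * w \<epsilon> z) z - b \<epsilon> z * multi_pd (replicate k (0, 1)) (w \<epsilon>) z)"
proof -
  let ?\<alpha> = "replicate k (0, 1) :: (real \<times> real) list"
  let ?L = "filter (\<lambda>p. length (snd p) < length ?\<alpha>) (splits ?\<alpha>)"
  let ?f = "\<lambda>p \<epsilon> z. multi_pd (fst p) (b \<epsilon>) z * multi_pd (snd p) (w \<epsilon>) z"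
  have terms: "slice_growth (?f p)" "\<And>\<epsilon>. 0 < \<epsilon> \<Longrightarrow> \<epsilon> \<le> 1 \<Longrightarrow> continuous_on X (?f p \<epsilon>)" if p: "p \<in> set ?L" for p
  proof -
    have p': "(fst p, snd p) \<in> set (splits ?\<alpha>)" "length (snd p) < k" using p by auto
    have L: "fst p \<in> lists Basis" "snd p \<in> lists Basis" using splits_lists[OF p'(1) rep_t] by auto
    have "set (snd p) \<subseteq> {(0, 1)}"
      using splits_lists(2)[OF p'(1), of "{(0, 1)}"] by (auto simp: in_lists_conv_set)
    then have sp: "snd p = replicate (length (snd p)) (0, 1)" by (intro replicate_eqI) auto
    have cb: "continuous_on X (multi_pd (fst p) (b \<epsilon>))" if "0 < \<epsilon>" "\<epsilon> \<le> 1" for \<epsilon>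
      by (rule smooth_continuous_on[OF oX sm_b[OF that] L(1)])
    have cw: "continuous_on X (multi_pd (snd p) (w \<epsilon>))" if "0 < \<epsilon>" "\<epsilon> \<le> 1" for \<epsilon>
      by (rule smooth_continuous_on[OF oX w[OF that] L(2)])
    have "slice_growth (\<lambda>\<epsilon>. multi_pd (snd p) (w \<epsilon>))" using sl[OF p'(2)] sp by simp
    then show "slice_growth (?f p)" by (intro slice_growth_mult[OF slow_b[OF L(1)] cb _ cw])
    show "continuous_on X (?f p \<epsilon>)" if "0 < \<epsilon>" "\<epsilon> \<le> 1" for \<epsilon>
      using cb[OF that] cw[OF that] by (intro continuous_intros)
  qed
  have "slice_growth (\<lambda>\<epsilon> z. \<Sum>p\<leftarrow>?L. ?f p \<epsilon> z)"
    using slice_growth_sum_list[of ?L ?f] terms by blast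
  then show ?thesis
  proof (rule slice_growth_cong)
    fix \<epsilon> :: real and z assume \<epsilon>: "0 < \<epsilon>" "\<epsilon> \<le> 1" and z: "z \<in> X"
    show "multi_pd ?\<alpha> (\<lambda>z. b \<epsilon> z * w \<epsilon> z) z - b \<epsilon> z * multi_pd ?\<alpha> (w \<epsilon>) z = (\<Sum>p\<leftarrow>?L. ?f p \<epsilon> z)"
      using multi_pd_mult_commutator[OF oX sm_b[OF \<epsilon>] w[OF \<epsilon>] rep_t z] by (simp add: case_prod_beta')
  qed
qed

lemma dt_C: "0 < \<epsilon> \<Longrightarrow> \<epsilon> \<le> 1 \<Longrightarrow> z \<in> X \<Longrightarrow> dt (C \<epsilon>) z = 0"
proof -
  assume \<epsilon>: "0 < \<epsilon>" "\<epsilon> \<le> 1" and z: "z \<in> X"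
  obtain x t where xt: "z = (x, t)" by (cases z)
  have x: "x \<in> I01" "t \<in> {0<..<T}" using z by (auto simp: xt X_dom_def)
  have "((\<lambda>t. C \<epsilon> (x, t)) has_vector_derivative dt (C \<epsilon>) z) (at t)"
    using X_dom_line_derivative(2)[OF sm_C[OF \<epsilon>]] z by (simp add: xt)
  moreover have "((\<lambda>t. C \<epsilon> (x, t)) has_vector_derivative 0) (at t)"
  proof (rule has_vector_derivative_transform_within_open)
    show "((\<lambda>t. of_real (\<kappa> \<epsilon> x) :: complex) has_vector_derivative 0) (at t)" by simp
    show "of_real (\<kappa> \<epsilon> x) = C \<epsilon> (x, s)" if "s \<in> {0<..<T}" for s
      using C_eq[OF \<epsilon>, of "(x, s)"] that x by (simp add: X_dom_def)
  qed (use x in auto)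
  ultimately show ?thesis by (rule vector_derivative_unique_at)
qed

lemma multi_pd_t_W:
  assumes \<epsilon>: "0 < \<epsilon>" "\<epsilon> \<le> 1" and z: "z \<in> X"
  shows "multi_pd (replicate k (0, 1)) (W \<epsilon>) z = C \<epsilon> z * dx (dx (multi_pd (replicate k (0, 1)) (u \<epsilon>))) z"
  using z
proof (induction k arbitrary: z)
  case 0
  then show ?case by (simp add: W_def)
next
  case (Suc k)
  let ?v = "multi_pd (replicate k (0, 1)) (u \<epsilon>)"
  have sv: "smooth_fun_on X ?v" by (rule smooth_multi_pd[OF sm_u[OF \<epsilon>] rep_t])
  have "multi_pd (replicate (Suc k) (0, 1)) (W \<epsilon>) z = dt (\<lambda>z. C \<epsilon> z * dx (dx ?v) z) z"
    using Suc by (auto intro!: pd_cong[OF oX])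
  also have "\<dots> = dt (C \<epsilon>) z * dx (dx ?v) z + C \<epsilon> z * dt (dx (dx ?v)) z"
    by (intro pd_mult smooth_differentiable0[OF oX _ Suc.prems] smooth_dx sv sm_C[OF \<epsilon>])
  also have "\<dots> = C \<epsilon> z * dx (dx (dt ?v)) z"
    using dt_C[OF \<epsilon> Suc.prems] dxx_dt[OF sv Suc.prems] by simp
  finally show ?case by simp
qed

lemma multi_pd_t_commute:
  assumes f: "smooth_fun_on X f" and z: "z \<in> X"
  shows "multi_pd (replicate k (0, 1)) (dx f) z = dx (multi_pd (replicate k (0, 1)) f) z"
    "multi_pd (replicate k (0, 1)) (dx (dx f)) z = dx (dx (multi_pd (replicate k (0, 1)) f)) z"
    "multi_pd (replicate k (0, 1)) (dt (dt f)) z = dt (dt (multi_pd (replicate k (0, 1)) f)) z"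
proof -
  have 1: "multi_pd (replicate k (0, 1)) (pd i f) z = pd i (multi_pd (replicate k (0, 1)) f) z"
    if "smooth_fun_on X f" "z \<in> X" "i \<in> Basis" for f z i
    by (rule multi_pd_pd[OF oX that(1,3) rep_t that(2)])
  have 2: "multi_pd (replicate k (0, 1)) (pd i (pd i f)) z = pd i (pd i (multi_pd (replicate k (0, 1)) f)) z"
    if i: "i \<in> Basis" for i
    using 1[OF smooth_pd[OF f i] z i] pd_cong[OF oX z 1[OF f _ i]] by simp
  show "multi_pd (replicate k (0, 1)) (dx f) z = dx (multi_pd (replicate k (0, 1)) f) z"
    "multi_pd (replicate k (0, 1)) (dx (dx f)) z = dx (dx (multi_pd (replicate k (0, 1)) f)) z"
    "multi_pd (replicate k (0, 1)) (dt (dt f)) z = dt (dt (multi_pd (replicate k (0, 1)) f)) z"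
    using 1[OF f z basis(1)] 2[OF basis(1)] 2[OF basis(2)] by auto
qed

lemma slice_growth_diff:
  assumes v: "slice_growth v" "\<And>\<epsilon>. 0 < \<epsilon> \<Longrightarrow> \<epsilon> \<le> 1 \<Longrightarrow> continuous_on X (v \<epsilon>)"
    and w: "slice_growth w" "\<And>\<epsilon>. 0 < \<epsilon> \<Longrightarrow> \<epsilon> \<le> 1 \<Longrightarrow> continuous_on X (w \<epsilon>)"
  shows "slice_growth (\<lambda>\<epsilon> z. v \<epsilon> z - w \<epsilon> z)"
proof -
  have "slice_growth (\<lambda>\<epsilon> z. - w \<epsilon> z)" using w(1) by (simp add: slice_growth_def)
  then have "slice_growth (\<lambda>\<epsilon> z. v \<epsilon> z + (- w \<epsilon> z))"
    using w(2) by (intro slice_growth_add v) (auto intro: continuous_on_minus)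
  then show ?thesis by simp
qed

definition ut :: "nat \<Rightarrow> (real \<times> real) family" where
  "ut k \<epsilon> = multi_pd (replicate k (0, 1)) (u \<epsilon>)"

definition Wt :: "nat \<Rightarrow> (real \<times> real) family" where
  "Wt k \<epsilon> = multi_pd (replicate k (0, 1)) (W \<epsilon>)"

lemma dt_ut: "dt (ut k \<epsilon>) = ut (Suc k) \<epsilon>"
  by (simp add: ut_def)

lemma sm_ut: "0 < \<epsilon> \<Longrightarrow> \<epsilon> \<le> 1 \<Longrightarrow> smooth_fun_on X (ut k \<epsilon>)"
  unfolding ut_def by (intro smooth_multi_pd sm_u rep_t)

lemma sm_Wt: "0 < \<epsilon> \<Longrightarrow> \<epsilon> \<le> 1 \<Longrightarrow> smooth_fun_on X (Wt k \<epsilon>)"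
  unfolding Wt_def by (intro smooth_multi_pd sm_W rep_t)

text \<open>The differential operator applied to the \<open>k\<close>-th time derivative of \<open>u\<close>, that is, the right-hand side
  of the equation that this derivative solves.\<close>

definition Ht :: "nat \<Rightarrow> (real \<times> real) family" where
  "Ht k \<epsilon> z = dt (dt (ut k \<epsilon>)) z + dx (dx (Wt k \<epsilon>)) z + b \<epsilon> z * dx (dx (ut k \<epsilon>)) z"

lemma continuous_Ht: "0 < \<epsilon> \<Longrightarrow> \<epsilon> \<le> 1 \<Longrightarrow> continuous_on X (Ht k \<epsilon>)"
  unfolding Ht_def[abs_def]
  by (intro continuous_intros smooth_continuous smooth_dt smooth_dx sm_ut sm_Wt sm_b)

text \<open>It is the \<open>k\<close>-th time derivative of \<open>G\<close> up to the commutator with \<open>b\<close>, since \<open>C\<close> does not depend on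
  time.\<close>

lemma slice_growth_Ht:
  assumes "\<And>j. j < k \<Longrightarrow> slice_growth (\<lambda>\<epsilon>. dx (dx (ut j \<epsilon>)))"
  shows "slice_growth (Ht k)"
proof -
  let ?t = "replicate k (0, 1) :: (real \<times> real) list"
  have sxx: "smooth_fun_on X (dx (dx (u \<epsilon>)))" if "0 < \<epsilon>" "\<epsilon> \<le> 1" for \<epsilon>
    by (intro smooth_dx sm_u that)
  have sb: "smooth_fun_on X (\<lambda>z. b \<epsilon> z * dx (dx (u \<epsilon>)) z)" if "0 < \<epsilon>" "\<epsilon> \<le> 1" for \<epsilon>
    by (intro smooth_mult[OF oX] sm_b sxx that)
  have 1: "slice_growth (\<lambda>\<epsilon> z. multi_pd ?t (\<lambda>z. b \<epsilon> z * dx (dx (u \<epsilon>)) z) z - b \<epsilon> z * multi_pd ?t (dx (dx (u \<epsilon>))) z)"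
  proof (rule slice_growth_commutator[OF sxx])
    fix j assume "j < k"
    then show "slice_growth (\<lambda>\<epsilon>. multi_pd (replicate j (0, 1)) (dx (dx (u \<epsilon>))))"
      by (rule slice_growth_cong[OF assms]) (simp add: ut_def multi_pd_t_commute(2)[OF sm_u])
  qed
  have 2: "slice_growth (\<lambda>\<epsilon>. multi_pd ?t (G \<epsilon>))"
    by (intro slice_growth_of_growth reg_G rep_t smooth_continuous smooth_multi_pd sm_G)
  have "slice_growth (\<lambda>\<epsilon> z. multi_pd ?t (G \<epsilon>) z -
     (multi_pd ?t (\<lambda>z. b \<epsilon> z * dx (dx (u \<epsilon>)) z) z - b \<epsilon> z * multi_pd ?t (dx (dx (u \<epsilon>))) z))"
    by (intro slice_growth_diff 1 2 continuous_intros smooth_continuous smooth_multi_pd sm_G rep_t sb sxx sm_b)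
  then show ?thesis
  proof (rule slice_growth_cong)
    fix \<epsilon> :: real and z assume \<epsilon>: "0 < \<epsilon>" "\<epsilon> \<le> 1" and z: "z \<in> X"
    have "multi_pd ?t (G \<epsilon>) z = multi_pd ?t (\<lambda>z. dt (dt (u \<epsilon>)) z + dx (dx (W \<epsilon>)) z) z
        + multi_pd ?t (\<lambda>z. b \<epsilon> z * dx (dx (u \<epsilon>)) z) z"
      unfolding G_eq by (rule multi_pd_add[OF oX _ sb[OF \<epsilon>] rep_t z])
        (intro smooth_add[OF oX] smooth_dt smooth_dx sm_u sm_W \<epsilon>)
    also have "multi_pd ?t (\<lambda>z. dt (dt (u \<epsilon>)) z + dx (dx (W \<epsilon>)) z) z
        = multi_pd ?t (dt (dt (u \<epsilon>))) z + multi_pd ?t (dx (dx (W \<epsilon>))) z"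
      by (rule multi_pd_add[OF oX _ _ rep_t z]) (intro smooth_dt smooth_dx sm_u sm_W \<epsilon>)+
    finally show "Ht k \<epsilon> z = multi_pd ?t (G \<epsilon>) z -
      (multi_pd ?t (\<lambda>z. b \<epsilon> z * dx (dx (u \<epsilon>)) z) z - b \<epsilon> z * multi_pd ?t (dx (dx (u \<epsilon>))) z)"
      using multi_pd_t_commute(2,3)[OF sm_u[OF \<epsilon>] z, of k] multi_pd_t_commute(2)[OF sm_W[OF \<epsilon>] z, of k]
      by (simp add: Ht_def ut_def Wt_def)
  qed
qed

lemma growth_lateral:
  shows "growth (\<lambda>\<epsilon>. {h \<epsilon>, 1 - h \<epsilon>} \<times> {0<..<T}) Q (\<lambda>\<epsilon>. dt (ut k \<epsilon>))"
    "growth (\<lambda>\<epsilon>. {h \<epsilon>, 1 - h \<epsilon>} \<times> {0<..<T}) Q (\<lambda>\<epsilon>. dx (dt (ut k \<epsilon>)))"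
proof -
  show "growth (\<lambda>\<epsilon>. {h \<epsilon>, 1 - h \<epsilon>} \<times> {0<..<T}) Q (\<lambda>\<epsilon>. dt (ut k \<epsilon>))"
    using lateral0[of Q "Suc k"] by (simp add: dt_ut ut_def)
  have sub: "{h \<epsilon>, 1 - h \<epsilon>} \<times> {0<..<T} \<subseteq> X" if "0 < \<epsilon>" "\<epsilon> \<le> 1" for \<epsilon>
    using h[OF that] by (auto simp: X_dom_def)
  have "dx (dt (ut k \<epsilon>)) z = multi_pd (replicate (Suc k) (0, 1)) (dx (u \<epsilon>)) z"
    if "0 < \<epsilon>" "\<epsilon> \<le> 1" "z \<in> {h \<epsilon>, 1 - h \<epsilon>} \<times> {0<..<T}" for \<epsilon> z
    using multi_pd_t_commute(1)[OF sm_u[OF that(1,2)] subsetD[OF sub[OF that(1,2)] that(3)], of "Suc k"]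
    unfolding dt_ut ut_def by simp
  from growth_cong[OF lateral1[of Q "Suc k"] this]
  show "growth (\<lambda>\<epsilon>. {h \<epsilon>, 1 - h \<epsilon>} \<times> {0<..<T}) Q (\<lambda>\<epsilon>. dx (dt (ut k \<epsilon>)))" .
qed

text \<open>With \<open>B = ln (r \<epsilon>)\<close> the exponential factor of the energy inequality is a power of \<open>r \<epsilon>\<close>, hence of slow
  scale: it preserves the order \<open>2 * P\<close>, whatever \<open>k\<close> is.\<close>

lemma energy_estimate:
  assumes slH: "slice_growth (Ht k)"
  shows "slice_growth (ut k)" "slice_growth (ut (Suc k))" "slice_growth (\<lambda>\<epsilon>. dx (dx (ut k \<epsilon>)))"
proof -
  let ?K = "1 + 1 / c0"
  obtain mH where mH: "net_order (2 * P) mH" "\<forall>\<epsilon>. 0 \<le> mH \<epsilon>"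
    "\<forall>\<^sub>F \<epsilon> in at_right 0. \<forall>t\<in>{h \<epsilon>..<T}. msq \<epsilon> (Ht k \<epsilon>) t \<le> mH \<epsilon>"
    by (rule slice_growthE[OF slH])
  obtain R1 where R1: "growth (\<lambda>_. X) R1 (\<lambda>\<epsilon>. dx (Wt k \<epsilon>))"
    using moderateD(3)[OF X_box mod_W, of "(1, 0) # replicate k (0, 1)"] rep_t basis by (auto simp: Wt_def)
  obtain R0 where R0: "growth (\<lambda>_. X) R0 (Wt k)"
    using moderateD(3)[OF X_box mod_W rep_t[of k]] unfolding Wt_def[abs_def] by auto
  obtain w1 where w1: "net_order R1 w1" "\<forall>\<epsilon>. 0 \<le> w1 \<epsilon>" "\<forall>\<^sub>F \<epsilon> in at_right 0. \<forall>z\<in>X. norm (dx (Wt k \<epsilon>) z) \<le> w1 \<epsilon>"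
    by (rule growthE[OF R1])
  obtain w0 where w0: "net_order R0 w0" "\<forall>\<epsilon>. 0 \<le> w0 \<epsilon>" "\<forall>\<^sub>F \<epsilon> in at_right 0. \<forall>z\<in>X. norm (Wt k \<epsilon> z) \<le> w0 \<epsilon>"
    by (rule growthE[OF R0])
  \<comment> \<open>The boundary terms are products of moderate with negligible factors.\<close>
  obtain l0 where l0: "net_order (2 * P - R1) l0" "\<forall>\<epsilon>. 0 \<le> l0 \<epsilon>"
    "\<forall>\<^sub>F \<epsilon> in at_right 0. \<forall>z\<in>{h \<epsilon>, 1 - h \<epsilon>} \<times> {0<..<T}. norm (dt (ut k \<epsilon>) z) \<le> l0 \<epsilon>"
    by (rule growthE[OF growth_lateral(1)])
  obtain l1 where l1: "net_order (2 * P - R0) l1" "\<forall>\<epsilon>. 0 \<le> l1 \<epsilon>"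
    "\<forall>\<^sub>F \<epsilon> in at_right 0. \<forall>z\<in>{h \<epsilon>, 1 - h \<epsilon>} \<times> {0<..<T}. norm (dx (dt (ut k \<epsilon>)) z) \<le> l1 \<epsilon>"
    by (rule growthE[OF growth_lateral(2)])
  define D where "D \<epsilon> = w1 \<epsilon> * l0 \<epsilon> + w0 \<epsilon> * l1 \<epsilon>" for \<epsilon>
  define G' where "G' \<epsilon> = mH \<epsilon> + 2 * D \<epsilon> + 2 * D \<epsilon>" for \<epsilon>
  have D: "net_order (2 * P) D"
    unfolding D_def using net_order_mult[OF w1(1) l0(1)] net_order_mult[OF w0(1) l1(1)]
    by (intro net_order_add) auto
  have G': "net_order (2 * P) G'" unfolding G'_def by (intro net_order_add net_order_cmult mH(1) D)
  have init: "growth (\<lambda>\<epsilon>. (\<lambda>x. (x, h \<epsilon>)) ` I01) P (ut k)" "growth (\<lambda>\<epsilon>. (\<lambda>x. (x, h \<epsilon>)) ` I01) P (\<lambda>\<epsilon>. dt (ut k \<epsilon>))"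
    "growth (\<lambda>\<epsilon>. (\<lambda>x. (x, h \<epsilon>)) ` I01) P (\<lambda>\<epsilon>. dx (dx (ut k \<epsilon>)))"
    using growth_initial[of "replicate k (0, 1)"] growth_initial[of "(0, 1) # replicate k (0, 1)"]
      growth_initial[of "(1, 0) # (1, 0) # replicate k (0, 1)"] rep_t[of k] basis
    unfolding ut_def[abs_def] by auto
  obtain i0 where i0: "net_order P i0" "\<forall>\<epsilon>. 0 \<le> i0 \<epsilon>" "\<forall>\<^sub>F \<epsilon> in at_right 0. \<forall>z\<in>(\<lambda>x. (x, h \<epsilon>)) ` I01. norm (ut k \<epsilon> z) \<le> i0 \<epsilon>"
    by (rule growthE[OF init(1)])
  obtain i1 where i1: "net_order P i1" "\<forall>\<epsilon>. 0 \<le> i1 \<epsilon>" "\<forall>\<^sub>F \<epsilon> in at_right 0. \<forall>z\<in>(\<lambda>x. (x, h \<epsilon>)) ` I01. norm (dt (ut k \<epsilon>) z) \<le> i1 \<epsilon>"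
    by (rule growthE[OF init(2)])
  obtain i2 where i2: "net_order P i2" "\<forall>\<epsilon>. 0 \<le> i2 \<epsilon>" "\<forall>\<^sub>F \<epsilon> in at_right 0. \<forall>z\<in>(\<lambda>x. (x, h \<epsilon>)) ` I01. norm (dx (dx (ut k \<epsilon>)) z) \<le> i2 \<epsilon>"
    by (rule growthE[OF init(3)])
  have gC: "growth (\<lambda>_. X) 0 C" using slow_C[of "[]"] by simp
  obtain mC where mC: "net_order 0 mC" "\<forall>\<epsilon>. 0 \<le> mC \<epsilon>" "\<forall>\<^sub>F \<epsilon> in at_right 0. \<forall>z\<in>X. norm (C \<epsilon> z) \<le> mC \<epsilon>"
    by (rule growthE[OF gC])
  define E0 where "E0 \<epsilon> = (i1 \<epsilon>)\<^sup>2 + mC \<epsilon> * (i2 \<epsilon>)\<^sup>2 + (i0 \<epsilon>)\<^sup>2" for \<epsilon>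
  have E0: "net_order (2 * P) E0"
    unfolding E0_def using net_order_mult[OF mC(1) net_order_power2[OF i2(1)]]
    by (intro net_order_add net_order_power2 i0(1) i1(1)) auto
  define M where "M \<epsilon> = exp (2 * T) * (\<bar>r \<epsilon>\<bar> powr (?K * T) * (E0 \<epsilon> + T * G' \<epsilon>))" for \<epsilon>
  have M: "net_order (2 * P) M"
  proof -
    have "?K * T > 0" using c0 T by (auto intro!: mult_pos_pos add_pos_pos)
    then have "net_order 0 (\<lambda>\<epsilon>. \<bar>r \<epsilon>\<bar> powr (?K * T))" by (rule net_order_slow_powr[OF slow_r])
    from net_order_mult[OF this net_order_add[OF E0 net_order_cmult[OF G', of T]]]
    show ?thesis unfolding M_def by (intro net_order_cmult) simp
  qed
  define e where "e \<epsilon> t x = (norm (dt (ut k \<epsilon>) (x, t)))\<^sup>2 + \<kappa> \<epsilon> x * (norm (dx (dx (ut k \<epsilon>)) (x, t)))\<^sup>2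
      + (norm (ut k \<epsilon> (x, t)))\<^sup>2" for \<epsilon> t x
  have ev: "\<forall>\<^sub>F \<epsilon> in at_right 0. 0 < \<epsilon> \<and> \<epsilon> \<le> 1 \<and>
      (\<forall>t\<in>{h \<epsilon>..<T}. integral {h \<epsilon>..1 - h \<epsilon>} (e \<epsilon> t) \<le> M \<epsilon>)"
    using mH(3) w1(3) w0(3) l0(3) l1(3) i0(3) i1(3) i2(3) mC(3) b_le eventually_unit
  proof eventually_elim
    case (elim \<epsilon>)
    then have \<epsilon>: "0 < \<epsilon>" "\<epsilon> \<le> 1" by auto
    note hh = h[OF \<epsilon>]
    have D0: "0 \<le> D \<epsilon>" unfolding D_def using w0(2) w1(2) l0(2) l1(2) by (intro add_nonneg_nonneg mult_nonneg_nonneg) auto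
    then have G0: "0 \<le> G' \<epsilon>" unfolding G'_def using mH(2) by (simp add: add_nonneg_nonneg)
    have E00: "0 \<le> E0 \<epsilon>" unfolding E0_def using mC(2) by (intro add_nonneg_nonneg mult_nonneg_nonneg) auto
    have lnr: "0 \<le> ln (r \<epsilon>)" "0 < r \<epsilon>" using r_ge[OF \<epsilon>] by auto
    have start: "integral {h \<epsilon>..1 - h \<epsilon>} (e \<epsilon> (h \<epsilon>)) \<le> E0 \<epsilon>"
    proof -
      have t: "h \<epsilon> \<in> {h \<epsilon>..<T}" using hh by auto
      have "continuous_on {h \<epsilon>..1 - h \<epsilon>} (\<kappa> \<epsilon>)"
        using \<kappa>_cont[OF \<epsilon>] by (rule continuous_on_subset) (use hh in auto)
      then have "continuous_on {h \<epsilon>..1 - h \<epsilon>} (e \<epsilon> (h \<epsilon>))"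
        unfolding e_def
        by (intro continuous_intros slice_continuous[OF _ \<epsilon> t] smooth_continuous smooth_dt smooth_dx sm_ut \<epsilon>)
      then have "integral {h \<epsilon>..1 - h \<epsilon>} (e \<epsilon> (h \<epsilon>)) \<le> integral {h \<epsilon>..1 - h \<epsilon>} (\<lambda>x. E0 \<epsilon>)"
      proof (intro integral_le integrable_continuous_real)
        fix x assume x: "x \<in> {h \<epsilon>..1 - h \<epsilon>}"
        then have x01: "x \<in> I01" using hh by auto
        then have S: "(x, h \<epsilon>) \<in> (\<lambda>x. (x, h \<epsilon>)) ` I01" by blast
        have z: "(x, h \<epsilon>) \<in> X" using slice_in_X[OF \<epsilon> x t] .
        have "\<kappa> \<epsilon> x \<le> norm (C \<epsilon> (x, h \<epsilon>))" using C_eq[OF \<epsilon> z] by simp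
        also have "\<dots> \<le> mC \<epsilon>" using elim(9) z by simp
        finally have "\<kappa> \<epsilon> x \<le> mC \<epsilon>" .
        moreover have "norm (dt (ut k \<epsilon>) (x, h \<epsilon>)) \<le> i1 \<epsilon>" "norm (dx (dx (ut k \<epsilon>)) (x, h \<epsilon>)) \<le> i2 \<epsilon>"
          "norm (ut k \<epsilon> (x, h \<epsilon>)) \<le> i0 \<epsilon>" using elim(6,7,8) S by blast+
        moreover have "0 \<le> mC \<epsilon>" using mC(2) by blast
        ultimately show "e \<epsilon> (h \<epsilon>) x \<le> E0 \<epsilon>"
          unfolding e_def E0_def by (intro add_mono mult_mono power_mono norm_ge_zero zero_le_power)
      qed auto
      also have "\<dots> = (1 - h \<epsilon> - h \<epsilon>) * E0 \<epsilon>" using hh by simp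
      also have "\<dots> \<le> 1 * E0 \<epsilon>" using hh E00 by (intro mult_right_mono) auto
      finally show ?thesis by simp
    qed
    have "integral {h \<epsilon>..1 - h \<epsilon>} (e \<epsilon> t) \<le> M \<epsilon>" if t: "t \<in> {h \<epsilon>..<T}" for t
    proof -
      have "integral {h \<epsilon>..1 - h \<epsilon>} (e \<epsilon> t) \<le> exp ((2 + ln (r \<epsilon>) * (1 + 1 / c0)) * (t - h \<epsilon>)) *
          (integral {h \<epsilon>..1 - h \<epsilon>} (e \<epsilon> (h \<epsilon>)) + (t - h \<epsilon>) * G' \<epsilon>)"
        unfolding e_def
      proof (rule energy_inequality[OF sm_ut[OF \<epsilon>] sm_Wt[OF \<epsilon>, of k] _ \<kappa>_cont[OF \<epsilon>] c0 \<kappa>_ge[OF \<epsilon>] _ continuous_Ht[OF \<epsilon>, of k]])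
        show "Wt k \<epsilon> z = \<kappa> \<epsilon> (fst z) *\<^sub>R dx (dx (ut k \<epsilon>)) z" if "z \<in> X" for z
          using multi_pd_t_W[OF \<epsilon> that] C_eq[OF \<epsilon> that] by (simp add: Wt_def ut_def scaleR_conv_of_real)
        show "dt (dt (ut k \<epsilon>)) z + dx (dx (Wt k \<epsilon>)) z + b \<epsilon> z * dx (dx (ut k \<epsilon>)) z = Ht k \<epsilon> z" for z
          by (simp add: Ht_def)
        show "norm (b \<epsilon> z) \<le> ln (r \<epsilon>)" if "z \<in> X" for z using elim(10) that by simp
        show "0 < h \<epsilon>" "0 < h \<epsilon>" "h \<epsilon> < 1 - h \<epsilon>" "1 - h \<epsilon> < 1" "h \<epsilon> \<le> t" "t < T" using hh t by auto
        fix q assume q: "h \<epsilon> \<le> q" "q \<le> t"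
        then have q': "q \<in> {h \<epsilon>..<T}" "q \<in> {0<..<T}" using t hh by auto
        have bd: "norm (dx (Wt k \<epsilon>) (x, q)) * norm (dt (ut k \<epsilon>) (x, q)) + norm (Wt k \<epsilon> (x, q)) * norm (dx (dt (ut k \<epsilon>)) (x, q)) \<le> D \<epsilon>"
          if x: "x = h \<epsilon> \<or> x = 1 - h \<epsilon>" for x
        proof -
          have "(x, q) \<in> X" using slice_in_X[OF \<epsilon> _ q'(1), of x] x hh by auto
          moreover have "(x, q) \<in> {h \<epsilon>, 1 - h \<epsilon>} \<times> {0<..<T}" using x q' by auto
          ultimately show ?thesis
            unfolding D_def using elim(2-5) w0(2) w1(2) by (intro add_mono mult_mono) auto
        qed
        show "msq \<epsilon> (Ht k \<epsilon>) q
          + 2 * (norm (dx (Wt k \<epsilon>) (h \<epsilon>, q)) * norm (dt (ut k \<epsilon>) (h \<epsilon>, q)) + norm (Wt k \<epsilon> (h \<epsilon>, q)) * norm (dx (dt (ut k \<epsilon>)) (h \<epsilon>, q)))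
          + 2 * (norm (dx (Wt k \<epsilon>) (1 - h \<epsilon>, q)) * norm (dt (ut k \<epsilon>) (1 - h \<epsilon>, q)) + norm (Wt k \<epsilon> (1 - h \<epsilon>, q)) * norm (dx (dt (ut k \<epsilon>)) (1 - h \<epsilon>, q)))
          \<le> G' \<epsilon>"
          unfolding G'_def using elim(1) q'(1) bd[of "h \<epsilon>"] bd[of "1 - h \<epsilon>"]
          by (intro add_mono mult_left_mono) auto
      qed
      also have "\<dots> \<le> exp ((2 + ln (r \<epsilon>) * ?K) * (t - h \<epsilon>)) * (E0 \<epsilon> + T * G' \<epsilon>)"
        using t hh by (intro mult_left_mono add_mono start mult_right_mono G0) auto
      also have "\<dots> \<le> exp ((2 + ln (r \<epsilon>) * ?K) * T) * (E0 \<epsilon> + T * G' \<epsilon>)"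
      proof (rule mult_right_mono)
        have "0 \<le> 2 + ln (r \<epsilon>) * ?K" using lnr c0 by (intro add_nonneg_nonneg mult_nonneg_nonneg) auto
        then have "(2 + ln (r \<epsilon>) * ?K) * (t - h \<epsilon>) \<le> (2 + ln (r \<epsilon>) * ?K) * T"
          using t hh by (intro mult_left_mono) auto
        then show "exp ((2 + ln (r \<epsilon>) * ?K) * (t - h \<epsilon>)) \<le> exp ((2 + ln (r \<epsilon>) * ?K) * T)" by simp
        show "0 \<le> E0 \<epsilon> + T * G' \<epsilon>" using E00 G0 T by simp
      qed
      also have "exp ((2 + ln (r \<epsilon>) * ?K) * T) = exp (2 * T) * \<bar>r \<epsilon>\<bar> powr (?K * T)"
        using lnr by (simp add: powr_def algebra_simps flip: exp_add)
      finally show ?thesis by (simp add: M_def mult.assoc)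
    qed
    then show ?case using \<epsilon> by blast
  qed
  have part: "slice_growth f"
    if f: "\<And>\<epsilon>. 0 < \<epsilon> \<Longrightarrow> \<epsilon> \<le> 1 \<Longrightarrow> continuous_on X (f \<epsilon>)" and a: "0 < a"
      and le: "\<And>\<epsilon> x t. 0 < \<epsilon> \<Longrightarrow> \<epsilon> \<le> 1 \<Longrightarrow> x \<in> I01 \<Longrightarrow> a * (norm (f \<epsilon> (x, t)))\<^sup>2 \<le> e \<epsilon> t x" for f a
  proof (rule slice_growthI[OF net_order_cmult[OF M, of "1 / a"]])
    show "\<forall>\<^sub>F \<epsilon> in at_right 0. \<forall>t\<in>{h \<epsilon>..<T}. msq \<epsilon> (f \<epsilon>) t \<le> 1 / a * M \<epsilon>"
      using ev
    proof eventually_elim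
      case (elim \<epsilon>)
      then have \<epsilon>: "0 < \<epsilon>" "\<epsilon> \<le> 1" by auto
      note hh = h[OF \<epsilon>]
      show ?case
      proof
        fix t assume t: "t \<in> {h \<epsilon>..<T}"
        have "continuous_on {h \<epsilon>..1 - h \<epsilon>} (\<kappa> \<epsilon>)"
          using \<kappa>_cont[OF \<epsilon>] by (rule continuous_on_subset) (use hh in auto)
        then have "continuous_on {h \<epsilon>..1 - h \<epsilon>} (e \<epsilon> t)"
          unfolding e_def
          by (intro continuous_intros slice_continuous[OF _ \<epsilon> t] smooth_continuous smooth_dt smooth_dx sm_ut \<epsilon>)
        then have "integral {h \<epsilon>..1 - h \<epsilon>} (\<lambda>x. a * (norm (f \<epsilon> (x, t)))\<^sup>2) \<le> integral {h \<epsilon>..1 - h \<epsilon>} (e \<epsilon> t)"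
          using le[OF \<epsilon>] hh
          by (intro integral_le integrable_continuous_real continuous_intros slice_continuous[OF f[OF \<epsilon>] \<epsilon> t]) auto
        then have "a * msq \<epsilon> (f \<epsilon>) t \<le> M \<epsilon>" using elim t by fastforce
        then show "msq \<epsilon> (f \<epsilon>) t \<le> 1 / a * M \<epsilon>"
          using a by (simp add: field_simps)
      qed
    qed
  qed
  have \<kappa>0: "0 \<le> \<kappa> \<epsilon> x" if "0 < \<epsilon>" "\<epsilon> \<le> 1" "x \<in> I01" for \<epsilon> x using \<kappa>_ge[OF that] c0 by simp
  show "slice_growth (ut k)"
    using \<kappa>0 by (intro part[of _ 1] smooth_continuous sm_ut) (auto simp: e_def)
  have "slice_growth (\<lambda>\<epsilon>. dt (ut k \<epsilon>))"
    using \<kappa>0 by (intro part[of _ 1] smooth_continuous smooth_dt sm_ut) (auto simp: e_def)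
  then show "slice_growth (ut (Suc k))" by (simp add: dt_ut)
  have "c0 * (norm (dx (dx (ut k \<epsilon>)) (x, t)))\<^sup>2 \<le> e \<epsilon> t x" if "0 < \<epsilon>" "\<epsilon> \<le> 1" "x \<in> I01" for \<epsilon> x t
  proof -
    have "c0 * (norm (dx (dx (ut k \<epsilon>)) (x, t)))\<^sup>2 \<le> \<kappa> \<epsilon> x * (norm (dx (dx (ut k \<epsilon>)) (x, t)))\<^sup>2"
      by (intro mult_right_mono \<kappa>_ge that) simp
    then show ?thesis unfolding e_def by (smt (verit) zero_le_power2)
  qed
  then show "slice_growth (\<lambda>\<epsilon>. dx (dx (ut k \<epsilon>)))"
    by (intro part[of _ c0] smooth_continuous smooth_dx sm_ut c0)
qed

text \<open>Of the solution, the right-hand side for \<open>k\<close> contains only second space derivatives of time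
  derivatives of order less than \<open>k\<close>.\<close>

lemma slice_growth_all:
  "slice_growth (\<lambda>\<epsilon>. dx (dx (ut k \<epsilon>))) \<and> slice_growth (ut k)"
proof (induction k rule: less_induct)
  case (less k)
  show ?case using energy_estimate[OF slice_growth_Ht] less by blast
qed

subsection \<open>Derivatives in space\<close>

definition K :: "real \<Rightarrow> (real \<times> real) set" where
  "K \<epsilon> = {h \<epsilon>..1 - h \<epsilon>} \<times> {h \<epsilon>..<T}"

lemma K_sub: "0 < \<epsilon> \<Longrightarrow> \<epsilon> \<le> 1 \<Longrightarrow> K \<epsilon> \<subseteq> X"
  unfolding K_def using slice_in_X by auto

lemma growth_of_slices:
  assumes sm: "\<And>\<epsilon>. 0 < \<epsilon> \<Longrightarrow> \<epsilon> \<le> 1 \<Longrightarrow> smooth_fun_on X (f \<epsilon>)"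
    and sl: "slice_growth f" "slice_growth (\<lambda>\<epsilon>. dx (dx (f \<epsilon>)))"
  shows "growth K P f" "growth K P (\<lambda>\<epsilon>. dx (f \<epsilon>))"
proof -
  obtain m where m: "net_order (2 * P) m"
    "\<forall>\<^sub>F \<epsilon> in at_right 0. \<forall>t\<in>{h \<epsilon>..<T}. msq \<epsilon> (f \<epsilon>) t \<le> m \<epsilon>"
    by (rule slice_growthE[OF sl(1)])
  obtain n where n: "net_order (2 * P) n"
    "\<forall>\<^sub>F \<epsilon> in at_right 0. \<forall>t\<in>{h \<epsilon>..<T}. msq \<epsilon> (dx (dx (f \<epsilon>))) t \<le> n \<epsilon>"
    by (rule slice_growthE[OF sl(2)])
  have M: "net_order P (\<lambda>\<epsilon>. sqrt (3000 * (m \<epsilon> + n \<epsilon>)))"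
    by (intro net_order_sqrt net_order_cmult net_order_add m(1) n(1))
  have ev: "\<forall>\<^sub>F \<epsilon> in at_right 0. \<forall>z\<in>K \<epsilon>. norm (f \<epsilon> z) \<le> sqrt (3000 * (m \<epsilon> + n \<epsilon>))
      \<and> norm (dx (f \<epsilon>) z) \<le> sqrt (3000 * (m \<epsilon> + n \<epsilon>))"
    using m(2) n(2) eventually_unit
  proof eventually_elim
    case (elim \<epsilon>)
    then have \<epsilon>: "0 < \<epsilon>" "\<epsilon> \<le> 1" by auto
    show ?case
    proof
      fix z assume z: "z \<in> K \<epsilon>"
      obtain x t where xt: "z = (x, t)" by (cases z)
      have x: "x \<in> {h \<epsilon>..1 - h \<epsilon>}" and t: "t \<in> {h \<epsilon>..<T}" using z by (auto simp: xt K_def)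
      let ?I = "msq \<epsilon> (f \<epsilon>) t
        + msq \<epsilon> (dx (dx (f \<epsilon>))) t"
      have d: "((\<lambda>x. g (x, t)) has_vector_derivative dx g (y, t)) (at y)"
        if "smooth_fun_on X g" "y \<in> {h \<epsilon>..1 - h \<epsilon>}" for g y
        using X_dom_line_derivative(1)[OF that(1)] slice_in_X[OF \<epsilon> that(2) t] by simp
      have len: "1 / 2 \<le> (1 - h \<epsilon>) - h \<epsilon>" "(1 - h \<epsilon>) - h \<epsilon> \<le> 1" using h[OF \<epsilon>] by auto
      have c: "continuous_on {h \<epsilon>..1 - h \<epsilon>} (\<lambda>x. dx (dx (f \<epsilon>)) (x, t))"
        by (intro slice_continuous[OF _ \<epsilon> t] smooth_continuous smooth_dx sm \<epsilon>)
      have "?I \<le> m \<epsilon> + n \<epsilon>" using elim(1,2) t by (intro add_mono) auto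
      then have I: "3000 * ?I \<le> 3000 * (m \<epsilon> + n \<epsilon>)" by (rule mult_left_mono) simp
      have "(norm (f \<epsilon> (x, t)))\<^sup>2 \<le> 3000 * ?I"
        by (rule interpolation(1)[OF len d[OF sm[OF \<epsilon>]] d[OF smooth_dx[OF sm[OF \<epsilon>]]] c x])
      moreover have "(norm (dx (f \<epsilon>) (x, t)))\<^sup>2 \<le> 3000 * ?I"
        by (rule interpolation(2)[OF len d[OF sm[OF \<epsilon>]] d[OF smooth_dx[OF sm[OF \<epsilon>]]] c x])
      ultimately have "(norm (f \<epsilon> (x, t)))\<^sup>2 \<le> 3000 * (m \<epsilon> + n \<epsilon>)" "(norm (dx (f \<epsilon>) (x, t)))\<^sup>2 \<le> 3000 * (m \<epsilon> + n \<epsilon>)"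
        using I by (auto intro: order_trans)
      then show "norm (f \<epsilon> z) \<le> sqrt (3000 * (m \<epsilon> + n \<epsilon>)) \<and> norm (dx (f \<epsilon>) z) \<le> sqrt (3000 * (m \<epsilon> + n \<epsilon>))"
        unfolding xt by (intro conjI real_le_rsqrt)
    qed
  qed
  show "growth K P f" by (rule growthI[OF M eventually_mono[OF ev]]) auto
  show "growth K P (\<lambda>\<epsilon>. dx (f \<epsilon>))" by (rule growthI[OF M eventually_mono[OF ev]]) auto
qed

lemma growth_ut: "growth K P (ut k)" "growth K P (\<lambda>\<epsilon>. dx (ut k \<epsilon>))"
  using growth_of_slices[where f="ut k", OF sm_ut] slice_growth_all[of k] by blast+

text \<open>The equation gives \<open>dx (dx W)\<close> in terms of quantities that the energy controls; interpolation then yields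
  the intermediate derivative and passes from mean squares to suprema.\<close>

lemma growth_Wt: "growth K P (Wt k)" "growth K P (\<lambda>\<epsilon>. dx (Wt k \<epsilon>))"
proof -
  have gC: "growth (\<lambda>_. X) 0 C" using slow_C[of "[]"] by simp
  have gb: "growth (\<lambda>_. X) 0 b" using slow_b[of "[]"] by simp
  have xx: "slice_growth (\<lambda>\<epsilon>. dx (dx (ut k \<epsilon>)))" using slice_growth_all by blast
  have "slice_growth (\<lambda>\<epsilon> z. C \<epsilon> z * dx (dx (ut k \<epsilon>)) z)"
    by (intro slice_growth_mult gC xx smooth_continuous smooth_dx sm_C sm_ut)
  then have 1: "slice_growth (Wt k)"
    by (rule slice_growth_cong) (simp add: Wt_def ut_def multi_pd_t_W)
  have bxx: "slice_growth (\<lambda>\<epsilon> z. b \<epsilon> z * dx (dx (ut k \<epsilon>)) z)"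
    by (intro slice_growth_mult gb xx smooth_continuous smooth_dx sm_b sm_ut)
  have "slice_growth (\<lambda>\<epsilon> z. Ht k \<epsilon> z - ut (Suc (Suc k)) \<epsilon> z - b \<epsilon> z * dx (dx (ut k \<epsilon>)) z)"
    using slice_growth_Ht[of k] slice_growth_all
    by (intro slice_growth_diff bxx continuous_intros continuous_Ht smooth_continuous smooth_dx sm_b sm_ut) auto
  then have 2: "slice_growth (\<lambda>\<epsilon>. dx (dx (Wt k \<epsilon>)))"
    by (rule slice_growth_cong) (simp add: Ht_def dt_ut)
  show "growth K P (Wt k)" "growth K P (\<lambda>\<epsilon>. dx (Wt k \<epsilon>))"
    using growth_of_slices[of "Wt k", OF sm_Wt 1 2] by blast+
qed

abbreviation "nx \<alpha> \<equiv> count (mset \<alpha>) (1 :: real, 0 :: real)"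

lemma perm_K:
  assumes "\<And>\<epsilon>. 0 < \<epsilon> \<Longrightarrow> \<epsilon> \<le> 1 \<Longrightarrow> smooth_fun_on X (f \<epsilon>)" "mset \<beta> = mset \<alpha>" "\<beta> \<in> lists Basis"
    "growth K P (\<lambda>\<epsilon>. multi_pd \<beta> (f \<epsilon>))"
  shows "growth K P (\<lambda>\<epsilon>. multi_pd \<alpha> (f \<epsilon>))"
  by (rule growth_multi_pd_perm[where S=K and f=f, OF oX _ _ assms(2-4)]) (use assms(1) K_sub in auto)

lemma growth_nx_le_1:
  assumes sm: "\<And>\<epsilon>. 0 < \<epsilon> \<Longrightarrow> \<epsilon> \<le> 1 \<Longrightarrow> smooth_fun_on X (f \<epsilon>)"
    and g: "\<And>k. growth K P (\<lambda>\<epsilon>. multi_pd (replicate k (0, 1)) (f \<epsilon>))"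
      "\<And>k. growth K P (\<lambda>\<epsilon>. dx (multi_pd (replicate k (0, 1)) (f \<epsilon>)))"
    and \<alpha>: "\<alpha> \<in> lists Basis" "nx \<alpha> \<le> 1"
  shows "growth K P (\<lambda>\<epsilon>. multi_pd \<alpha> (f \<epsilon>))"
proof -
  let ?k = "count (mset \<alpha>) (0, 1)"
  have "nx \<alpha> = 0 \<or> nx \<alpha> = 1" using \<alpha>(2) by linarith
  then show ?thesis
  proof
    assume c: "nx \<alpha> = 0"
    have m: "mset (replicate ?k (0, 1)) = mset \<alpha>" using mset_eq_replicate_append[OF \<alpha>(1)] unfolding c by simp
    show ?thesis by (rule perm_K[where f=f, OF sm m rep_t g(1)])
  next
    assume c: "nx \<alpha> = 1"
    have m: "mset ((1, 0) # replicate ?k (0, 1)) = mset \<alpha>" using mset_eq_replicate_append[OF \<alpha>(1)] unfolding c by simp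
    have L: "(1, 0) # replicate ?k (0, 1) \<in> lists (Basis :: (real \<times> real) set)" using rep_t basis by simp
    have "growth K P (\<lambda>\<epsilon>. multi_pd ((1, 0) # replicate ?k (0, 1)) (f \<epsilon>))"
      unfolding multi_pd_Cons by (rule g(2))
    from perm_K[where f=f, OF sm m L this] show ?thesis .
  qed
qed

lemma growth_u_nx_le_1: "\<alpha> \<in> lists Basis \<Longrightarrow> nx \<alpha> \<le> 1 \<Longrightarrow> growth K P (\<lambda>\<epsilon>. multi_pd \<alpha> (u \<epsilon>))"
  by (rule growth_nx_le_1[where f=u, OF sm_u]) (use growth_ut in \<open>auto simp: ut_def[abs_def]\<close>)

lemma growth_W_nx_le_1: "\<alpha> \<in> lists Basis \<Longrightarrow> nx \<alpha> \<le> 1 \<Longrightarrow> growth K P (\<lambda>\<epsilon>. multi_pd \<alpha> (W \<epsilon>))"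
  by (rule growth_nx_le_1[where f=W, OF sm_W]) (use growth_Wt in \<open>auto simp: Wt_def[abs_def]\<close>)

lemma split_xx:
  assumes "\<alpha> \<in> lists Basis" "2 \<le> nx \<alpha>"
  obtains \<gamma> where "\<gamma> \<in> lists Basis" "mset (\<gamma> @ [(1, 0), (1, 0)]) = mset \<alpha>" "nx \<alpha> = nx \<gamma> + 2"
proof -
  obtain i where i: "nx \<alpha> = i + 2" using assms(2) by (metis add.commute le_Suc_ex)
  let ?\<gamma> = "replicate i (1, 0) @ replicate (count (mset \<alpha>) (0, 1)) (0, 1) :: (real \<times> real) list"
  have "mset (?\<gamma> @ [(1, 0), (1, 0)]) = mset \<alpha>"
    using mset_eq_replicate_append[OF assms(1)] unfolding i by (simp add: ac_simps)
  then show thesis using reps by (intro that[of ?\<gamma>]) (auto simp: i)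
qed

text \<open>Dividing \<open>W = C * dx (dx u)\<close> by \<open>C\<close> turns space derivatives of \<open>W\<close> into ones of \<open>u\<close> with two more
  orders; the equation expresses \<open>dx (dx W)\<close> by derivatives of \<open>u\<close> with at most two space orders.\<close>

lemma growth_u_of_growth_W:
  assumes W: "\<And>\<delta>. \<delta> \<in> lists Basis \<Longrightarrow> nx \<delta> \<le> n \<Longrightarrow> growth K P (\<lambda>\<epsilon>. multi_pd \<delta> (W \<epsilon>))"
    and \<alpha>: "\<alpha> \<in> lists Basis" "nx \<alpha> \<le> n + 2"
  shows "growth K P (\<lambda>\<epsilon>. multi_pd \<alpha> (u \<epsilon>))"
proof (cases "nx \<alpha> \<le> 1")
  case True
  then show ?thesis by (rule growth_u_nx_le_1[OF \<alpha>(1)])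
next
  case False
  then have "2 \<le> nx \<alpha>" by simp
  then obtain \<gamma> where \<gamma>: "\<gamma> \<in> lists Basis" "mset (\<gamma> @ [(1, 0), (1, 0)]) = mset \<alpha>" "nx \<alpha> = nx \<gamma> + 2"
    by (rule split_xx[OF \<alpha>(1)])
  have "growth K P (\<lambda>\<epsilon>. multi_pd \<gamma> (dx (dx (u \<epsilon>))))"
  proof (rule growth_multi_pd_divide[where f=C and D="\<lambda>\<delta>. nx \<delta> \<le> n", OF oX _ _ _ _ c0])
    show "smooth_fun_on X (C \<epsilon>)" "smooth_fun_on X (dx (dx (u \<epsilon>)))" "K \<epsilon> \<subseteq> X" if "0 < \<epsilon>" "\<epsilon> \<le> 1" for \<epsilon>
      using that sm_C smooth_dx[OF smooth_dx[OF sm_u]] K_sub by auto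
    show "growth K 0 (\<lambda>\<epsilon>. multi_pd \<alpha> (C \<epsilon>))" if "\<alpha> \<in> lists Basis" for \<alpha>
      by (rule growth_subset[OF slow_C[OF that] K_sub])
    show "c0 \<le> norm (C \<epsilon> z)" if "0 < \<epsilon>" "\<epsilon> \<le> 1" "z \<in> X" for \<epsilon> z
    proof -
      have "fst z \<in> I01" using that(3) by (auto simp: X_dom_def)
      then show ?thesis using \<kappa>_ge[OF that(1,2), of "fst z"] C_eq[OF that] by simp
    qed
    show "growth K P (\<lambda>\<epsilon>. multi_pd \<delta> (\<lambda>z. C \<epsilon> z * dx (dx (u \<epsilon>)) z))" if "\<delta> \<in> lists Basis" "nx \<delta> \<le> n" for \<delta>
      using W[OF that] by (simp add: W_def)
    show "nx \<delta> \<le> n" if "nx \<alpha> \<le> n" "mset \<delta> \<subseteq># mset \<alpha>" for \<alpha> \<delta> using count_mono[OF that(2), of "(1, 0)"] that(1) by linarith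
  qed (use \<gamma> \<alpha>(2) in auto)
  then have "growth K P (\<lambda>\<epsilon>. multi_pd (\<gamma> @ [(1, 0), (1, 0)]) (u \<epsilon>))" unfolding multi_pd_xx .
  then show ?thesis using \<gamma>(1) basis by (intro perm_K[where f=u, OF sm_u \<gamma>(2)]) auto
qed

lemma growth_W_of_growth_u:
  assumes u: "\<And>\<alpha>. \<alpha> \<in> lists Basis \<Longrightarrow> nx \<alpha> \<le> n + 2 \<Longrightarrow> growth K P (\<lambda>\<epsilon>. multi_pd \<alpha> (u \<epsilon>))"
    and \<delta>: "\<delta> \<in> lists Basis" "nx \<delta> \<le> n + 2"
  shows "growth K P (\<lambda>\<epsilon>. multi_pd \<delta> (W \<epsilon>))"
proof (cases "nx \<delta> \<le> 1")
  case True
  then show ?thesis by (rule growth_W_nx_le_1[OF \<delta>(1)])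
next
  case False
  then have "2 \<le> nx \<delta>" by simp
  then obtain \<gamma> where \<gamma>: "\<gamma> \<in> lists Basis" "mset (\<gamma> @ [(1, 0), (1, 0)]) = mset \<delta>" "nx \<delta> = nx \<gamma> + 2"
    by (rule split_xx[OF \<delta>(1)])
  have n: "nx \<gamma> \<le> n" using \<gamma>(3) \<delta>(2) by simp
  have sb: "smooth_fun_on X (\<lambda>z. b \<epsilon> z * dx (dx (u \<epsilon>)) z)" if "0 < \<epsilon>" "\<epsilon> \<le> 1" for \<epsilon>
    by (intro smooth_mult[OF oX] smooth_dx sm_u sm_b that)
  have b0: "growth K 0 (\<lambda>\<epsilon>. multi_pd \<alpha> (b \<epsilon>))" if "\<alpha> \<in> lists Basis" for \<alpha>
    by (rule growth_subset[OF slow_b[OF that] K_sub])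
  have uxx: "growth K P (\<lambda>\<epsilon>. multi_pd \<alpha> (dx (dx (u \<epsilon>))))" if "\<alpha> \<in> lists Basis" "nx \<alpha> \<le> n" for \<alpha>
    unfolding multi_pd_xx using that basis by (intro u) auto
  have "growth K (0 + P) (\<lambda>\<epsilon>. multi_pd \<gamma> (\<lambda>z. b \<epsilon> z * dx (dx (u \<epsilon>)) z))"
    by (rule growth_multi_pd_mult[where D="\<lambda>\<alpha>. nx \<alpha> \<le> n", OF oX sm_b smooth_dx[OF smooth_dx[OF sm_u]] K_sub b0 uxx _ \<gamma>(1) n])
      (auto intro: order_trans[OF count_mono])
  then have 1: "growth K P (\<lambda>\<epsilon>. multi_pd \<gamma> (\<lambda>z. b \<epsilon> z * dx (dx (u \<epsilon>)) z))" by simp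
  have 2: "growth K P (\<lambda>\<epsilon>. multi_pd \<gamma> (dt (dt (u \<epsilon>))))"
    unfolding multi_pd_tt using \<gamma>(1) n basis by (intro u) auto
  have 3: "growth K P (\<lambda>\<epsilon>. multi_pd \<gamma> (\<lambda>z. G \<epsilon> z - dt (dt (u \<epsilon>)) z - b \<epsilon> z * dx (dx (u \<epsilon>)) z))"
    by (intro growth_multi_pd_diff[OF oX _ _ K_sub \<gamma>(1)] smooth_diff[OF oX]
        sm_G sb smooth_dt sm_u 1 2 growth_subset[OF reg_G[OF \<gamma>(1)] K_sub])
  have "growth K P (\<lambda>\<epsilon>. multi_pd \<gamma> (dx (dx (W \<epsilon>))))"
    by (rule growth_multi_pd_cong[OF oX _ 3]) (use K_sub in \<open>auto simp: G_eq\<close>)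
  then have "growth K P (\<lambda>\<epsilon>. multi_pd (\<gamma> @ [(1, 0), (1, 0)]) (W \<epsilon>))" unfolding multi_pd_xx .
  then show ?thesis using \<gamma>(1) basis by (intro perm_K[where f=W, OF sm_W \<gamma>(2)]) auto
qed

lemma growth_W_all: "\<delta> \<in> lists Basis \<Longrightarrow> nx \<delta> \<le> n + 1 \<Longrightarrow> growth K P (\<lambda>\<epsilon>. multi_pd \<delta> (W \<epsilon>))"
proof (induction n arbitrary: \<delta>)
  case 0
  then show ?case by (intro growth_W_nx_le_1) auto
next
  case (Suc n)
  have "growth K P (\<lambda>\<epsilon>. multi_pd \<alpha> (u \<epsilon>))" if "\<alpha> \<in> lists Basis" "nx \<alpha> \<le> n + 2" for \<alpha>
    using growth_u_of_growth_W[OF Suc.IH that(1)] that(2) by simp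
  then show ?case using Suc.prems by (intro growth_W_of_growth_u[of n]) auto
qed

lemma growth_u_K: "\<alpha> \<in> lists Basis \<Longrightarrow> growth K P (\<lambda>\<epsilon>. multi_pd \<alpha> (u \<epsilon>))"
  by (rule growth_u_of_growth_W[where n="nx \<alpha> + 1"]) (auto intro: growth_W_all[where n="nx \<alpha>"])

text \<open>The set \<open>K \<epsilon>\<close> is within the negligible distance \<open>2 * h \<epsilon>\<close> of every point of the domain.\<close>

lemma growth_u:
  assumes \<alpha>: "\<alpha> \<in> lists Basis"
  shows "growth (\<lambda>_. X) P (\<lambda>\<epsilon>. multi_pd \<alpha> (u \<epsilon>))"
proof -
  obtain R M where M: "net_order R M" "\<forall>\<epsilon>. 0 \<le> M \<epsilon>" "\<forall>\<^sub>F \<epsilon> in at_right 0. \<forall>x\<in>X. \<forall>y\<in>X.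
      norm (multi_pd \<alpha> (u \<epsilon>) x - multi_pd \<alpha> (u \<epsilon>) y) \<le> M \<epsilon> * norm (x - y)"
    by (rule moderate_lipschitz[OF X_box mod_u \<alpha>])
  obtain m where m: "net_order P m" "\<forall>\<epsilon>. 0 \<le> m \<epsilon>" "\<forall>\<^sub>F \<epsilon> in at_right 0. \<forall>z\<in>K \<epsilon>. norm (multi_pd \<alpha> (u \<epsilon>) z) \<le> m \<epsilon>"
    by (rule growthE[OF growth_u_K[OF \<alpha>]])
  show ?thesis
  proof (rule growthI)
    show "net_order P (\<lambda>\<epsilon>. m \<epsilon> + 2 * (M \<epsilon> * h \<epsilon>))"
      using net_order_mult[OF M(1) null_h[of "P - R"]] by (intro net_order_add net_order_cmult m(1)) auto
    show "\<forall>\<^sub>F \<epsilon> in at_right 0. \<forall>z\<in>X. norm (multi_pd \<alpha> (u \<epsilon>) z) \<le> m \<epsilon> + 2 * (M \<epsilon> * h \<epsilon>)"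
      using m(3) M(3) eventually_unit
    proof eventually_elim
      case (elim \<epsilon>)
      then have \<epsilon>: "0 < \<epsilon>" "\<epsilon> \<le> 1" by auto
      note hh = h[OF \<epsilon>]
      let ?g = "multi_pd \<alpha> (u \<epsilon>)"
      show ?case
      proof
        fix z assume z: "z \<in> X"
        obtain x t where xt: "z = (x, t)" by (cases z)
        have x: "0 < x" "x < 1" "0 < t" "t < T" using z by (auto simp: xt X_dom_def)
        define y where "y = (max (h \<epsilon>) (min x (1 - h \<epsilon>)), max (h \<epsilon>) t)"
        have yK: "y \<in> K \<epsilon>" using hh x by (auto simp: y_def K_def)
        have "norm (z - y) \<le> \<bar>x - max (h \<epsilon>) (min x (1 - h \<epsilon>))\<bar> + \<bar>t - max (h \<epsilon>) t\<bar>"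
          using norm_Pair_le[of "x - max (h \<epsilon>) (min x (1 - h \<epsilon>))" "t - max (h \<epsilon>) t"] by (simp add: xt y_def)
        also have "\<dots> \<le> h \<epsilon> + h \<epsilon>" using hh x by (intro add_mono) (auto simp: max_def min_def abs_if)
        finally have "M \<epsilon> * norm (z - y) \<le> M \<epsilon> * (h \<epsilon> + h \<epsilon>)"
          using M(2) by (intro mult_left_mono) auto
        moreover have "norm (?g z - ?g y) \<le> M \<epsilon> * norm (z - y)"
          using elim(2) z subsetD[OF K_sub[OF \<epsilon>] yK] by simp
        ultimately have "norm (?g z - ?g y) \<le> 2 * (M \<epsilon> * h \<epsilon>)" by (simp add: algebra_simps)
        moreover have "norm (?g y) \<le> m \<epsilon>" using elim(1) yK by simp
        ultimately show "norm (?g z) \<le> m \<epsilon> + 2 * (M \<epsilon> * h \<epsilon>)"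
          using norm_triangle_sub[of "?g z" "?g y"] by simp
      qed
    qed
  qed
qed

end

section \<open>Regularity of the Colombeau solution\<close>

lemma growth_Un:
  assumes "growth S P w" "growth S' P w"
  shows "growth (\<lambda>\<epsilon>. S \<epsilon> \<union> S' \<epsilon>) P w"
proof -
  obtain m where m: "net_order P m" "\<forall>\<epsilon>. 0 \<le> m \<epsilon>" "\<forall>\<^sub>F \<epsilon> in at_right 0. \<forall>p\<in>S \<epsilon>. norm (w \<epsilon> p) \<le> m \<epsilon>"
    by (rule growthE[OF assms(1)])
  obtain n where n: "net_order P n" "\<forall>\<epsilon>. 0 \<le> n \<epsilon>" "\<forall>\<^sub>F \<epsilon> in at_right 0. \<forall>p\<in>S' \<epsilon>. norm (w \<epsilon> p) \<le> n \<epsilon>"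
    by (rule growthE[OF assms(2)])
  show ?thesis
  proof (rule growthI[OF net_order_add[OF m(1) n(1)]])
    show "\<forall>\<^sub>F \<epsilon> in at_right 0. \<forall>p\<in>S \<epsilon> \<union> S' \<epsilon>. norm (w \<epsilon> p) \<le> m \<epsilon> + n \<epsilon>"
      using m(3) n(3) by eventually_elim (use m(2) n(2) in \<open>auto intro: add_increasing add_increasing2\<close>)
  qed
qed

lemma gzero_growth:
  assumes \<Omega>: "sobolev_box \<Omega>" and v: "v \<in> gzero \<Omega>" and \<alpha>: "\<alpha> \<in> lists Basis"
  shows "growth (\<lambda>_. \<Omega>) Q (\<lambda>\<epsilon>. multi_pd \<alpha> (v \<epsilon>))"
  using growth_uminus[OF gclassD(3)[OF \<Omega> v[unfolded gzero_def] \<alpha>, of Q]] by (simp add: multi_pd_const)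

context side
begin

lemma tr_memI:
  assumes u: "u \<in> U" "u \<in> moderate (X_dom T)" and F: "\<And>f. F f = tr f"
  shows "(\<lambda>\<epsilon>. tr (u \<epsilon>)) \<in> glift {p<..<q} F U"
  using glift_memI[OF box(2) u(1), of F] moderate_tr[OF u(2)] F by simp

lemma replicate_lists: "replicate k (1 :: real) \<in> lists Basis"
  by (auto simp: in_lists_conv_set)

end

theorem theorem3p4:
  fixes T :: real
    and b g u :: "(real \<times> real) gfun"
    and c f1 f2 :: "real gfun"
  assumes "T > 0"
    and "b \<in> colombeau (X_dom T)" and "slow_scale_derivs (X_dom T) b"
    and "c \<in> colombeau I01" and "slow_scale_derivs I01 c"
    and "bounded_positive I01 c"
    and "slow_scale_log_type (X_dom T) b"
    and "f1 \<in> regular I01" and "gvanishes_at I01 f1 0" and "gvanishes_at I01 f1 1"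
    and "f2 \<in> regular I01"
    and "g \<in> regular (X_dom T)"
    and "colombeau_solution T b c g f1 f2 u"
  shows "u \<in> regular (X_dom T)"
proof -
  let ?X = "X_dom T"
  have X: "sobolev_box ?X" by (rule sobolev_box_X_dom[OF \<open>T > 0\<close>])
  have I: "sobolev_box I01" and J: "sobolev_box {0<..<T}"
    using \<open>T > 0\<close> by (auto intro: sobolev_box_interval)
  have bas: "(1, 0) \<in> (Basis :: (real \<times> real) set)" "(0, 1) \<in> (Basis :: (real \<times> real) set)"
    by (auto simp: Basis_real_prod)
  have uC: "u \<in> colombeau ?X"
    and eq: "gadd ?X (gadd ?X (gdt T (gdt T u)) (gdx T (gdx T (gmult ?X (embed_x T c) (gdx T (gdx T u))))))
       (gmult ?X b (gdx T (gdx T u))) = g"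
    and t0: "restrict_t0 T u = f1" and t1: "restrict_t0 T (gdt T u) = f2"
    and x0: "restrict_x T 0 u = gzero {0<..<T}" "restrict_x T 1 u = gzero {0<..<T}"
    and x1: "restrict_x T 0 (gdx T u) = gzero {0<..<T}" "restrict_x T 1 (gdx T u) = gzero {0<..<T}"
    using assms(13) unfolding colombeau_solution_def by blast+

  \<comment> \<open>Of \<open>b\<close> and \<open>c\<close> the representatives with the pointwise bounds are used; the slow scale estimates
    transfer to them.\<close>
  obtain w where w: "w \<in> moderate ?X" and uw: "u = gclass ?X w" using uC by (rule colombeau_memD)
  have wu: "w \<in> u" unfolding uw by (rule in_gclass_self[OF X w])
  obtain b1 r e0 where b1: "b1 \<in> b" and r: "slow_scale r" "\<forall>\<epsilon>\<in>{0<..1}. (1::real) \<le> r \<epsilon>"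
    and e0: "e0 \<in> {0<..1}" and blog: "\<forall>\<epsilon>\<in>{0<..e0}. Linf_norm ?X (b1 \<epsilon>) \<le> ereal (ln (r \<epsilon>))"
    using assms(7) unfolding slow_scale_log_type_def by blast
  have mb: "b1 \<in> moderate ?X" by (rule colombeau_moderate[OF X assms(2) b1])
  obtain c1 c0 c00 where c1: "c1 \<in> c" and c0: "0 < c0"
    and cpos: "\<forall>\<epsilon>\<in>{0<..1}. \<forall>x\<in>I01. c1 \<epsilon> x \<in> \<real> \<and> c0 \<le> Re (c1 \<epsilon> x) \<and> Re (c1 \<epsilon> x) \<le> c00"
    using assms(6) unfolding bounded_positive_def by blast
  have mc: "c1 \<in> moderate I01" by (rule colombeau_moderate[OF I assms(4) c1])
  define C :: "(real \<times> real) family" where "C \<epsilon> = (\<lambda>(x, t). c1 \<epsilon> x)" for \<epsilon>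
  have mC: "C \<in> moderate ?X" unfolding C_def[abs_def] by (rule moderate_embed[OF \<open>T > 0\<close> mc])

  \<comment> \<open>All families that occur are moderate, so \<open>G\<close> belongs to the class on the left-hand side, which is \<open>g\<close>.\<close>
  define G where "G \<epsilon> = (\<lambda>z. dt (dt (w \<epsilon>)) z + dx (dx (\<lambda>z. C \<epsilon> z * dx (dx (w \<epsilon>)) z)) z + b1 \<epsilon> z * dx (dx (w \<epsilon>)) z)" for \<epsilon>
  have mwt: "(\<lambda>\<epsilon>. dt (w \<epsilon>)) \<in> moderate ?X" and mwx: "(\<lambda>\<epsilon>. dx (w \<epsilon>)) \<in> moderate ?X"
    by (intro moderate_pd[OF X w] bas)+
  have mwtt: "(\<lambda>\<epsilon>. dt (dt (w \<epsilon>))) \<in> moderate ?X" and mwxx: "(\<lambda>\<epsilon>. dx (dx (w \<epsilon>))) \<in> moderate ?X"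
    using moderate_pd[OF X mwt bas(2)] moderate_pd[OF X mwx bas(1)] by auto
  have mW: "(\<lambda>\<epsilon> z. C \<epsilon> z * dx (dx (w \<epsilon>)) z) \<in> moderate ?X" by (rule moderate_mult[OF X mC mwxx])
  have mWx: "(\<lambda>\<epsilon>. dx (\<lambda>z. C \<epsilon> z * dx (dx (w \<epsilon>)) z)) \<in> moderate ?X" by (rule moderate_pd[OF X mW bas(1)])
  have mWxx: "(\<lambda>\<epsilon>. dx (dx (\<lambda>z. C \<epsilon> z * dx (dx (w \<epsilon>)) z))) \<in> moderate ?X" by (rule moderate_pd[OF X mWx bas(1)])
  have mbw: "(\<lambda>\<epsilon> z. b1 \<epsilon> z * dx (dx (w \<epsilon>)) z) \<in> moderate ?X" by (rule moderate_mult[OF X mb mwxx])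
  have wt: "(\<lambda>\<epsilon>. dt (w \<epsilon>)) \<in> gdt T u" and wx: "(\<lambda>\<epsilon>. dx (w \<epsilon>)) \<in> gdx T u"
    by (intro gpd_memI[OF X wu w] bas)+
  have wtt: "(\<lambda>\<epsilon>. dt (dt (w \<epsilon>))) \<in> gdt T (gdt T u)" by (rule gpd_memI[OF X wt mwt bas(2)])
  have wxx: "(\<lambda>\<epsilon>. dx (dx (w \<epsilon>))) \<in> gdx T (gdx T u)" by (rule gpd_memI[OF X wx mwx bas(1)])
  have Cc: "C \<in> embed_x T c"
    unfolding embed_x_def using glift_memI[OF X c1, of "\<lambda>f (x, t). f x"] mC by (simp add: C_def[abs_def])
  have W: "(\<lambda>\<epsilon> z. C \<epsilon> z * dx (dx (w \<epsilon>)) z) \<in> gmult ?X (embed_x T c) (gdx T (gdx T u))"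
    by (rule gmult_memI[OF X Cc wxx mC mwxx])
  have Wxx: "(\<lambda>\<epsilon>. dx (dx (\<lambda>z. C \<epsilon> z * dx (dx (w \<epsilon>)) z))) \<in>
      gdx T (gdx T (gmult ?X (embed_x T c) (gdx T (gdx T u))))"
    by (rule gpd_memI[OF X gpd_memI[OF X W mW bas(1)] mWx bas(1)])
  have Gg: "G \<in> g"
    unfolding G_def[abs_def] eq[symmetric]
    by (rule gadd_memI[OF X gadd_memI[OF X wtt Wxx mwtt mWxx] gmult_memI[OF X b1 wxx mb mwxx]
          moderate_add[OF X mwtt mWxx] mbw])

  obtain Pg where Pg: "0 \<le> Pg" "\<And>u \<alpha>. u \<in> g \<Longrightarrow> \<alpha> \<in> lists Basis \<Longrightarrow> growth (\<lambda>_. ?X) Pg (\<lambda>\<epsilon>. multi_pd \<alpha> (u \<epsilon>))"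
    using regular_growth[OF X assms(12)] by blast
  obtain P1 where P1: "0 \<le> P1" "\<And>u \<alpha>. u \<in> f1 \<Longrightarrow> \<alpha> \<in> lists Basis \<Longrightarrow> growth (\<lambda>_. I01) P1 (\<lambda>\<epsilon>. multi_pd \<alpha> (u \<epsilon>))"
    using regular_growth[OF I assms(8)] by blast
  obtain P2 where P2: "0 \<le> P2" "\<And>u \<alpha>. u \<in> f2 \<Longrightarrow> \<alpha> \<in> lists Basis \<Longrightarrow> growth (\<lambda>_. I01) P2 (\<lambda>\<epsilon>. multi_pd \<alpha> (u \<epsilon>))"
    using regular_growth[OF I assms(11)] by blast
  define P where "P = max (max P1 P2) Pg"

  \<comment> \<open>The distance \<open>h \<epsilon>\<close> is positive but negligible; \<open>h0\<close> keeps half of the space interval.\<close>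
  define h0 where "h0 = min (1 / 4) (T / 2)"
  define h where "h \<epsilon> = h0 * \<epsilon> powr (1 / \<epsilon>)" for \<epsilon> :: real
  have h: "0 < h \<epsilon> \<and> h \<epsilon> \<le> 1 / 4 \<and> h \<epsilon> < T \<and> h \<epsilon> < 1" if "0 < \<epsilon>" "\<epsilon> \<le> 1" for \<epsilon>
  proof -
    have "0 < h0" "h0 \<le> 1 / 4" "h0 < T" using \<open>T > 0\<close> by (auto simp: h0_def)
    moreover have "0 < \<epsilon> powr (1 / \<epsilon>)" "\<epsilon> powr (1 / \<epsilon>) \<le> 1" using that by (auto intro!: powr_le1)
    then have "0 < h \<epsilon>" "h \<epsilon> \<le> h0"
      using \<open>0 < h0\<close> unfolding h_def by (auto intro: mult_left_le)
    ultimately show ?thesis by auto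
  qed
  have hn: "net_order Q h" for Q unfolding h_def by (rule net_order_negligible)

  interpret initial: side T 0 1 "(0, 0)" "(1, 0)" "(0, 1)" T
    by unfold_locales (use \<open>T > 0\<close> in \<open>auto simp: X_dom_def Basis_real_prod norm_Pair\<close>)
  interpret left: side T 0 T "(0, 0)" "(0, 1)" "(1, 0)" 1
    by unfold_locales (use \<open>T > 0\<close> in \<open>auto simp: X_dom_def Basis_real_prod norm_Pair\<close>)
  interpret right: side T 0 T "(1, 0)" "(0, 1)" "(- 1, 0)" 1
    by unfold_locales (use \<open>T > 0\<close> in \<open>auto simp: X_dom_def Basis_real_prod norm_Pair\<close>)

  have i0: "growth (\<lambda>\<epsilon>. (\<lambda>x. (x, h \<epsilon>)) ` I01) P (\<lambda>\<epsilon>. multi_pd (replicate k (1, 0)) (w \<epsilon>))" for k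
  proof -
    have "(\<lambda>\<epsilon>. initial.tr (w \<epsilon>)) \<in> f1"
      unfolding t0[symmetric] restrict_t0_def by (rule initial.tr_memI[OF wu w]) (simp add: initial.tr_def fun_eq_iff)
    then have "growth (\<lambda>_. I01) P1 (\<lambda>\<epsilon>. multi_pd (replicate k 1) (initial.tr (w \<epsilon>)))"
      by (rule P1(2)[OF _ initial.replicate_lists])
    then have "growth (\<lambda>_. I01) P (\<lambda>\<epsilon>. multi_pd (replicate k 1) (initial.tr (w \<epsilon>)))"
      by (rule growth_mono) (simp add: P_def)
    from initial.growth_near_side[OF w _ hn this] show ?thesis using h by simp
  qed
  have i1: "growth (\<lambda>\<epsilon>. (\<lambda>x. (x, h \<epsilon>)) ` I01) P (\<lambda>\<epsilon>. multi_pd (replicate k (1, 0)) (dt (w \<epsilon>)))" for k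
  proof -
    have "(\<lambda>\<epsilon>. initial.tr (dt (w \<epsilon>))) \<in> f2"
      unfolding t1[symmetric] restrict_t0_def by (rule initial.tr_memI[OF wt mwt]) (simp add: initial.tr_def fun_eq_iff)
    then have "growth (\<lambda>_. I01) P2 (\<lambda>\<epsilon>. multi_pd (replicate k 1) (initial.tr (dt (w \<epsilon>))))"
      by (rule P2(2)[OF _ initial.replicate_lists])
    then have "growth (\<lambda>_. I01) P (\<lambda>\<epsilon>. multi_pd (replicate k 1) (initial.tr (dt (w \<epsilon>))))"
      by (rule growth_mono) (simp add: P_def)
    from initial.growth_near_side[OF mwt _ hn this] show ?thesis using h by simp
  qed
  have lat: "growth (\<lambda>\<epsilon>. {h \<epsilon>, 1 - h \<epsilon>} \<times> {0<..<T}) Q (\<lambda>\<epsilon>. multi_pd (replicate k (0, 1)) (v \<epsilon>))"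
    if v: "v \<in> V" "v \<in> moderate ?X" and V: "restrict_x T 0 V = gzero {0<..<T}" "restrict_x T 1 V = gzero {0<..<T}"
    for v V k Q
  proof -
    have "(\<lambda>\<epsilon>. left.tr (v \<epsilon>)) \<in> gzero {0<..<T}"
      unfolding V(1)[symmetric] restrict_x_def by (rule left.tr_memI[OF v]) (simp add: left.tr_def fun_eq_iff)
    from left.growth_near_side[OF v(2) _ hn gzero_growth[OF J this left.replicate_lists]]
    have 1: "growth (\<lambda>\<epsilon>. (\<lambda>s. (h \<epsilon>, s)) ` {0<..<T}) Q (\<lambda>\<epsilon>. multi_pd (replicate k (0, 1)) (v \<epsilon>))"
      using h by simp
    have "(\<lambda>\<epsilon>. right.tr (v \<epsilon>)) \<in> gzero {0<..<T}"
      unfolding V(2)[symmetric] restrict_x_def by (rule right.tr_memI[OF v]) (simp add: right.tr_def fun_eq_iff)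
    from right.growth_near_side[OF v(2) _ hn gzero_growth[OF J this right.replicate_lists]]
    have 2: "growth (\<lambda>\<epsilon>. (\<lambda>s. (1 - h \<epsilon>, s)) ` {0<..<T}) Q (\<lambda>\<epsilon>. multi_pd (replicate k (0, 1)) (v \<epsilon>))"
      using h by simp
    show ?thesis by (rule growth_subset[OF growth_Un[OF 1 2]]) auto
  qed

  interpret beam_family T P c0 w b1 C G "\<lambda>\<epsilon> x. Re (c1 \<epsilon> x)" r h
  proof
    show "growth (\<lambda>_. ?X) 0 (\<lambda>\<epsilon>. multi_pd \<alpha> (b1 \<epsilon>))" if "\<alpha> \<in> lists Basis" for \<alpha>
      by (rule slow_scale_derivs_growth[OF X assms(2,3) b1 that])
    show "growth (\<lambda>_. ?X) 0 (\<lambda>\<epsilon>. multi_pd \<alpha> (C \<epsilon>))" if \<alpha>: "\<alpha> \<in> lists Basis" for \<alpha>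
      unfolding C_def
      by (rule growth_embed[OF moderateD(2)[OF I mc] \<alpha> slow_scale_derivs_growth[OF I assms(4,5) c1 initial.replicate_lists]])
    show "C \<epsilon> z = of_real (Re (c1 \<epsilon> (fst z)))" if "0 < \<epsilon>" "\<epsilon> \<le> 1" "z \<in> ?X" for \<epsilon> z
      using that cpos by (auto simp: C_def X_dom_def complex_is_Real_iff complex_eq_iff)
    show "c0 \<le> Re (c1 \<epsilon> x)" if "0 < \<epsilon>" "\<epsilon> \<le> 1" "x \<in> I01" for \<epsilon> x using that cpos by auto
    show "continuous_on I01 (\<lambda>x. Re (c1 \<epsilon> x))" if "0 < \<epsilon>" "\<epsilon> \<le> 1" for \<epsilon>
      using smooth_continuous_on[OF _ moderateD(2)[OF I mc that], of "[]"] by (intro continuous_intros) auto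
    show "\<forall>\<^sub>F \<epsilon> in at_right 0. \<forall>z\<in>?X. norm (b1 \<epsilon> z) \<le> ln (r \<epsilon>)"
    proof (rule eventually_mono)
      show "\<forall>\<^sub>F \<epsilon> in at_right 0. \<epsilon> \<in> {0<..<e0}" using eventually_at_right_real[of 0 e0] e0 by simp
      fix \<epsilon> assume e: "\<epsilon> \<in> {0<..<e0}"
      then have \<epsilon>: "0 < \<epsilon>" "\<epsilon> \<le> 1" "\<epsilon> \<in> {0<..e0}" using e0 by auto
      have "continuous_on ?X (b1 \<epsilon>)" by (rule smooth_continuous[OF moderateD(2)[OF X mb \<epsilon>(1,2)]])
      then show "\<forall>z\<in>?X. norm (b1 \<epsilon> z) \<le> ln (r \<epsilon>)"
        using norm_le_of_Linf_norm[OF open_X_dom] blog \<epsilon>(3) by blast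
    qed
    show "net_order 0 r" using net_order_slow_scale[OF r(1)] by (simp add: net_order_abs)
    show "1 \<le> r \<epsilon>" if "0 < \<epsilon>" "\<epsilon> \<le> 1" for \<epsilon> using r(2) that by auto
    show "growth (\<lambda>_. ?X) P (\<lambda>\<epsilon>. multi_pd \<alpha> (G \<epsilon>))" if "\<alpha> \<in> lists Basis" for \<alpha>
      by (rule growth_mono[OF Pg(2)[OF Gg that]]) (simp add: P_def)
    show "0 < h \<epsilon> \<and> h \<epsilon> \<le> 1 / 4 \<and> h \<epsilon> < T" if "0 < \<epsilon>" "\<epsilon> \<le> 1" for \<epsilon> using h[OF that] by blast
  qed (use \<open>T > 0\<close> w mb mC c0 G_def hn i0 i1 lat[OF wu w x0] lat[OF wx mwx x1] in auto)
  have "0 \<le> P" using Pg(1) by (simp add: P_def)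
  then show ?thesis by (rule regularI[OF X uC wu _ growth_u])
qed

end
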